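(* Let $G$ be an $m$-uniform hypergraph containing a free node $x$. Then $$j(I(G))=j(I(G-x)).$$
   Context: A hypergraph $G$ has a finite non-empty node set $V(G)$ and an edge set $E(G)$ consisting of subsets of $V(G)$; it is $m$-uniform ($m\ge1$) if every edge has exactly $m$ elements. A node $x$ is free if it is contained in exactly one edge of $G$. $G-x$ is the hypergraph with node set $V(G)\setminus\{x\}$ whose edges are the edges of $G$ not containing $x$ (since node sets are non-empty, $G$ has at least two nodes here). Fix a field $\Bbbk$ and view nodes as indeterminates. The edge ideal of a hypergraph with nodes $x_1,\dots,x_n$ is $I(G)=(x_{i_1}\cdots x_{i_m}:\{x_{i_1},\dots,x_{i_m}\}\in E(G))\subset\Bbbk[x_1,\dots,x_n]_{(x_1,\dots,x_n)}$; $I(G-x)$ is taken in the analogous local ring whose variables are the nodes in $V(G)\setminus\{x\}$. For an ideal $I$ in a Noetherian local ring $(R,\mathfrak m)$ of dimension $n\ge1$, the $j$-multiplicity is $j(I)=(n-1)!\lim_{t\to\infty}\lambda_R(\Gamma_{\mathfrak m}(I^t/I^{t+1}))/t^{n-1}$, where $\lambda_R$ is length and $\Gamma_{\mathfrak m}$ is the zeroth local cohomology. *)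

theory Defs
  imports
    "HOL-Algebra.Module"
    "HOL-Algebra.QuotRing"
    "HOL-Algebra.Ideal_Product"
    "HOL-Library.Poly_Mapping"
    "HOL-Library.Extended_Real"
begin

section \<open>Hypergraphs\<close>

record 'v hypergraph =
  nodes :: "'v set"
  edges :: "'v set set"

definition hypergraph :: "'v hypergraph \<Rightarrow> bool"
  where "hypergraph G \<longleftrightarrow> finite (nodes G) \<and> nodes G \<noteq> {} \<and> edges G \<subseteq> Pow (nodes G)"

definition uniform :: "nat \<Rightarrow> 'v hypergraph \<Rightarrow> bool"
  where "uniform m G \<longleftrightarrow> 1 \<le> m \<and> (\<forall>e\<in>edges G. card e = m)"

definition free_node :: "'v hypergraph \<Rightarrow> 'v \<Rightarrow> bool"
  where "free_node G x \<longleftrightarrow> x \<in> nodes G \<and> (\<exists>!e. e \<in> edges G \<and> x \<in> e)"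

definition delete_node :: "'v hypergraph \<Rightarrow> 'v \<Rightarrow> 'v hypergraph"
  where "delete_node G x = \<lparr> nodes = nodes G - {x}, edges = {e \<in> edges G. x \<notin> e} \<rparr>"


section \<open>Modules: length, quotients, zeroth local cohomology\<close>

definition module_length :: "('a, 'c) ring_scheme \<Rightarrow> ('a, 'b, 'd) module_scheme \<Rightarrow> enat"
  where "module_length R M =
    Sup {enat n | n. \<exists>N :: nat \<Rightarrow> 'b set.
      (\<forall>i\<le>n. submodule (N i) R M) \<and> (\<forall>i<n. N i \<subset> N (Suc i))}"

text \<open>The record type of modules carries ring multiplication and one fields, which the
  locale \<^locale>\<open>module\<close> does not constrain; their values below are immaterial.\<close>

definition ideal_module :: "('a, 'c) ring_scheme \<Rightarrow> 'a set \<Rightarrow> ('a, 'a) module"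
  where "ideal_module R I =
    \<lparr> carrier = I, mult = mult R, one = one R, zero = zero R, add = add R, smult = mult R \<rparr>"

definition quotient_module :: "('a, 'b, 'd) module_scheme \<Rightarrow> 'b set \<Rightarrow> ('a, 'b set) module"
  where "quotient_module M N =
    \<lparr> carrier = a_rcosets\<^bsub>M\<^esub> N, mult = rcoset_mult M N, one = N +>\<^bsub>M\<^esub> \<one>\<^bsub>M\<^esub>,
      zero = N, add = set_add M, smult = (\<lambda>r X. \<Union>x\<in>X. N +>\<^bsub>M\<^esub> (r \<odot>\<^bsub>M\<^esub> x)) \<rparr>"

abbreviation ideal_power :: "('a, 'c) ring_scheme \<Rightarrow> 'a set \<Rightarrow> nat \<Rightarrow> 'a set"
  where "ideal_power R I t \<equiv> I [^]\<^bsub>ideals_set R\<^esub> t"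

text \<open>The submodule of all elements that are annihilated by some power of \<open>J\<close>.\<close>

definition local_cohomology0 ::
    "('a, 'c) ring_scheme \<Rightarrow> 'a set \<Rightarrow> ('a, 'b) module \<Rightarrow> ('a, 'b) module"
  where "local_cohomology0 R J M =
    M \<lparr> carrier := {u \<in> carrier M. \<exists>k. \<forall>a\<in>ideal_power R J k. a \<odot>\<^bsub>M\<^esub> u = \<zero>\<^bsub>M\<^esub>} \<rparr>"


section \<open>The j-multiplicity\<close>

definition krull_dim :: "('a, 'c) ring_scheme \<Rightarrow> enat"
  where "krull_dim R =
    Sup {enat n | n. \<exists>P :: nat \<Rightarrow> 'a set.
      (\<forall>i\<le>n. primeideal (P i) R) \<and> (\<forall>i<n. P i \<subset> P (Suc i))}"

definition the_maximal_ideal :: "('a, 'c) ring_scheme \<Rightarrow> 'a set"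
  where "the_maximal_ideal R = (THE M. maximalideal M R)"

text \<open>Meant for an ideal \<open>I\<close> of a Noetherian local ring \<open>R\<close> of dimension at least 1; the
  dimension is then finite. Lengths are kept in the extended reals, so that no infinite value
  is truncated.\<close>

definition j_multiplicity :: "('a, 'c) ring_scheme \<Rightarrow> 'a set \<Rightarrow> ereal"
  where "j_multiplicity R I =
    (let d = the_enat (krull_dim R) - 1 in
      ereal (fact d) *
      lim (\<lambda>t::nat. ereal_of_enat (module_length R
              (local_cohomology0 R (the_maximal_ideal R)
                (quotient_module (ideal_module R (ideal_power R I t)) (ideal_power R I (t + 1)))))
            / ereal (real t ^ d)))"


section \<open>Localization\<close>

definition fraction_rel :: "('a, 'c) ring_scheme \<Rightarrow> 'a set \<Rightarrow> (('a \<times> 'a) \<times> ('a \<times> 'a)) set"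
  where "fraction_rel R S =
    {((a, s), (b, t)) | a s b t.
      a \<in> carrier R \<and> s \<in> S \<and> b \<in> carrier R \<and> t \<in> S \<and>
      (\<exists>u\<in>S. u \<otimes>\<^bsub>R\<^esub> (a \<otimes>\<^bsub>R\<^esub> t) = u \<otimes>\<^bsub>R\<^esub> (b \<otimes>\<^bsub>R\<^esub> s))}"

definition fraction :: "('a, 'c) ring_scheme \<Rightarrow> 'a set \<Rightarrow> 'a \<Rightarrow> 'a \<Rightarrow> ('a \<times> 'a) set"
  where "fraction R S a s = fraction_rel R S `` {(a, s)}"

definition localization :: "('a, 'c) ring_scheme \<Rightarrow> 'a set \<Rightarrow> ('a \<times> 'a) set ring"
  where "localization R S =
    \<lparr> carrier = (carrier R \<times> S) // fraction_rel R S,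
      mult = (\<lambda>X Y. \<Union>(a, s)\<in>X. \<Union>(b, t)\<in>Y. fraction R S (a \<otimes>\<^bsub>R\<^esub> b) (s \<otimes>\<^bsub>R\<^esub> t)),
      one = fraction R S \<one>\<^bsub>R\<^esub> \<one>\<^bsub>R\<^esub>,
      zero = fraction R S \<zero>\<^bsub>R\<^esub> \<one>\<^bsub>R\<^esub>,
      add = (\<lambda>X Y. \<Union>(a, s)\<in>X. \<Union>(b, t)\<in>Y.
        fraction R S ((a \<otimes>\<^bsub>R\<^esub> t) \<oplus>\<^bsub>R\<^esub> (b \<otimes>\<^bsub>R\<^esub> s)) (s \<otimes>\<^bsub>R\<^esub> t)) \<rparr>"


section \<open>Polynomials and edge ideals\<close>

text \<open>A monomial is a finitely supported exponent function \<^typ>\<open>'v \<Rightarrow>\<^sub>0 nat\<close>, a polynomial a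
  finitely supported function from monomials to coefficients.\<close>

type_synonym ('v, 'k) mpoly = "('v \<Rightarrow>\<^sub>0 nat) \<Rightarrow>\<^sub>0 'k"

definition mpoly_ring :: "'k::field itself \<Rightarrow> 'v set \<Rightarrow> ('v, 'k) mpoly ring"
  where "mpoly_ring K V =
    \<lparr> carrier = {p. \<forall>\<alpha>\<in>Poly_Mapping.keys p. Poly_Mapping.keys \<alpha> \<subseteq> V},
      mult = (*), one = 1, zero = 0, add = (+) \<rparr>"

definition Var :: "'v \<Rightarrow> ('v, 'k::field) mpoly"
  where "Var v = Poly_Mapping.single (Poly_Mapping.single v 1) 1"

definition non_origin :: "'k::field itself \<Rightarrow> 'v set \<Rightarrow> ('v, 'k) mpoly set"
  where "non_origin K V =
    carrier (mpoly_ring K V) - genideal (mpoly_ring K V) (Var ` V)"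

text \<open>The polynomial ring in the variables \<open>V\<close>, localized at the ideal generated by \<open>V\<close>.\<close>

definition local_mpoly_ring ::
    "'k::field itself \<Rightarrow> 'v set \<Rightarrow> (('v, 'k) mpoly \<times> ('v, 'k) mpoly) set ring"
  where "local_mpoly_ring K V = localization (mpoly_ring K V) (non_origin K V)"

definition edge_ideal ::
    "'k::field itself \<Rightarrow> 'v hypergraph \<Rightarrow> (('v, 'k) mpoly \<times> ('v, 'k) mpoly) set set"
  where "edge_ideal K G =
    genideal (local_mpoly_ring K (nodes G))
      {fraction (mpoly_ring K (nodes G)) (non_origin K (nodes G)) (\<Prod>v\<in>e. Var v) 1 | e.
        e \<in> edges G}"

end

theory Submission
  imports Defs "HOL-Computational_Algebra.Polynomial"
begin

text \<open>Everything is graded by monomials. The module \<open>\<Gamma>\<^sub>m(I\<^sup>t / I\<^sup>t\<^sup>+\<^sup>1)\<close> has a composition series indexed by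
  the monomials \<open>u\<close> in \<open>I\<^sup>t\<close> but not in \<open>I\<^sup>t\<^sup>+\<^sup>1\<close> such that every variable has a power multiplying \<open>u\<close> into
  \<open>I\<^sup>t\<^sup>+\<^sup>1\<close>, so its length \<open>H(t)\<close> counts such monomials. By the theorem of Hilbert and Serre \<open>H\<close> is
  eventually a polynomial, and its degree is less than the number \<open>n\<close> of nodes. If the edges do not span
  \<open>\<real>\<^sup>n\<close>, then \<open>H(0) + \<dots> + H(t)\<close> is too small for the limit to be non-zero. Otherwise, up to shifting
  \<open>t\<close> by a constant, this sum is the number of lattice points of degree less than \<open>m(t + 1)\<close> in the cone
  spanned by the edges. A free node in the edge \<open>e\<close> makes the cone of \<open>G\<close> the product of the ray through \<open>e\<close>
  and the cone of \<open>G - x\<close>, compatibly with the lattice, since the coefficient of \<open>e\<close> is the exponent of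
  \<open>x\<close>. Hence summing the counts for \<open>G - x\<close> gives the counts for \<open>G\<close>, and comparing leading
  coefficients gives \<open>j(I(G)) = j(I(G - x))\<close>.\<close>

section \<open>Hilbert functions of monomial modules\<close>

text \<open>H(t) is hard to estimate directly: even deep inside the cone, the largest number of
  edges packed into a monomial of degree D is D/m only up to a bounded error, since lattice points
  of the cone need not be sums of edges. A torsion monomial belongs to exactly one t, its packing
  number, so summing H up to t turns the error into a shift of t, which disappears in the limit. The
  price is the way back: convergence of averages does not imply convergence of the sequence, so lim
  H(t)/t^(n-1) must be known to exist beforehand. This is the purpose of the theorem of Hilbert and
  Serre, combined with the bound O(t^(n-1)). The factorials match because one summation divides the
  limit for G by n, while two summations divide the limit for G - x by n(n-1). Finally, the
  j-multiplicity is normalized by the Krull dimension of the ring, so this dimension has to be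
  identified with the number of nodes.\<close>

lemma dickson:
  assumes "finite I"
  shows "\<exists>Z. finite Z \<and> Z \<subseteq> Y \<and> (\<forall>y\<in>Y. \<exists>z\<in>Z. \<forall>i\<in>I. z i \<le> (y i :: nat))"
  using assms
proof (induction I arbitrary: Y rule: finite_induct)
  case empty
  show ?case
  proof (cases "Y = {}")
    case False
    then obtain y where "y \<in> Y" by auto
    then show ?thesis by (intro exI[of _ "{y}"]) auto
  qed auto
next
  case (insert i I)
  obtain Z where Z: "finite Z" "Z \<subseteq> Y" "\<And>y. y \<in> Y \<Longrightarrow> \<exists>z\<in>Z. \<forall>i\<in>I. z i \<le> y i"
    using insert.IH[of Y] by blast
  \<comment> \<open>\<open>N\<close> bounds the new coordinate on \<open>Z\<close>. Elements of
    \<open>Y\<close> whose new coordinate is at least \<open>N\<close> are therefore dominated by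
    \<open>Z\<close>, and only the finitely many slices below \<open>N\<close> need witnesses of
    their own.\<close>
  define N where "N = (\<Sum>z\<in>Z. z i)"
  have N: "z i \<le> N" if "z \<in> Z" for z
    unfolding N_def using member_le_sum[of z Z "\<lambda>z. z i"] that Z(1) by simp
  have "\<exists>Z. finite Z \<and> Z \<subseteq> {y \<in> Y. y i = k} \<and>
      (\<forall>y\<in>{y \<in> Y. y i = k}. \<exists>z\<in>Z. \<forall>i\<in>I. z i \<le> y i)" for k
    by (rule insert.IH)
  then have "\<forall>k. \<exists>Z. finite Z \<and> Z \<subseteq> {y \<in> Y. y i = k} \<and>
      (\<forall>y\<in>{y \<in> Y. y i = k}. \<exists>z\<in>Z. \<forall>i\<in>I. z i \<le> y i)" by blast
  then obtain W where W': "\<forall>k. finite (W k) \<and> W k \<subseteq> {y \<in> Y. y i = k} \<and>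
      (\<forall>y\<in>{y \<in> Y. y i = k}. \<exists>z\<in>W k. \<forall>i\<in>I. z i \<le> y i)"
    by (rule choice[THEN exE])
  then have W: "\<And>k. finite (W k)" "\<And>k. W k \<subseteq> {y \<in> Y. y i = k}"
      "\<And>k y. y \<in> Y \<Longrightarrow> y i = k \<Longrightarrow> \<exists>z\<in>W k. \<forall>i\<in>I. z i \<le> y i"
    by auto
  show ?case
  proof (intro exI[of _ "Z \<union> (\<Union>k<N. W k)"] conjI ballI)
    show "finite (Z \<union> (\<Union>k<N. W k))" using Z W by auto
    show "Z \<union> (\<Union>k<N. W k) \<subseteq> Y" using Z(2) W(2) by fastforce
    fix y assume y: "y \<in> Y"
    show "\<exists>z\<in>Z \<union> (\<Union>k<N. W k). \<forall>j\<in>insert i I. z j \<le> y j"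
    proof (cases "y i < N")
      case True
      obtain z where "z \<in> W (y i)" "\<forall>j\<in>I. z j \<le> y j" using W(3)[OF y refl] by blast
      moreover have "z i = y i" using W(2) \<open>z \<in> W (y i)\<close> by blast
      ultimately show ?thesis using True by (intro bexI[of _ z]) auto
    next
      case False
      obtain z where "z \<in> Z" "\<forall>j\<in>I. z j \<le> y j" using Z(3)[OF y] by blast
      then show ?thesis using N[of z] False by (intro bexI[of _ z]) auto
    qed
  qed
qed

section \<open>Sequences that are eventually polynomial\<close>

definition eventually_poly :: "(nat \<Rightarrow> real) \<Rightarrow> bool"
  where "eventually_poly h \<longleftrightarrow> (\<exists>p. \<forall>\<^sub>F t in sequentially. h t = poly p (real t))"

lemma poly_antidifference:
  fixes p :: "real poly"
  shows "\<exists>q. \<forall>x. poly q (x + 1) - poly q x = poly p x"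
proof (induction "Polynomial.degree p" arbitrary: p rule: less_induct)
  case less
  define d where "d = Polynomial.degree p"
  \<comment> \<open>The difference of x^(d+1) has leading term (d+1) x^d. With this \<open>c\<close>
    the difference of \<open>q0\<close> has the same leading term as \<open>p\<close>, so the
    remainder \<open>r\<close> is zero or of smaller degree.\<close>
  define c where "c = Polynomial.lead_coeff p / real (d + 1)"
  define q0 where "q0 = Polynomial.monom c (d + 1)"
  define r where "r = p - (pcompose q0 [:1, 1:] - q0)"
  have diff: "poly (pcompose q0 [:1, 1:] - q0) x = c * ((x + 1) ^ (d + 1) - x ^ (d + 1))" for x
    by (simp add: q0_def poly_pcompose poly_monom algebra_simps)
  have diff_eq: "pcompose q0 [:1, 1:] - q0 =
      (\<Sum>k\<le>d. Polynomial.monom (c * of_nat ((d + 1) choose k)) k)"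
  proof (rule poly_ext)
    fix x :: real
    have "(x + 1) ^ (d + 1) = (\<Sum>k\<le>d + 1. of_nat ((d + 1) choose k) * x ^ k)"
      using binomial_ring[of x 1 "d + 1"] by simp
    then have "(x + 1) ^ (d + 1) - x ^ (d + 1) = (\<Sum>k\<le>d. of_nat ((d + 1) choose k) * x ^ k)"
      by simp
    then show "poly (pcompose q0 [:1, 1:] - q0) x =
        poly (\<Sum>k\<le>d. Polynomial.monom (c * of_nat ((d + 1) choose k)) k) x"
      unfolding diff by (simp add: poly_sum poly_monom sum_distrib_left mult.assoc)
  qed
  have coeff_d: "Polynomial.coeff (pcompose q0 [:1, 1:] - q0) k =
      (if k \<le> d then c * of_nat ((d + 1) choose k) else 0)" for k
    unfolding diff_eq by (simp add: coeff_sum)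
  have r: "Polynomial.coeff r k = 0" if "k \<ge> d" for k
  proof (cases "k = d")
    case True
    then show ?thesis unfolding r_def coeff_diff[of p] coeff_d by (simp add: c_def d_def)
  next
    case False
    then show ?thesis using that unfolding r_def coeff_diff[of p] coeff_d
      by (simp add: d_def coeff_eq_0)
  qed
  have "\<exists>q. \<forall>x. poly q (x + 1) - poly q x = poly r x"
  proof (cases "r = 0")
    case True
    then show ?thesis by (intro exI[of _ 0]) simp
  next
    case False
    then have "Polynomial.degree r < d" using r[of "Polynomial.degree r"] by (meson leading_coeff_neq_0 not_le)
    then show ?thesis using less d_def by blast
  qed
  then obtain q where q: "\<And>x. poly q (x + 1) - poly q x = poly r x" by blast
  have "poly (q + q0) (x + 1) - poly (q + q0) x = poly p x" for x
    using q[of x] by (simp add: r_def poly_pcompose add.commute[of 1])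
  then show ?case by blast
qed

lemma eventually_poly_diff:
  assumes "eventually_poly f" "eventually_poly g"
  shows "eventually_poly (\<lambda>t. f t - g t)"
proof -
  obtain p q where "\<forall>\<^sub>F t in sequentially. f t = poly p (real t)"
    "\<forall>\<^sub>F t in sequentially. g t = poly q (real t)"
    using assms unfolding eventually_poly_def by blast
  then have "\<forall>\<^sub>F t in sequentially. f t - g t = poly (p - q) (real t)"
    by eventually_elim simp
  then show ?thesis unfolding eventually_poly_def by blast
qed

lemma eventually_poly_Suc:
  assumes "eventually_poly f"
  shows "eventually_poly (\<lambda>t. f (Suc t))"
proof -
  obtain p where p: "\<forall>\<^sub>F t in sequentially. f t = poly p (real t)"
    using assms unfolding eventually_poly_def by blast
  have "\<forall>\<^sub>F t in sequentially. f (Suc t) = poly (pcompose p [:1, 1:]) (real t)"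
    using eventually_sequentially_Suc[THEN iffD2, OF p] by eventually_elim (simp add: poly_pcompose)
  then show ?thesis unfolding eventually_poly_def by blast
qed

lemma eventually_poly_if_difference:
  assumes "eventually_poly (\<lambda>t. h (Suc t) - h t)"
  shows "eventually_poly h"
proof -
  obtain p where "\<forall>\<^sub>F t in sequentially. h (Suc t) - h t = poly p (real t)"
    using assms unfolding eventually_poly_def by blast
  then obtain N where N: "\<And>t. t \<ge> N \<Longrightarrow> h (Suc t) - h t = poly p (real t)"
    unfolding eventually_sequentially by blast
  obtain q where q: "\<And>x. poly q (x + 1) - poly q x = poly p x"
    using poly_antidifference by blast
  define c where "c = h N - poly q (real N)"
  have "h t = poly (q + [:c:]) (real t)" if "t \<ge> N" for t
    using that
  proof (induction t rule: dec_induct)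
    case base
    then show ?case by (simp add: c_def)
  next
    case (step t)
    then show ?case using N[of t] q[of "real t"] by (simp add: algebra_simps)
  qed
  then show ?thesis unfolding eventually_poly_def eventually_sequentially by blast
qed

section \<open>Monomial modules over a polynomial ring, in exponents\<close>

text \<open>The monomial \<open>f\<close> times a product of generators, written additively:
  \<open>vec e\<close> is the exponent vector of the generator \<open>e\<close>, and
  \<open>c e\<close> is its multiplicity.\<close>

definition translate :: "'e set \<Rightarrow> ('e \<Rightarrow> 'i \<Rightarrow> nat) \<Rightarrow> ('e \<Rightarrow> nat) \<Rightarrow> ('i \<Rightarrow> nat) \<Rightarrow> 'i \<Rightarrow> nat"
  where "translate E vec c f = (\<lambda>i. f i + (\<Sum>e\<in>E. c e * vec e i))"

text \<open>Such a set spans a monomial module over the polynomial ring with variables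
  \<open>E\<close>, and a difference \<open>A - B\<close> of two such sets indexes a basis of a
  quotient module.\<close>

definition shift_closed :: "'e set \<Rightarrow> ('e \<Rightarrow> 'i \<Rightarrow> nat) \<Rightarrow> ('i \<Rightarrow> nat) set \<Rightarrow> bool"
  where "shift_closed E vec A \<longleftrightarrow> (\<forall>f\<in>A. \<forall>e\<in>E. (\<lambda>i. f i + vec e i) \<in> A)"

lemma shift_closed_mult:
  assumes "shift_closed E vec A" "f \<in> A" "e \<in> E"
  shows "(\<lambda>i. f i + n * vec e i) \<in> A"
proof (induction n)
  case 0
  then show ?case using assms by simp
next
  case (Suc n)
  have "(\<lambda>i. (f i + n * vec e i) + vec e i) \<in> A"
    using assms(1,3) Suc unfolding shift_closed_def by (elim ballE[of _ _ "\<lambda>i. f i + n * vec e i"]) auto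
  then show ?case by (simp add: algebra_simps)
qed

lemma translate_closed:
  assumes "finite F" "F \<subseteq> E" "shift_closed E vec A" "f \<in> A"
  shows "translate F vec c f \<in> A"
  using assms(1,2)
proof (induction F rule: finite_induct)
  case empty
  then show ?case using assms by (simp add: translate_def)
next
  case (insert e F)
  have "(\<lambda>i. translate F vec c f i + c e * vec e i) \<in> A"
    using insert assms(3) shift_closed_mult by (metis insert_subset)
  then show ?case using insert by (simp add: translate_def algebra_simps)
qed

text \<open>As in the usual proof of the theorem of Hilbert and Serre, adding \<open>vec e\<close> is a partial self-map of
  \<open>A - B\<close> whose kernel and cokernel are generated without \<open>e\<close>.\<close>

lemma hilbert_serre:
  assumes "finite E" "shift_closed E vec A" "shift_closed E vec B"
    and "finite G" "G \<subseteq> A" "A - B \<subseteq> {translate E vec c g | c g. g \<in> G}"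
    and "\<And>e. e \<in> E \<Longrightarrow> vec e i0 = 1"
  shows "eventually_poly (\<lambda>t. real (card {f \<in> A - B. f i0 = t}))
    \<and> (\<forall>t. finite {f \<in> A - B. f i0 = t})"
  using assms
proof (induction E arbitrary: A B G rule: finite_induct)
  case empty
  then have fin: "finite (A - B)"
    by (auto simp: translate_def intro: finite_subset)
  define N where "N = Max (insert 0 ((\<lambda>f. f i0) ` (A - B)))"
  have N: "f i0 \<le> N" if "f \<in> A - B" for f
    unfolding N_def using that fin by (intro Max_ge) auto
  have "real (card {f \<in> A - B. f i0 = t}) = poly 0 (real t)" if "t \<ge> Suc N" for t
  proof -
    have "{f \<in> A - B. f i0 = t} = {}" using N that by fastforce
    then show ?thesis by (metis card.empty of_nat_0 poly_0)
  qed
  then have "eventually_poly (\<lambda>t. real (card {f \<in> A - B. f i0 = t}))"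
    unfolding eventually_poly_def eventually_sequentially by blast
  moreover have "\<forall>t. finite {f \<in> A - B. f i0 = t}" by (auto intro: finite_subset[OF _ fin])
  ultimately show ?case by blast
next
  case (insert e E)
  define X where "X = A - B"
  define add where "add = (\<lambda>f i. f i + vec e i)"
  \<comment> \<open>\<open>AK - B\<close> is the kernel and \<open>A - BC\<close> the cokernel of
    \<open>add\<close> on \<open>A - B\<close>.\<close>
  define AK where "AK = {f \<in> A. add f \<in> B}"
  define BC where "BC = B \<union> add ` A"
  have inj: "inj add" unfolding add_def inj_def by (metis add_right_cancel ext)
  have addA: "add f \<in> A" if "f \<in> A" for f using insert.prems(1) that by (simp add: add_def shift_closed_def)
  have addB: "add f \<in> B" if "f \<in> B" for f using insert.prems(2) that by (simp add: add_def shift_closed_def)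
  have vec_e: "vec e i0 = 1" using insert.prems by simp
  have clA: "shift_closed E vec A" and clB: "shift_closed E vec B"
    using insert.prems by (auto simp: shift_closed_def)
  have comm: "(\<lambda>i. add f i + vec e' i) = add (\<lambda>i. f i + vec e' i)" for f e'
    by (auto simp: add_def)
  have clAK: "shift_closed E vec AK"
    using clA clB unfolding shift_closed_def AK_def by (auto simp flip: comm)
  have clBC: "shift_closed E vec BC"
    using clA clB unfolding shift_closed_def BC_def by (auto simp: comm)
  have split: "translate (insert e E) vec c f = (\<lambda>i. translate E vec c f i + c e * vec e i)" for c f
    using insert.hyps by (auto simp: translate_def)
  have upd: "translate E vec (c(e := n)) f = translate E vec c f" for c n f
  proof -
    have "(\<Sum>e'\<in>E. (c(e := n)) e' * vec e' i) = (\<Sum>e'\<in>E. c e' * vec e' i)" for i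
      using insert.hyps by (intro sum.cong) auto
    then show ?thesis by (simp only: translate_def)
  qed
  have gen: "\<exists>c g. g \<in> G \<and> f = translate (insert e E) vec c g" if "f \<in> X" for f
    using that insert.prems(5) unfolding X_def by blast
  have C: "eventually_poly (\<lambda>t. real (card {f \<in> A - BC. f i0 = t}))
      \<and> (\<forall>t. finite {f \<in> A - BC. f i0 = t})"
  proof (rule insert.IH[OF clA clBC insert.prems(3,4)])
    show "A - BC \<subseteq> {translate E vec c g |c g. g \<in> G}"
    proof
      fix f assume f: "f \<in> A - BC"
      then have "f \<in> X" by (auto simp: X_def BC_def)
      then obtain c g where cg: "g \<in> G" "f = translate (insert e E) vec c g" using gen by blast
      have "c e = 0"
      proof (rule ccontr)
        assume "c e \<noteq> 0"
        then obtain n where n: "c e = Suc n" using not0_implies_Suc by blast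
        have "f = add (translate (insert e E) vec (c(e := n)) g)"
          using n unfolding cg(2) split upd add_def by (simp add: algebra_simps)
        moreover have "translate (insert e E) vec (c(e := n)) g \<in> A"
          using insert.hyps(1) insert.prems(1,4) cg(1) by (intro translate_closed[where E = "insert e E"]) auto
        ultimately have "f \<in> BC" by (auto simp: BC_def)
        then show False using f by blast
      qed
      then show "f \<in> {translate E vec c g |c g. g \<in> G}" using cg split by auto
    qed
  qed (use insert.prems in auto)
  \<comment> \<open>The kernel may need generators outside \<open>G\<close>. For each
    \<open>g\<close> the multiplicities that lead from \<open>g\<close> into the kernel have
    finitely many minimal members by \<open>dickson\<close>; the corresponding translates form
    \<open>GK\<close>.\<close>
  define Y where "Y = (\<lambda>g. {c. translate (insert e E) vec c g \<in> AK - B})"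
  have "\<exists>Z. finite Z \<and> Z \<subseteq> Y g \<and> (\<forall>y\<in>Y g. \<exists>z\<in>Z. \<forall>i\<in>insert e E. z i \<le> y i)" for g
    using insert.hyps by (intro dickson) auto
  then obtain Z where Z: "\<And>g. finite (Z g)" "\<And>g. Z g \<subseteq> Y g"
      "\<And>g y. y \<in> Y g \<Longrightarrow> \<exists>z\<in>Z g. \<forall>i\<in>insert e E. z i \<le> y i"
    by metis
  define GK where "GK = (\<Union>g\<in>G. (\<lambda>c. translate (insert e E) vec c g) ` Z g)"
  have K: "eventually_poly (\<lambda>t. real (card {f \<in> AK - B. f i0 = t}))
      \<and> (\<forall>t. finite {f \<in> AK - B. f i0 = t})"
  proof (rule insert.IH[OF clAK clB])
    show "finite GK" using Z(1) insert.prems(3) by (auto simp: GK_def)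
    show "GK \<subseteq> AK" using Z(2) by (auto simp: GK_def Y_def)
    show "AK - B \<subseteq> {translate E vec c g |c g. g \<in> GK}"
    proof
      fix f assume f: "f \<in> AK - B"
      then have "f \<in> X" by (auto simp: X_def AK_def)
      then obtain c g where cg: "g \<in> G" "f = translate (insert e E) vec c g" using gen by blast
      have "c \<in> Y g" using f cg by (simp add: Y_def)
      then obtain z where z: "z \<in> Z g" "\<And>i. i \<in> insert e E \<Longrightarrow> z i \<le> c i" using Z(3) by meson
      define h where "h = translate (insert e E) vec z g"
      have h: "h \<in> GK" "h \<in> AK" using z(1) cg(1) Z(2) by (auto simp: GK_def h_def Y_def)
      have f_h: "f = translate (insert e E) vec (\<lambda>i. c i - z i) h"
      proof
        fix i
        have "(\<Sum>e'\<in>insert e E. c e' * vec e' i) =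
            (\<Sum>e'\<in>insert e E. z e' * vec e' i + (c e' - z e') * vec e' i)"
          using z(2) by (intro sum.cong) (auto simp flip: add_mult_distrib)
        then show "f i = translate (insert e E) vec (\<lambda>i. c i - z i) h i"
          unfolding cg(2) h_def translate_def by (simp only: sum.distrib add.assoc)
      qed
      \<comment> \<open>A remaining use of \<open>e\<close> would lead from \<open>h\<close> through
        \<open>add h\<close>, which lies in \<open>B\<close> because \<open>h\<close> is in the
        kernel.\<close>
      have "c e - z e = 0"
      proof (rule ccontr)
        assume "c e - z e \<noteq> 0"
        then obtain n where n: "c e - z e = Suc n" using not0_implies_Suc by blast
        have "f = translate (insert e E) vec ((\<lambda>i. c i - z i)(e := n)) (add h)"
          using n unfolding f_h split upd add_def by (simp add: translate_def algebra_simps)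
        moreover have "add h \<in> B" using h(2) by (simp add: AK_def)
        ultimately have "f \<in> B"
          using insert.hyps(1) insert.prems(2)
          by (metis finite_insert order_refl translate_closed)
        then show False using f by blast
      qed
      then have "f = translate E vec (\<lambda>i. c i - z i) h" using f_h split by simp
      then show "f \<in> {translate E vec c g |c g. g \<in> GK}" using h by blast
    qed
  qed (use insert.prems in auto)
  define H where "H = (\<lambda>S t. {f \<in> S. f i0 = (t::nat)})"
  \<comment> \<open>An element of degree t + 1 is either outside the image of \<open>add\<close>, or
    comes from an element of degree t that \<open>add\<close> does not send into \<open>B\<close>.
    Counting both kinds expresses the first difference of the Hilbert function through cokernel and
    kernel.\<close>
  have step: "H X (Suc t) = H (A - BC) (Suc t) \<union> add ` (H X t - H (AK - B) t)" for t
    using addA addB vec_e by (auto simp: H_def X_def AK_def BC_def add_def)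
  have disj: "H (A - BC) (Suc t) \<inter> add ` (H X t - H (AK - B) t) = {}" for t
    by (auto simp: H_def X_def BC_def)
  have X0: "H X 0 \<subseteq> H (A - BC) 0"
    using vec_e by (auto simp: H_def X_def BC_def add_def)
  have finC: "finite (H (A - BC) t)" and finK: "finite (H (AK - B) t)" for t
    using C K by (auto simp: H_def)
  have fin: "finite (H X t)" for t
  proof (induction t)
    case 0
    then show ?case using X0 finC finite_subset by blast
  next
    case (Suc t)
    then show ?case unfolding step using finC by auto
  qed
  have sub: "H (AK - B) t \<subseteq> H X t" for t by (auto simp: H_def X_def AK_def)
  have "real (card (H X (Suc t))) - real (card (H X t)) =
      real (card (H (A - BC) (Suc t))) - real (card (H (AK - B) t))" for t
  proof -
    have "card (H X (Suc t)) = card (H (A - BC) (Suc t)) + card (H X t - H (AK - B) t)"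
      unfolding step using fin finC disj inj
      by (subst card_Un_disjoint) (auto simp: card_image inj_on_subset)
    also have "card (H X t - H (AK - B) t) = card (H X t) - card (H (AK - B) t)"
      using sub finK by (intro card_Diff_subset)
    finally have "card (H X (Suc t)) + card (H (AK - B) t) = card (H (A - BC) (Suc t)) + card (H X t)"
      using card_mono[OF fin[of t] sub[of t]] by simp
    then have "real (card (H X (Suc t))) + real (card (H (AK - B) t)) =
        real (card (H (A - BC) (Suc t))) + real (card (H X t))"
      by (metis of_nat_add)
    then show ?thesis by (simp add: algebra_simps)
  qed
  moreover have "eventually_poly (\<lambda>t. real (card (H (A - BC) (Suc t))) - real (card (H (AK - B) t)))"
    using C K by (intro eventually_poly_diff eventually_poly_Suc) (auto simp: H_def)
  ultimately have "eventually_poly (\<lambda>t. real (card (H X (Suc t))) - real (card (H X t)))"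
    by simp
  then have "eventually_poly (\<lambda>t. real (card (H X t)))"
    by (rule eventually_poly_if_difference)
  then show ?case using fin by (simp add: H_def X_def)
qed

section \<open>Exponents of local cohomology\<close>

text \<open>Gaussian elimination for the matrix with rows \<open>J\<close> and columns
  \<open>V\<close>, by induction on the columns. Over the reals a missing kernel vector yields the
  unit vectors as combinations of rows; over the coefficient field an excess of columns yields a
  kernel vector.\<close>

lemma elimination:
  fixes a :: "'j \<Rightarrow> 'v \<Rightarrow> 'k::field"
  assumes "finite V" "finite J"
  shows "(\<exists>y. (\<exists>v\<in>V. y v \<noteq> 0) \<and> (\<forall>j\<in>J. (\<Sum>v\<in>V. y v * a j v) = 0)) \<or>
    (card V \<le> card J \<and>
      (\<forall>i\<in>V. \<exists>\<mu>. \<forall>v\<in>V. (\<Sum>j\<in>J. \<mu> j * a j v) = (if v = i then 1 else 0)))"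
  using assms
proof (induction V arbitrary: a J rule: finite_induct)
  case empty
  then show ?case by simp
next
  case (insert v0 V)
  show ?case
  proof (cases "\<forall>j\<in>J. a j v0 = 0")
    case True
    have "(\<Sum>v\<in>insert v0 V. (if v = v0 then 1 else 0) * a j v) = 0" if "j \<in> J" for j
      using True that insert.hyps by (auto intro!: sum.neutral)
    then show ?thesis
      by (intro disjI1 exI[of _ "\<lambda>v. if v = v0 then 1 else 0"]) auto
  next
    case False
    then obtain j1 where j1: "j1 \<in> J" "a j1 v0 \<noteq> 0" by blast
    define J' where "J' = J - {j1}"
    define c where "c = (\<lambda>j. a j v0 / a j1 v0)"
    define b where "b = (\<lambda>j v. a j v - c j * a j1 v)"
    have J: "J = insert j1 J'" "finite J'" "j1 \<notin> J'" using j1 insert.prems by (auto simp: J'_def)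
    have b0: "b j v0 = 0" for j using j1 by (simp add: b_def c_def)
    from insert.IH[OF J(2), of b] show ?thesis
    proof (elim disjE exE conjE)
      fix y assume y: "\<exists>v\<in>V. y v \<noteq> 0" "\<forall>j\<in>J'. (\<Sum>v\<in>V. y v * b j v) = 0"
      define s where "s = (\<Sum>v\<in>V. y v * a j1 v)"
      \<comment> \<open>The value at \<open>v0\<close> solves the pivot equation \<open>j1\<close>.
        The other equations differ from those for \<open>b\<close> by multiples of it.\<close>
      define z where "z = y(v0 := - s / a j1 v0)"
      have z: "(\<Sum>v\<in>insert v0 V. z v * a j v) = (\<Sum>v\<in>V. y v * a j v) - s * c j" for j
      proof -
        have "(\<Sum>v\<in>V. z v * a j v) = (\<Sum>v\<in>V. y v * a j v)"
          using insert.hyps by (intro sum.cong) (auto simp: z_def)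
        then show ?thesis using insert.hyps by (simp add: z_def c_def)
      qed
      have "(\<Sum>v\<in>insert v0 V. z v * a j v) = 0" if "j \<in> J" for j
      proof (cases "j = j1")
        case True
        then show ?thesis using j1 unfolding z by (simp add: s_def c_def)
      next
        case False
        then have "(\<Sum>v\<in>V. y v * b j v) = 0" using that y J by auto
        then show ?thesis unfolding z
          by (simp add: b_def s_def algebra_simps sum_subtractf sum_distrib_left)
      qed
      moreover have "\<exists>v\<in>insert v0 V. z v \<noteq> 0" using y(1) insert.hyps by (auto simp: z_def)
      ultimately show ?thesis by blast
    next
      assume card: "card V \<le> card J'"
        and "\<forall>i\<in>V. \<exists>\<mu>. \<forall>v\<in>V. (\<Sum>j\<in>J'. \<mu> j * b j v) = (if v = i then 1 else 0)"
      then obtain \<mu> where \<mu>: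
          "\<And>i v. i \<in> V \<Longrightarrow> v \<in> V \<Longrightarrow> (\<Sum>j\<in>J'. \<mu> i j * b j v) = (if v = i then 1 else 0)"
        by metis
      \<comment> \<open>The weight of the pivot row is chosen so that the combination of rows of
        \<open>a\<close> equals the given combination of rows of \<open>b\<close>; in particular it
        vanishes in column \<open>v0\<close>.\<close>
      define \<nu> where "\<nu> = (\<lambda>i. (\<mu> i)(j1 := - (\<Sum>j\<in>J'. \<mu> i j * c j)))"
      have \<nu>: "(\<Sum>j\<in>J. \<nu> i j * a j v) = (\<Sum>j\<in>J'. \<mu> i j * b j v)" for i v
      proof -
        have "(\<Sum>j\<in>J'. \<nu> i j * a j v) = (\<Sum>j\<in>J'. \<mu> i j * a j v)"
          using J by (intro sum.cong) (auto simp: \<nu>_def)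
        then show ?thesis
          using J by (simp add: \<nu>_def b_def algebra_simps sum_subtractf sum_distrib_left)
      qed
      have \<nu>1: "(\<Sum>j\<in>J. \<nu> i j * a j v) = (if v = i then 1 else 0)"
        if "i \<in> V" "v \<in> insert v0 V" for i v
        using that \<mu>[of i v] insert.hyps b0 unfolding \<nu> by auto
      define r where "r = (\<lambda>v. a j1 v / a j1 v0)"
      \<comment> \<open>The normalized pivot row has entry 1 in column \<open>v0\<close>. Its
        entries in the other columns are removed with the combinations \<open>\<nu>\<close>, which
        do not touch \<open>v0\<close>.\<close>
      define \<kappa> where "\<kappa> = (\<lambda>j. (if j = j1 then 1 / a j1 v0 else 0) - (\<Sum>w\<in>V. r w * \<nu> w j))"
      have \<kappa>: "(\<Sum>j\<in>J. \<kappa> j * a j v) = (if v = v0 then 1 else 0)" if "v \<in> insert v0 V" for v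
      proof -
        have "(\<Sum>j\<in>J. \<kappa> j * a j v) = (\<Sum>j\<in>J. (if j = j1 then 1 / a j1 v0 * a j v else 0))
            - (\<Sum>j\<in>J. \<Sum>w\<in>V. r w * (\<nu> w j * a j v))"
          unfolding sum_subtractf[symmetric] \<kappa>_def
          by (intro sum.cong) (auto simp: algebra_simps sum_distrib_left)
        also have "(\<Sum>j\<in>J. (if j = j1 then 1 / a j1 v0 * a j v else 0)) = r v"
          using j1 insert.prems by (simp add: r_def)
        also have "(\<Sum>j\<in>J. \<Sum>w\<in>V. r w * (\<nu> w j * a j v)) =
            (\<Sum>w\<in>V. r w * (\<Sum>j\<in>J. \<nu> w j * a j v))"
          by (subst sum.swap) (simp add: sum_distrib_left)
        also have "\<dots> = (\<Sum>w\<in>V. r w * (if v = w then 1 else 0))"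
          using \<nu>1 that by (intro sum.cong) auto
        also have "\<dots> = (if v = v0 then 0 else r v)"
          using that insert.hyps by (auto simp: if_distrib[of "(*) _"] cong: if_cong)
        finally show ?thesis using j1 by (auto simp: r_def)
      qed
      have "\<exists>\<mu>. \<forall>v\<in>insert v0 V. (\<Sum>j\<in>J. \<mu> j * a j v) = (if v = i then 1 else 0)"
        if "i \<in> insert v0 V" for i
        using that \<nu>1 \<kappa> by (cases "i = v0") blast+
      moreover have "card (insert v0 V) \<le> card J" using card J insert.hyps by simp
      ultimately show ?thesis by blast
    qed
  qed
qed

section \<open>Powers of the edge ideal in terms of exponent vectors\<close>

definition exponents :: "'v set \<Rightarrow> ('v \<Rightarrow> nat) set"
  where "exponents V = {f. \<forall>v. v \<notin> V \<longrightarrow> f v = 0}"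

text \<open>Exponent vector of the product of the edges with multiplicities \<open>c\<close>. The
  value type is left open because real multiplicities describe the cone over the edges.\<close>

definition load :: "'v set set \<Rightarrow> ('v set \<Rightarrow> 'a::comm_monoid_add) \<Rightarrow> 'v \<Rightarrow> 'a"
  where "load E c v = (\<Sum>e\<in>E. if v \<in> e then c e else 0)"

text \<open>Membership of a monomial in the \<open>t\<close>-th power of the edge ideal: some
  product of \<open>t\<close> edges, repetitions allowed, divides it.\<close>

definition packs :: "'v set set \<Rightarrow> nat \<Rightarrow> ('v \<Rightarrow> nat) \<Rightarrow> bool"
  where "packs E t f \<longleftrightarrow> (\<exists>c. (\<forall>v. load E c v \<le> f v) \<and> sum c E = t)"

text \<open>The condition to be killed by a power of the maximal ideal modulo the power
  \<open>Suc t\<close>, tested on one variable at a time; \<open>torsion_monomial_ideal\<close>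
  justifies this.\<close>

definition torsion_at :: "'v set \<Rightarrow> 'v set set \<Rightarrow> nat \<Rightarrow> ('v \<Rightarrow> nat) \<Rightarrow> bool"
  where "torsion_at V E t f \<longleftrightarrow> (\<forall>v\<in>V. \<exists>k. packs E (Suc t) (f(v := f v + k)))"

text \<open>The exponents of the monomials forming a basis of the zeroth local cohomology of
  \<open>I\<^sup>t / I\<^sup>t\<^sup>+\<^sup>1\<close>.\<close>

definition torsion :: "'v set \<Rightarrow> 'v set set \<Rightarrow> nat \<Rightarrow> ('v \<Rightarrow> nat) set"
  where "torsion V E t =
    {f \<in> exponents V. packs E t f \<and> torsion_at V E t f \<and> \<not> packs E (Suc t) f}"

lemma restrict_image_exponents:
  assumes "f \<in> exponents V" "\<And>v. v \<in> V \<Longrightarrow> f v \<le> N"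
  shows "restrict f W \<in> W \<rightarrow>\<^sub>E {..N}"
  using assms by (fastforce simp: exponents_def)

lemma finite_bounded_exponents:
  assumes "finite V"
  shows "finite {f \<in> exponents V. \<forall>v\<in>V. f v \<le> N}"
proof -
  have "inj_on (\<lambda>f. restrict f V) (exponents V)"
    by (rule inj_onI) (auto simp: exponents_def fun_eq_iff restrict_def, metis)
  then have "inj_on (\<lambda>f. restrict f V) {f \<in> exponents V. \<forall>v\<in>V. f v \<le> N}"
    by (rule inj_on_subset) auto
  moreover have "(\<lambda>f. restrict f V) ` {f \<in> exponents V. \<forall>v\<in>V. f v \<le> N} \<subseteq> V \<rightarrow>\<^sub>E {..N}"
    using restrict_image_exponents by blast
  moreover have "finite (V \<rightarrow>\<^sub>E {..N})" using assms by (intro finite_PiE) auto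
  ultimately show ?thesis by (rule inj_on_finite)
qed

text \<open>The equation of the hyperplane recovers the coordinate at \<open>v0\<close> from the
  others, which saves one factor \<open>N + 1\<close>. This saving decides the orders of growth of
  the torsion counts.\<close>

lemma card_hyperplane_exponents:
  fixes y :: "'v \<Rightarrow> real"
  assumes "finite V" "v0 \<in> V" "y v0 \<noteq> 0" "S \<subseteq> exponents V"
    and "\<And>f v. f \<in> S \<Longrightarrow> v \<in> V \<Longrightarrow> f v \<le> N"
    and "\<And>f. f \<in> S \<Longrightarrow> (\<Sum>v\<in>V. y v * real (f v)) = \<kappa>"
  shows "card S \<le> (N + 1) ^ (card V - 1)"
proof -
  have "inj_on (\<lambda>f. restrict f (V - {v0})) S"
  proof (rule inj_onI)
    fix f g assume fg: "f \<in> S" "g \<in> S" "restrict f (V - {v0}) = restrict g (V - {v0})"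
    have eq: "f v = g v" if "v \<noteq> v0" for v
    proof (cases "v \<in> V")
      case True
      then show ?thesis using fun_cong[OF fg(3), of v] that by simp
    next
      case False
      then show ?thesis using fg(1,2) assms(4) unfolding exponents_def by (metis (mono_tags, lifting) mem_Collect_eq subsetD)
    qed
    have "(\<Sum>v\<in>V - {v0}. y v * real (f v)) = (\<Sum>v\<in>V - {v0}. y v * real (g v))"
      using eq by (intro sum.cong) auto
    moreover have "(\<Sum>v\<in>V. y v * real (f v)) = (\<Sum>v\<in>V. y v * real (g v))"
      using assms(6) fg by simp
    ultimately have "y v0 * real (f v0) = y v0 * real (g v0)"
      using assms(1,2) by (simp add: sum.remove)
    then have "f v0 = g v0" using assms(3) by simp
    then show "f = g" using eq by (metis ext)
  qed
  moreover have "(\<lambda>f. restrict f (V - {v0})) ` S \<subseteq> (V - {v0}) \<rightarrow>\<^sub>E {..N}"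
    using assms(4,5) restrict_image_exponents by blast
  moreover have "finite ((V - {v0}) \<rightarrow>\<^sub>E {..N})" using assms(1) by (intro finite_PiE) auto
  ultimately have "card S \<le> card ((V - {v0}) \<rightarrow>\<^sub>E {..N})" by (rule card_inj_on_le)
  then show ?thesis using assms(1,2) by (simp add: card_funcsetE)
qed

locale uniform_edges =
  fixes V :: "'v set" and E :: "'v set set" and m :: nat
  assumes fin_V: "finite V" and ne_V: "V \<noteq> {}" and E_sub: "E \<subseteq> Pow V"
    and card_edge: "e \<in> E \<Longrightarrow> card e = m" and m_pos: "1 \<le> m"
begin

lemma fin_E: "finite E" using fin_V E_sub by (meson finite_Pow_iff finite_subset)

lemma load_outside: "v \<notin> V \<Longrightarrow> load E c v = 0"
  using E_sub unfolding load_def by (intro sum.neutral) auto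

lemma load_in_exponents: "load E c \<in> exponents V"
  by (simp add: exponents_def load_outside)

lemma load_add: "load E (\<lambda>e. c e + d e) v = load E c v + load E d v"
  unfolding load_def sum.distrib[symmetric] by (intro sum.cong) auto

lemma of_nat_load: "real (load E c v) = load E (\<lambda>e. real (c e)) v"
  unfolding load_def of_nat_sum by (intro sum.cong) auto

lemma load_mult: "load E (\<lambda>e. (k::real) * c e) v = k * load E c v"
  unfolding load_def sum_distrib_left by (intro sum.cong) auto

lemma load_mono:
  fixes c d :: "'v set \<Rightarrow> 'a::ordered_comm_monoid_add"
  shows "(\<And>e. e \<in> E \<Longrightarrow> c e \<le> d e) \<Longrightarrow> load E c v \<le> load E d v"
  unfolding load_def by (intro sum_mono) auto

lemma load_single:
  assumes "e \<in> E"
  shows "load E (\<lambda>e'. if e' = e then 1 else 0) v = (if v \<in> e then 1 else 0 :: nat)"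
    "(\<Sum>e'\<in>E. if e' = e then 1 else 0 :: nat) = 1"
proof -
  have "load E (\<lambda>e'. if e' = e then 1 else 0) v =
      (\<Sum>e'\<in>E. if e' = e then (if v \<in> e then 1 else 0) else (0 :: nat))"
    unfolding load_def by (intro sum.cong) auto
  then show "load E (\<lambda>e'. if e' = e then 1 else 0) v = (if v \<in> e then 1 else 0 :: nat)"
    using assms fin_E by simp
  show "(\<Sum>e'\<in>E. if e' = e then 1 else 0 :: nat) = 1" using assms fin_E by simp
qed

lemma load_le_sum: "load E c v \<le> sum (c :: _ \<Rightarrow> nat) E"
  unfolding load_def by (intro sum_mono) auto

text \<open>Double counting of incidences between vertices and edges. By uniformity the degree of a
  product of edges determines their number, for real weights as well.\<close>

lemma sum_load:
  fixes c :: "'v set \<Rightarrow> 'a::comm_semiring_1"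
  shows "(\<Sum>v\<in>V. load E c v) = of_nat m * sum c E"
proof -
  have "(\<Sum>v\<in>V. load E c v) = (\<Sum>e\<in>E. \<Sum>v\<in>V. if v \<in> e then c e else 0)"
    unfolding load_def by (rule sum.swap)
  also have "\<dots> = (\<Sum>e\<in>E. of_nat m * c e)"
  proof (intro sum.cong refl)
    fix e assume "e \<in> E"
    then have "V \<inter> e = e" "card e = m" using E_sub card_edge by auto
    then show "(\<Sum>v\<in>V. if v \<in> e then c e else 0) = of_nat m * c e"
      using fin_V by (simp add: sum.inter_restrict[symmetric])
  qed
  finally show ?thesis by (simp add: sum_distrib_left)
qed

lemma packs_mono: "packs E t f \<Longrightarrow> (\<And>v. f v \<le> g v) \<Longrightarrow> packs E t g"
  unfolding packs_def by (elim exE conjE) (rule exI, blast intro: le_trans)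

lemma packs_0: "packs E 0 f"
  unfolding packs_def by (intro exI[of _ "\<lambda>_. 0"]) (simp add: load_def)

lemma packs_add:
  assumes "packs E s f" "packs E t g"
  shows "packs E (s + t) (\<lambda>v. f v + g v)"
proof -
  obtain c d where "\<And>v. load E c v \<le> f v" "sum c E = s" "\<And>v. load E d v \<le> g v" "sum d E = t"
    using assms unfolding packs_def by blast
  then show ?thesis unfolding packs_def
    by (intro exI[of _ "\<lambda>e. c e + d e"]) (auto simp: load_add sum.distrib intro: add_mono)
qed

lemma packs_load: "packs E (sum c E) (load E c)"
  unfolding packs_def by (intro exI[of _ c]) simp

lemma packs_Suc:
  assumes "packs E (Suc t) f"
  shows "packs E t f"
proof -
  obtain c where c: "\<And>v. load E c v \<le> f v" "sum c E = Suc t"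
    using assms unfolding packs_def by blast
  have "\<exists>e\<in>E. c e \<noteq> 0"
    using c(2) by (metis nat.simps(3) sum.neutral)
  then obtain e where e: "e \<in> E" "c e \<noteq> 0" by blast
  define d where "d = c(e := c e - 1)"
  have "sum c E = c e + sum c (E - {e})" "sum d E = d e + sum d (E - {e})"
    using e fin_E by (simp_all add: sum.remove)
  moreover have "sum d (E - {e}) = sum c (E - {e})"
    by (intro sum.cong) (auto simp: d_def)
  ultimately have "sum d E = t" using c(2) e by (simp add: d_def)
  moreover have "load E d v \<le> f v" for v
    using load_mono[of d c v] c(1)[of v] by (force simp: d_def)
  ultimately show ?thesis unfolding packs_def by blast
qed

lemma packs_le:
  assumes "s \<le> t" "packs E t f"
  shows "packs E s f"
  using assms by (induction t rule: dec_induct) (auto dest: packs_Suc)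

lemma packs_degree:
  assumes "packs E t f"
  shows "m * t \<le> (\<Sum>v\<in>V. f v)"
proof -
  obtain c where c: "\<And>v. load E c v \<le> f v" "sum c E = t"
    using assms unfolding packs_def by blast
  have "m * t = (\<Sum>v\<in>V. load E c v)" using sum_load[of c] c by simp
  also have "\<dots> \<le> (\<Sum>v\<in>V. f v)" using c by (intro sum_mono)
  finally show ?thesis .
qed

text \<open>No edge uses a vertex more than once, so exponents above \<open>t\<close> never matter for \<open>I\<^sup>t\<close>.\<close>

lemma torsion_bounded:
  assumes "f \<in> torsion V E t" "v \<in> V"
  shows "f v \<le> t"
proof (rule ccontr)
  assume "\<not> f v \<le> t"
  obtain k where "packs E (Suc t) (f(v := f v + k))"
    using assms unfolding torsion_def torsion_at_def by blast
  then obtain c where c: "\<And>w. load E c w \<le> (f(v := f v + k)) w" "sum c E = Suc t"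
    unfolding packs_def by blast
  have "load E c w \<le> f w" for w
    using c(1)[of w] load_le_sum[of c w] c(2) \<open>\<not> f v \<le> t\<close> by (cases "w = v") auto
  then have "packs E (Suc t) f" using c(2) unfolding packs_def by blast
  then show False using assms by (simp add: torsion_def)
qed

lemma finite_torsion: "finite (torsion V E t)"
  by (rule finite_subset[OF _ finite_bounded_exponents[OF fin_V, of t]])
    (use torsion_bounded in \<open>auto simp: torsion_def\<close>)

text \<open>Lower powers are packed as well, so a torsion exponent at \<open>t\<close> has packing
  number exactly \<open>t\<close>. Hence sums of torsion counts are cardinalities of unions, which
  can be compared by injections.\<close>

lemma torsion_disjoint:
  assumes "f \<in> torsion V E s" "f \<in> torsion V E t"
  shows "s = t"
  using assms packs_le[of "Suc s" t f] packs_le[of "Suc t" s f]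
  by (cases s t rule: linorder_cases) (auto simp: torsion_def)

lemma card_UN_torsion: "card (\<Union>s\<le>t. torsion V E s) = (\<Sum>s\<le>t. card (torsion V E s))"
  using finite_torsion torsion_disjoint by (intro card_UN_disjoint) blast+

lemma torsion_at_mono:
  assumes "torsion_at V E t f" "\<And>v. f v \<le> g v"
  shows "torsion_at V E t g"
  unfolding torsion_at_def
proof
  fix v assume "v \<in> V"
  then obtain k where "packs E (Suc t) (f(v := f v + k))"
    using assms unfolding torsion_at_def by blast
  then have "packs E (Suc t) (g(v := g v + k))"
    using assms(2) by (elim packs_mono) auto
  then show "\<exists>k. packs E (Suc t) (g(v := g v + k))" ..
qed

lemma torsion_at_add_load:
  assumes "torsion_at V E t f"
  shows "torsion_at V E (t + sum c E) (\<lambda>v. f v + load E c v)"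
  unfolding torsion_at_def
proof
  fix v assume "v \<in> V"
  then obtain k where "packs E (Suc t) (f(v := f v + k))"
    using assms unfolding torsion_at_def by blast
  then have "packs E (Suc t + sum c E) (\<lambda>w. (f(v := f v + k)) w + load E c w)"
    by (rule packs_add) (rule packs_load)
  then have "packs E (Suc (t + sum c E)) ((\<lambda>v. f v + load E c v)(v := f v + load E c v + k))"
    by (auto elim!: packs_mono)
  then show "\<exists>k. packs E (Suc (t + sum c E))
      ((\<lambda>v. f v + load E c v)(v := f v + load E c v + k))" ..
qed

text \<open>Each torsion exponent is a cofactor monomial times \<open>t\<close> edges. Apply
  \<open>dickson\<close> to these factorizations, with coordinates \<open>Inl v\<close> for the
  cofactor and \<open>Inr e\<close> for the multiplicities. An exponent exceeds a minimal
  factorization by some edges, which is harmless, and by a monomial \<open>r\<close>. The latter is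
  bounded, since a high power of a single vertex would push the exponent into the next power of the
  ideal. Minimal factorizations times the finitely many bounded \<open>r\<close> are the
  generators.\<close>

lemma torsion_generators:
  "\<exists>G. finite G \<and> (\<forall>(g, s)\<in>G. g \<in> exponents V \<and> packs E s g \<and> torsion_at V E s g) \<and>
    (\<forall>t. \<forall>f\<in>torsion V E t. \<exists>(g, s)\<in>G. \<exists>c. f = (\<lambda>v. g v + load E c v) \<and> t = s + sum c E)"
proof -
  define c_of where "c_of = (\<lambda>y :: 'v + 'v set \<Rightarrow> nat. \<lambda>e. y (Inr e))"
  define w_of where "w_of = (\<lambda>y :: 'v + 'v set \<Rightarrow> nat. \<lambda>v. if v \<in> V then y (Inl v) else 0)"
  define base where "base = (\<lambda>y v. w_of y v + load E (c_of y) v)"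
  define lev where "lev = (\<lambda>y. sum (c_of y) E)"
  define Y where "Y = {y. base y \<in> torsion V E (lev y)}"
  have "finite (Inl ` V \<union> Inr ` E)" using fin_V fin_E by simp
  from dickson[OF this, of Y] obtain Z where Z: "finite Z" "Z \<subseteq> Y"
    "\<And>y. y \<in> Y \<Longrightarrow> \<exists>z\<in>Z. \<forall>i\<in>Inl ` V \<union> Inr ` E. z i \<le> y i" by blast
  have "\<exists>k. packs E (Suc (lev z)) ((base z)(v := base z v + k))" if "z \<in> Z" "v \<in> V" for z v
    using that Z(2) by (auto simp: Y_def torsion_def torsion_at_def)
  then obtain k where k: "\<And>z v. z \<in> Z \<Longrightarrow> v \<in> V \<Longrightarrow>
      packs E (Suc (lev z)) ((base z)(v := base z v + k z v))" by metis
  \<comment> \<open>One exponent that works for all minimal factorizations and all vertices.\<close>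
  define K where "K = (\<Sum>z\<in>Z. \<Sum>v\<in>V. k z v)"
  have K: "packs E (Suc (lev z)) ((base z)(v := base z v + K))" if "z \<in> Z" "v \<in> V" for z v
  proof -
    have "k z v \<le> (\<Sum>v\<in>V. k z v)" using that fin_V by (intro member_le_sum) auto
    also have "\<dots> \<le> K" unfolding K_def using that Z(1) by (intro member_le_sum[of z Z "\<lambda>z. sum (k z) V"]) auto
    finally show ?thesis using k[OF that] by (elim packs_mono) auto
  qed
  define R where "R = {r \<in> exponents V. \<forall>v\<in>V. r v \<le> K}"
  define G where "G = (\<lambda>(z, r). (\<lambda>v. base z v + r v, lev z)) ` (Z \<times> R)"
  have "finite G" unfolding G_def R_def using Z(1) finite_bounded_exponents[OF fin_V] by simp
  moreover have "g \<in> exponents V \<and> packs E s g \<and> torsion_at V E s g" if gs: "(g, s) \<in> G" for g s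
  proof -
    obtain z r where zr: "z \<in> Z" "r \<in> R" "g = (\<lambda>v. base z v + r v)" "s = lev z"
      using gs by (auto simp: G_def)
    have "base z \<in> torsion V E (lev z)" using zr Z(2) by (auto simp: Y_def)
    then show ?thesis using zr
      by (auto simp: torsion_def exponents_def R_def elim!: packs_mono torsion_at_mono)
  qed
  moreover have "\<exists>(g, s)\<in>G. \<exists>c. f = (\<lambda>v. g v + load E c v) \<and> t = s + sum c E"
    if f: "f \<in> torsion V E t" for f t
  proof -
    obtain c where c: "\<And>v. load E c v \<le> f v" "sum c E = t"
      using f unfolding torsion_def packs_def by blast
    define y where "y = case_sum (\<lambda>v. f v - load E c v) c"
    have base_y: "base y = f"
    proof
      fix v
      show "base y v = f v"
        using c(1)[of v] f load_outside[of v c]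
        by (cases "v \<in> V") (auto simp: base_def w_of_def c_of_def y_def torsion_def exponents_def)
    qed
    have lev_y: "lev y = t" using c(2) by (simp add: lev_def c_of_def y_def)
    have "y \<in> Y" using base_y lev_y f by (simp add: Y_def)
    from Z(3)[OF this] obtain z where z': "z \<in> Z" "\<forall>i\<in>Inl ` V \<union> Inr ` E. z i \<le> y i" ..
    then have z: "z \<in> Z" "\<And>v. v \<in> V \<Longrightarrow> z (Inl v) \<le> y (Inl v)"
        "\<And>e. e \<in> E \<Longrightarrow> z (Inr e) \<le> y (Inr e)" by auto
    define d where "d = (\<lambda>e. y (Inr e) - z (Inr e))"
    define r where "r = (\<lambda>v. w_of y v - w_of z v)"
    have wz: "w_of z v \<le> w_of y v" for v using z(2) by (simp add: w_of_def)
    have ld: "load E (c_of y) v = load E (c_of z) v + load E d v" for v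
    proof -
      have "load E (c_of y) v = load E (\<lambda>e. c_of z e + d e) v"
        unfolding load_def using z(3) by (intro sum.cong) (auto simp: d_def c_of_def)
      then show ?thesis by (simp add: load_add)
    qed
    have f_eq: "f = (\<lambda>v. (base z v + r v) + load E d v)"
    proof
      fix v
      have "f v = base y v" by (simp add: base_y)
      then show "f v = (base z v + r v) + load E d v"
        using wz[of v] by (simp add: base_def ld r_def)
    qed
    have t_eq: "t = lev z + sum d E"
      unfolding lev_y[symmetric] lev_def sum.distrib[symmetric] using z(3)
      by (intro sum.cong) (auto simp: d_def c_of_def)
    \<comment> \<open>With more than \<open>K\<close> further copies of \<open>v\<close>, the
      minimal factorization already packs one more edge; adding the edges \<open>d\<close> would put
      \<open>f\<close> into the power \<open>Suc t\<close>.\<close>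
    have "r v \<le> K" if v: "v \<in> V" for v
    proof (rule ccontr)
      assume "\<not> r v \<le> K"
      have "packs E (Suc (lev z) + sum d E) (\<lambda>w. ((base z)(v := base z v + K)) w + load E d w)"
        by (rule packs_add[OF K[OF z(1) v] packs_load])
      then have "packs E (Suc t) f"
        unfolding t_eq add_Suc by (rule packs_mono) (use \<open>\<not> r v \<le> K\<close> in \<open>auto simp: f_eq\<close>)
      then show False using f by (simp add: torsion_def)
    qed
    then have "r \<in> R" by (auto simp: R_def exponents_def r_def w_of_def)
    then have "(\<lambda>v. base z v + r v, lev z) \<in> G" using z(1) by (force simp: G_def)
    then show ?thesis using f_eq t_eq
      by (intro bexI[of _ "(\<lambda>v. base z v + r v, lev z)"]) auto
  qed
  ultimately have "finite G \<and> (\<forall>(g, s)\<in>G. g \<in> exponents V \<and> packs E s g \<and> torsion_at V E s g) \<and>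
    (\<forall>t. \<forall>f\<in>torsion V E t. \<exists>(g, s)\<in>G. \<exists>c. f = (\<lambda>v. g v + load E c v) \<and> t = s + sum c E)"
    by auto
  then show ?thesis ..
qed

text \<open>As in the Rees algebra, a new coordinate \<open>None\<close> records the power
  \<open>t\<close>: a monomial lies in several powers, and every edge raises this coordinate by one,
  which is the grading that \<open>hilbert_serre\<close> expects. \<open>A\<close> collects the
  parts of the powers that become torsion and \<open>B\<close> the next powers.\<close>

lemma eventually_poly_card_torsion: "eventually_poly (\<lambda>t. real (card (torsion V E t)))"
proof -
  define vec where "vec = (\<lambda>e :: 'v set. case_option (1::nat) (\<lambda>v. if v \<in> e then 1 else 0))"
  define enc where "enc = (\<lambda>f t. case_option t f :: 'v option \<Rightarrow> nat)"
  define P where "P = (\<lambda>f t. f \<in> exponents V \<and> packs E t f \<and> torsion_at V E t f)"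
  define A where "A = {x. P (\<lambda>v. x (Some v)) (x None)}"
  define B where "B = {x. (\<lambda>v. x (Some v)) \<in> exponents V \<and> packs E (Suc (x None)) (\<lambda>v. x (Some v))}"
  have enc_Some: "(\<lambda>v. enc f t (Some v)) = f" and enc_None: "enc f t None = t" for f t
    by (simp_all add: enc_def)
  have enc_eq: "enc (\<lambda>v. x (Some v)) (x None) = x" for x
    by (auto simp: enc_def fun_eq_iff split: option.splits)
  have translate_enc: "translate E vec c (enc f t) = enc (\<lambda>v. f v + load E c v) (t + sum c E)" for c f t
  proof
    fix i
    show "translate E vec c (enc f t) i = enc (\<lambda>v. f v + load E c v) (t + sum c E) i"
      by (cases i) (auto simp: translate_def enc_def vec_def load_def intro!: sum.cong)
  qed
  have shift: "(\<lambda>v. x (Some v) + vec e (Some v)) = (\<lambda>v. x (Some v) + load E (\<lambda>e'. if e' = e then 1 else 0) v)"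
    "x None + vec e None = x None + (\<Sum>e'\<in>E. if e' = e then 1 else 0)" if "e \<in> E" for x e
    using load_single[OF that] by (simp_all add: vec_def)
  have exp_add: "(\<lambda>v. f v + load E c v) \<in> exponents V" if "f \<in> exponents V" for f c
    using that by (simp add: exponents_def load_outside)
  have "(\<lambda>i. x i + vec e i) \<in> A" if "x \<in> A" "e \<in> E" for x e
    using that exp_add packs_add[OF _ packs_load] torsion_at_add_load
    unfolding A_def P_def mem_Collect_eq shift[OF that(2)] by blast
  then have A: "shift_closed E vec A" by (simp add: shift_closed_def)
  have "(\<lambda>i. x i + vec e i) \<in> B" if "x \<in> B" "e \<in> E" for x e
    using that exp_add packs_add[OF _ packs_load]
    unfolding B_def mem_Collect_eq shift[OF that(2)] add_Suc[symmetric] by blast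
  then have B: "shift_closed E vec B" by (simp add: shift_closed_def)
  obtain G where G: "finite G" "\<And>g s. (g, s) \<in> G \<Longrightarrow> P g s"
    "\<And>t f. f \<in> torsion V E t \<Longrightarrow> \<exists>(g, s)\<in>G. \<exists>c. f = (\<lambda>v. g v + load E c v) \<and> t = s + sum c E"
    using torsion_generators unfolding P_def by fast
  have AB: "x \<in> A - B \<longleftrightarrow> (\<lambda>v. x (Some v)) \<in> torsion V E (x None)" for x
    by (auto simp: A_def B_def P_def torsion_def)
  have "eventually_poly (\<lambda>t. real (card {x \<in> A - B. x None = t}))"
  proof (rule hilbert_serre[THEN conjunct1, OF fin_E A B])
    show "finite ((\<lambda>(g, s). enc g s) ` G)" using G by simp
    show "(\<lambda>(g, s). enc g s) ` G \<subseteq> A" using G(2) by (auto simp: A_def enc_Some enc_None)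
    show "A - B \<subseteq> {translate E vec c g |c g. g \<in> (\<lambda>(g, s). enc g s) ` G}"
    proof
      fix x assume "x \<in> A - B"
      then obtain g s c where gsc: "(g, s) \<in> G" "(\<lambda>v. x (Some v)) = (\<lambda>v. g v + load E c v)"
          "x None = s + sum c E" using AB G(3) by blast
      have "x = translate E vec c (enc g s)"
        by (subst enc_eq[symmetric]) (simp only: gsc translate_enc)
      then show "x \<in> {translate E vec c g |c g. g \<in> (\<lambda>(g, s). enc g s) ` G}" using gsc(1) by blast
    qed
  qed (simp add: vec_def)
  moreover have "card {x \<in> A - B. x None = t} = card (torsion V E t)" for t
  proof -
    have "{x \<in> A - B. x None = t} = (\<lambda>f. enc f t) ` torsion V E t"
    proof (intro equalityI subsetI)
      fix x assume "x \<in> {x \<in> A - B. x None = t}"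
      then have "(\<lambda>v. x (Some v)) \<in> torsion V E t" "x = enc (\<lambda>v. x (Some v)) t"
        using AB enc_eq[of x] by auto
      then show "x \<in> (\<lambda>f. enc f t) ` torsion V E t" by blast
    next
      fix x assume "x \<in> (\<lambda>f. enc f t) ` torsion V E t"
      then obtain f where "f \<in> torsion V E t" "x = enc f t" by blast
      then show "x \<in> {x \<in> A - B. x None = t}"
        unfolding mem_Collect_eq AB by (simp add: enc_Some enc_None)
    qed
    moreover have "inj (\<lambda>f. enc f t)" by (rule injI) (metis enc_Some)
    ultimately show ?thesis by (simp add: card_image inj_on_subset)
  qed
  ultimately show ?thesis by simp
qed

end

section \<open>The cone over the edges\<close>

text \<open>The incidence vectors of the edges do not span the real space over \<open>V\<close>:
  \<open>y\<close> is a normal vector of a hyperplane that contains them all.\<close>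

definition deficient :: "'v set \<Rightarrow> 'v set set \<Rightarrow> bool"
  where "deficient V E \<longleftrightarrow> (\<exists>y::'v \<Rightarrow> real. (\<exists>v\<in>V. y v \<noteq> 0) \<and> (\<forall>e\<in>E. (\<Sum>v\<in>e. y v) = 0))"

text \<open>Lattice points of the real cone over the edges. By \<open>packs_degree\<close> the
  strict degree bound means that at most \<open>t\<close> edges can be packed into such a
  point.\<close>

definition cone_points :: "'v set \<Rightarrow> 'v set set \<Rightarrow> nat \<Rightarrow> nat \<Rightarrow> ('v \<Rightarrow> nat) set"
  where "cone_points V E m t = {f \<in> exponents V.
    (\<exists>\<xi>. (\<forall>e\<in>E. 0 \<le> \<xi> e) \<and> (\<forall>v. real (f v) = load E \<xi> v)) \<and> (\<Sum>v\<in>V. f v) < m * Suc t}"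

context uniform_edges
begin

lemma sum_incidence:
  fixes y :: "'v \<Rightarrow> 'a::comm_semiring_1"
  assumes "e \<in> E"
  shows "(\<Sum>v\<in>V. y v * (if v \<in> e then 1 else 0)) = (\<Sum>v\<in>e. y v)"
proof -
  have "V \<inter> e = e" using E_sub assms by auto
  then show ?thesis
    using fin_V sum.inter_restrict[of V y e] by (simp add: if_distrib[of "(*) _"] cong: if_cong)
qed

text \<open>The second alternative of \<open>elimination\<close>: \<open>\<mu> i\<close> writes the
  unit vector at \<open>i\<close> as a real combination of edges. Its entries may be negative, which
  is why the comparisons below translate by many copies of all edges.\<close>

lemma deficient_or_spanning:
  assumes "\<not> deficient V E"
  obtains \<mu> :: "'v \<Rightarrow> 'v set \<Rightarrow> real"
  where "\<And>i v. i \<in> V \<Longrightarrow> load E (\<mu> i) v = (if v = i then 1 else 0)"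
proof -
  have "\<not> (\<exists>y::'v \<Rightarrow> real. (\<exists>v\<in>V. y v \<noteq> 0) \<and>
      (\<forall>e\<in>E. (\<Sum>v\<in>V. y v * (if v \<in> e then 1 else 0)) = 0))"
    using assms unfolding deficient_def by (simp add: sum_incidence)
  with elimination[OF fin_V fin_E, of "\<lambda>e v. if v \<in> e then 1 else (0::real)"]
  have "\<forall>i\<in>V. \<exists>\<mu>::_ \<Rightarrow> real. \<forall>v\<in>V.
      (\<Sum>e\<in>E. \<mu> e * (if v \<in> e then 1 else 0)) = (if v = i then 1 else 0)"
    by blast
  then have "\<forall>i\<in>V. \<exists>\<mu>::_ \<Rightarrow> real. \<forall>v\<in>V. load E \<mu> v = (if v = i then 1 else 0)"
    by (simp add: load_def if_distrib[of "(*) _"] cong: if_cong)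
  then obtain \<mu> :: "'v \<Rightarrow> 'v set \<Rightarrow> real" where
    \<mu>: "\<And>i v. i \<in> V \<Longrightarrow> v \<in> V \<Longrightarrow> load E (\<mu> i) v = (if v = i then 1 else 0)"
    by metis
  show thesis
  proof (rule that)
    fix i v assume "i \<in> V"
    then show "load E (\<mu> i) v = (if v = i then 1 else 0)"
      using \<mu>[of i v] by (cases "v \<in> V") (auto simp: load_outside)
  qed
qed

lemma torsion_generated:
  obtains G where "finite G" "\<And>t. torsion V E t \<subseteq>
    {\<lambda>v. g v + load E c v | g c s. (g, s) \<in> G \<and> t = s + sum c E}"
proof -
  obtain G where "finite G"
    "\<forall>t. \<forall>f\<in>torsion V E t. \<exists>(g, s)\<in>G. \<exists>c. f = (\<lambda>v. g v + load E c v) \<and> t = s + sum c E"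
    using torsion_generators by blast
  then show thesis by (intro that[of G]) fast+
qed

text \<open>An edge contains a vertex at most once, so products of at most \<open>t\<close> edges
  lie in a box of side \<open>t\<close>, and \<open>card_hyperplane_exponents\<close> counts those
  on one hyperplane. The normal vector is 1 everywhere when the degree is fixed, and orthogonal to
  all edges in the deficient case.\<close>

lemma card_translates_le:
  fixes y :: "'v \<Rightarrow> real"
  assumes "finite G" "T \<subseteq> (\<Union>(g, s)\<in>G. (\<lambda>l v. g v + l v) ` S s)" "v0 \<in> V" "y v0 \<noteq> 0"
    and "\<And>s f. f \<in> S s \<Longrightarrow> \<exists>c. f = load E c \<and> sum c E \<le> t"
    and "\<And>s f. f \<in> S s \<Longrightarrow> (\<Sum>v\<in>V. y v * real (f v)) = \<kappa> s"
  shows "card T \<le> card G * (t + 1) ^ (card V - 1)"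
proof -
  have le: "f v \<le> t" and ex: "f \<in> exponents V" if "f \<in> S s" for f v s
    using assms(5)[OF that] load_le_sum load_in_exponents by (auto intro: le_trans)
  have fin: "finite (S s)" for s
    by (rule finite_subset[OF _ finite_bounded_exponents[OF fin_V, of t]]) (use le ex in auto)
  have S: "card (S s) \<le> (t + 1) ^ (card V - 1)" for s
    using le ex assms(4,6)
    by (intro card_hyperplane_exponents[where y = y and \<kappa> = "\<kappa> s", OF fin_V assms(3)]) auto
  have "card T \<le> card (\<Union>(g, s)\<in>G. (\<lambda>l v. g v + l v) ` S s)"
    using assms(1,2) fin by (intro card_mono) auto
  also have "\<dots> \<le> (\<Sum>(g, s)\<in>G. card ((\<lambda>l v. g v + l v) ` S s))"
    unfolding case_prod_beta by (rule card_UN_le[OF assms(1)])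
  also have "\<dots> \<le> (\<Sum>(g, s)\<in>G. (t + 1) ^ (card V - 1))"
    by (intro sum_mono) (auto intro: order_trans[OF card_image_le[OF fin] S, simplified])
  finally show ?thesis by simp
qed

lemma card_torsion_le: "\<exists>C. \<forall>t. card (torsion V E t) \<le> C * (t + 1) ^ (card V - 1)"
proof -
  obtain G where G: "finite G" "\<And>t. torsion V E t \<subseteq>
    {\<lambda>v. g v + load E c v | g c s. (g, s) \<in> G \<and> t = s + sum c E}"
    using torsion_generated by blast
  obtain v0 where v0: "v0 \<in> V" using ne_V by blast
  have "card (torsion V E t) \<le> card G * (t + 1) ^ (card V - 1)" for t
  proof (rule card_translates_le[OF G(1) _ v0])
    show "torsion V E t \<subseteq> (\<Union>(g, s)\<in>G. (\<lambda>l v. g v + l v) ` {load E c | c. t = s + sum c E})"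
      using G(2)[of t] by fastforce
    show "\<exists>c. f = load E c \<and> sum c E \<le> t" if "f \<in> {load E c | c. t = s + sum c E}" for s f
      using that by auto
    show "(\<Sum>v\<in>V. 1 * real (f v)) = real m * real (t - s)" if "f \<in> {load E c | c. t = s + sum c E}" for s f
      using that sum_load[where 'a = nat] by (auto simp flip: of_nat_sum of_nat_mult)
  qed simp
  then show ?thesis by blast
qed

text \<open>The normal vector vanishes on every product of edges, whatever their number. One
  hyperplane thus serves all powers up to \<open>t\<close>, and the whole sum obeys a bound of the
  order that otherwise holds for a single power.\<close>

lemma card_torsion_le_deficient:
  assumes "deficient V E"
  shows "\<exists>C. \<forall>t. (\<Sum>s\<le>t. card (torsion V E s)) \<le> C * (t + 1) ^ (card V - 1)"
proof -
  obtain y :: "'v \<Rightarrow> real" and v0 where y: "v0 \<in> V" "y v0 \<noteq> 0" "\<And>e. e \<in> E \<Longrightarrow> (\<Sum>v\<in>e. y v) = 0"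
    using assms unfolding deficient_def by blast
  obtain G where G: "finite G" "\<And>t. torsion V E t \<subseteq>
    {\<lambda>v. g v + load E c v | g c s. (g, s) \<in> G \<and> t = s + sum c E}"
    using torsion_generated by blast
  have "card (\<Union>s\<le>t. torsion V E s) \<le> card G * (t + 1) ^ (card V - 1)" for t
  proof (rule card_translates_le[where y = y and \<kappa> = "\<lambda>_. 0", OF G(1) _ y(1)])
    show "(\<Union>s\<le>t. torsion V E s) \<subseteq> (\<Union>(g, s)\<in>G. (\<lambda>l v. g v + l v) ` {load E c | c. sum c E \<le> t})"
      using G(2) by fastforce
    show "\<exists>c. f = load E c \<and> sum c E \<le> t" if "f \<in> {load E c | c. sum c E \<le> t}" for s :: nat and f
      using that by auto
    show "(\<Sum>v\<in>V. y v * real (f v)) = 0" if f: "f \<in> {load E c | c. sum c E \<le> t}" for s :: nat and f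
    proof -
      obtain c where "f = load E c" using f by auto
      moreover have "y v * real (load E c v) = (\<Sum>e\<in>E. real (c e) * (y v * (if v \<in> e then 1 else 0)))" for v
        unfolding load_def of_nat_sum sum_distrib_left by (intro sum.cong) auto
      ultimately have "(\<Sum>v\<in>V. y v * real (f v)) =
          (\<Sum>e\<in>E. real (c e) * (\<Sum>v\<in>V. y v * (if v \<in> e then 1 else 0)))"
        by (simp add: sum_distrib_left sum.swap[of _ E])
      also have "\<dots> = 0" using y(3) sum_incidence[of _ y] by (intro sum.neutral) auto
      finally show ?thesis .
    qed
  qed (rule y(2))
  then show ?thesis unfolding card_UN_torsion by blast
qed

section \<open>Torsion exponents against lattice points of the cone\<close>

lemma finite_cone_points: "finite (cone_points V E m t)"
proof (rule finite_subset[OF _ finite_bounded_exponents[OF fin_V, of "m * Suc t"]])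
  show "cone_points V E m t \<subseteq> {f \<in> exponents V. \<forall>v\<in>V. f v \<le> m * Suc t}"
  proof
    fix f assume f: "f \<in> cone_points V E m t"
    have "f v \<le> m * Suc t" if "v \<in> V" for v
      using member_le_sum[of v V f] that fin_V f by (auto simp: cone_points_def)
    then show "f \<in> {f \<in> exponents V. \<forall>v\<in>V. f v \<le> m * Suc t}"
      using f by (auto simp: cone_points_def)
  qed
qed

text \<open>Deep inside the cone every exponent is torsion, since adding a large multiple of a unit
  vector keeps it in the cone, where the largest power of the edge ideal containing a monomial is
  governed by the degree up to a bounded error.\<close>

lemma torsion_deep:
  assumes \<mu>: "\<And>i v. i \<in> V \<Longrightarrow> load E (\<mu> i) v = (if v = i then 1 else (0::real))"
    and N: "\<And>i e. i \<in> V \<Longrightarrow> e \<in> E \<Longrightarrow> \<bar>\<mu> i e\<bar> \<le> real N"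
    and \<xi>: "\<And>e. e \<in> E \<Longrightarrow> 0 \<le> \<xi> e" "\<And>v. real (q v) = load E \<xi> v"
    and L: "L = m * (card E + 1) * N"
    and s: "packs E s (\<lambda>v. q v + load E (\<lambda>_. L) v)"
  shows "torsion_at V E s (\<lambda>v. q v + load E (\<lambda>_. L) v)"
  unfolding torsion_at_def
proof
  fix i assume i: "i \<in> V"
  \<comment> \<open>After \<open>k\<close> has been added at \<open>i\<close>, the total weight of
    the edges is at least \<open>s + card E + 1\<close>, because \<open>k\<close> is
    \<open>m\<close> times \<open>card E + 1\<close>. Rounding down costs at most 1 per edge, so one
    edge more than \<open>s\<close> remains. The shift \<open>L = k * N\<close> keeps the weights
    non-negative despite the signs in \<open>\<mu> i\<close>.\<close>
  define k where "k = m * (card E + 1)"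
  define f where "f = (\<lambda>v. q v + load E (\<lambda>_. L) v)"
  define \<rho> where "\<rho> = (\<lambda>e. (\<xi> e + real L) + real k * \<mu> i e)"
  have L': "L = k * N" using L by (simp add: k_def)
  have \<rho>0: "0 \<le> \<rho> e" if "e \<in> E" for e
  proof -
    have "\<bar>real k * \<mu> i e\<bar> \<le> real k * real N"
      using N[OF i that] by (simp add: abs_mult mult_left_mono)
    then show ?thesis using \<xi>(1)[OF that] by (simp add: \<rho>_def L' abs_le_iff)
  qed
  have f_k: "real ((f(i := f i + k)) v) = load E \<rho> v" for v
    using \<mu>[OF i, of v] \<xi>(2)[of v] of_nat_load[of "\<lambda>_. L" v]
    by (cases "v = i") (auto simp: \<rho>_def load_add load_mult f_def)
  define c where "c = (\<lambda>e. nat \<lfloor>\<rho> e\<rfloor>)"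
  have c: "real (c e) \<le> \<rho> e" "\<rho> e \<le> real (c e) + 1" if "e \<in> E" for e
    using \<rho>0[OF that] unfolding c_def by linarith+
  have "real (load E c v) \<le> real ((f(i := f i + k)) v)" for v
    unfolding of_nat_load f_k using c by (intro load_mono)
  then have packs_c: "packs E (sum c E) (f(i := f i + k))" unfolding packs_def of_nat_le_iff by blast
  have "real m * sum \<rho> E = (\<Sum>v\<in>V. real ((f(i := f i + k)) v))"
    unfolding f_k sum_load[of \<rho>] by simp
  also have "\<dots> = real (\<Sum>v\<in>V. f v) + real k"
    using fin_V i by (simp add: sum.remove[of V i])
  finally have deg: "real m * sum \<rho> E = real (\<Sum>v\<in>V. f v) + real k" .
  have "real (m * s) \<le> real (\<Sum>v\<in>V. f v)" using packs_degree[OF s] unfolding f_def of_nat_le_iff .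
  then have "real m * (real s + (real (card E) + 1)) \<le> real m * sum \<rho> E"
    unfolding deg by (simp add: k_def algebra_simps)
  then have "real s + (real (card E) + 1) \<le> sum \<rho> E" using m_pos by simp
  also have "\<dots> \<le> (\<Sum>e\<in>E. real (c e) + 1)" using c by (intro sum_mono)
  finally have "real s + 1 \<le> real (sum c E)" by (simp add: sum.distrib)
  then have "Suc s \<le> sum c E" by linarith
  then have "packs E (Suc s) (f(i := f i + k))" using packs_c packs_le by blast
  then show "\<exists>k. packs E (Suc s) ((\<lambda>v. q v + load E (\<lambda>_. L) v)(i := q i + load E (\<lambda>_. L) i + k))"
    unfolding f_def by blast
qed

lemma spanning_bound:
  fixes \<mu> :: "'v \<Rightarrow> 'v set \<Rightarrow> real"
  obtains N :: nat where "\<And>i e. i \<in> V \<Longrightarrow> e \<in> E \<Longrightarrow> \<bar>\<mu> i e\<bar> \<le> real N"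
proof -
  define B where "B = (\<Sum>i\<in>V. \<Sum>e\<in>E. \<bar>\<mu> i e\<bar>)"
  have "\<bar>\<mu> i e\<bar> \<le> real (nat \<lceil>B\<rceil>)" if "i \<in> V" "e \<in> E" for i e
  proof -
    have "\<bar>\<mu> i e\<bar> \<le> (\<Sum>e\<in>E. \<bar>\<mu> i e\<bar>)" using that fin_E by (intro member_le_sum) auto
    also have "\<dots> \<le> B" unfolding B_def using that fin_V
      by (intro member_le_sum[of i V "\<lambda>i. \<Sum>e\<in>E. \<bar>\<mu> i e\<bar>"]) (auto intro: sum_nonneg)
    finally show ?thesis by linarith
  qed
  then show thesis by (rule that)
qed

text \<open>Translation by \<open>L\<close> copies of each edge is injective and brings every
  lattice point of the cone to where \<open>torsion_deep\<close> applies, so the image is torsion at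
  its packing number. The degree grows by \<open>m * d\<close>, which bounds this number by
  \<open>t + d\<close>.\<close>

lemma cone_points_le_torsion:
  assumes "\<not> deficient V E"
  shows "\<exists>d. \<forall>t. card (cone_points V E m t) \<le> (\<Sum>s\<le>t + d. card (torsion V E s))"
proof -
  obtain \<mu> :: "'v \<Rightarrow> 'v set \<Rightarrow> real"
    where \<mu>: "\<And>i v. i \<in> V \<Longrightarrow> load E (\<mu> i) v = (if v = i then 1 else 0)"
    using deficient_or_spanning[OF assms] by blast
  obtain N where N: "\<And>i e. i \<in> V \<Longrightarrow> e \<in> E \<Longrightarrow> \<bar>\<mu> i e\<bar> \<le> real N"
    using spanning_bound by blast
  define L where "L = m * (card E + 1) * N"
  define d where "d = L * card E"
  have "card (cone_points V E m t) \<le> card (\<Union>s\<le>t + d. torsion V E s)" for t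
  proof (rule card_inj_on_le)
    show "inj_on (\<lambda>q v. q v + load E (\<lambda>_. L) v) (cone_points V E m t)"
      by (rule inj_onI) (auto simp: fun_eq_iff)
    show "finite (\<Union>s\<le>t + d. torsion V E s)" using finite_torsion by simp
    show "(\<lambda>q v. q v + load E (\<lambda>_. L) v) ` cone_points V E m t \<subseteq> (\<Union>s\<le>t + d. torsion V E s)"
    proof
      fix f assume "f \<in> (\<lambda>q v. q v + load E (\<lambda>_. L) v) ` cone_points V E m t"
      then obtain q \<xi> where q: "f = (\<lambda>v. q v + load E (\<lambda>_. L) v)" "q \<in> exponents V"
        "\<And>e. e \<in> E \<Longrightarrow> 0 \<le> \<xi> e" "\<And>v. real (q v) = load E \<xi> v" "(\<Sum>v\<in>V. q v) < m * Suc t"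
        unfolding cone_points_def by blast
      have deg: "(\<Sum>v\<in>V. f v) = (\<Sum>v\<in>V. q v) + m * d"
        using sum_load[of "\<lambda>_. L"] by (simp add: q(1) sum.distrib d_def mult.commute)
      have bound: "s \<le> t + d" if "packs E s f" for s
      proof -
        have "m * s < m * (Suc t + d)" using packs_degree[OF that] q(5) deg by (simp add: algebra_simps)
        then have "s < Suc t + d" unfolding mult_less_cancel1 by blast
        then show ?thesis by simp
      qed
      define s where "s = (GREATEST s. packs E s f)"
      have s: "packs E s f" unfolding s_def using packs_0[of f] bound by (rule GreatestI_nat)
      have "\<not> packs E (Suc s) f" using Greatest_le_nat[of "\<lambda>s. packs E s f" "Suc s" "t + d"] bound
        unfolding s_def[symmetric] by auto
      moreover have "torsion_at V E s f"
        using torsion_deep[OF \<mu> N q(3,4) L_def] s unfolding q(1) by blast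
      moreover have "f \<in> exponents V" using q(2) by (auto simp: q(1) exponents_def load_outside)
      ultimately have "f \<in> torsion V E s" using s by (simp add: torsion_def)
      then show "f \<in> (\<Union>s\<le>t + d. torsion V E s)" using bound[OF s] by blast
    qed
  qed
  then show ?thesis unfolding card_UN_torsion by blast
qed

text \<open>A torsion exponent is a product of edges times one of finitely many generators, and only
  the generator may leave the cone. Expressed through \<open>\<mu>\<close> it has edge weights of
  absolute value at most \<open>D * N\<close>, where \<open>D\<close> bounds the degrees of the
  generators; \<open>L = D * N\<close> copies of each edge compensate for them.\<close>

lemma torsion_le_cone_points:
  assumes "\<not> deficient V E"
  shows "\<exists>d. \<forall>t. (\<Sum>s\<le>t. card (torsion V E s)) \<le> card (cone_points V E m (t + d))"
proof -
  obtain \<mu> :: "'v \<Rightarrow> 'v set \<Rightarrow> real"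
    where \<mu>: "\<And>i v. i \<in> V \<Longrightarrow> load E (\<mu> i) v = (if v = i then 1 else 0)"
    using deficient_or_spanning[OF assms] by blast
  obtain N where N: "\<And>i e. i \<in> V \<Longrightarrow> e \<in> E \<Longrightarrow> \<bar>\<mu> i e\<bar> \<le> real N"
    using spanning_bound by blast
  obtain G where G: "finite G" "\<forall>(g, s)\<in>G. g \<in> exponents V"
    "\<forall>t. \<forall>f\<in>torsion V E t. \<exists>(g, s)\<in>G. \<exists>c. f = (\<lambda>v. g v + load E c v) \<and> t = s + sum c E"
    using torsion_generators by fast
  define D where "D = (\<Sum>(g, s)\<in>G. \<Sum>v\<in>V. g v)"
  define L where "L = D * N"
  define d where "d = D + L * card E"
  have "card (\<Union>s\<le>t. torsion V E s) \<le> card (cone_points V E m (t + d))" for t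
  proof (rule card_inj_on_le)
    show "inj_on (\<lambda>q v. q v + load E (\<lambda>_. L) v) (\<Union>s\<le>t. torsion V E s)"
      by (rule inj_onI) (auto simp: fun_eq_iff)
    show "finite (cone_points V E m (t + d))" by (rule finite_cone_points)
    show "(\<lambda>q v. q v + load E (\<lambda>_. L) v) ` (\<Union>s\<le>t. torsion V E s) \<subseteq> cone_points V E m (t + d)"
    proof
      fix u assume "u \<in> (\<lambda>q v. q v + load E (\<lambda>_. L) v) ` (\<Union>s\<le>t. torsion V E s)"
      then obtain f s where f: "s \<le> t" "f \<in> torsion V E s" "u = (\<lambda>v. f v + load E (\<lambda>_. L) v)" by blast
      obtain g r c where g: "(g, r) \<in> G" "f = (\<lambda>v. g v + load E c v)" "s = r + sum c E"
        using G(3) f(2) by blast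
      have gD: "(\<Sum>v\<in>V. g v) \<le> D"
        unfolding D_def using g(1) G(1) member_le_sum[of "(g, r)" G "\<lambda>(g, s). \<Sum>v\<in>V. g v"] by simp
      have gV: "g \<in> exponents V" using G(2) g(1) by blast
      define \<xi> where "\<xi> = (\<lambda>e. (real (c e) + real L) + (\<Sum>i\<in>V. real (g i) * \<mu> i e))"
      have "0 \<le> \<xi> e" if "e \<in> E" for e
      proof -
        have "\<bar>\<Sum>i\<in>V. real (g i) * \<mu> i e\<bar> \<le> (\<Sum>i\<in>V. real (g i) * real N)"
          using N that by (intro order_trans[OF sum_abs] sum_mono) (simp add: abs_mult mult_left_mono)
        also have "\<dots> = real (\<Sum>i\<in>V. g i) * real N" by (simp add: sum_distrib_right)
        also have "\<dots> \<le> real D * real N" using gD by (intro mult_right_mono) (simp_all only: of_nat_le_iff of_nat_0_le_iff)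
        finally show ?thesis by (simp add: \<xi>_def L_def abs_le_iff)
      qed
      moreover have "real (u v) = load E \<xi> v" for v
      proof -
        have "load E (\<lambda>e. \<Sum>i\<in>V. real (g i) * \<mu> i e) v = (\<Sum>i\<in>V. real (g i) * load E (\<mu> i) v)"
          unfolding load_def sum_distrib_left by (subst sum.swap) (auto intro!: sum.cong sum.neutral)
        also have "\<dots> = (\<Sum>i\<in>V. if i = v then real (g i) else 0)"
          using \<mu> by (intro sum.cong) auto
        also have "\<dots> = real (g v)" using fin_V gV by (simp add: exponents_def)
        finally show ?thesis
          by (simp add: \<xi>_def load_add f(3) g(2) of_nat_load)
      qed
      moreover have "(\<Sum>v\<in>V. u v) < m * Suc (t + d)"
      proof -
        have "(\<Sum>v\<in>V. u v) = (\<Sum>v\<in>V. g v) + m * sum c E + m * (L * card E)"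
          using sum_load[of "\<lambda>_. L"] sum_load[of c]
          by (simp add: f(3) g(2) sum.distrib mult.commute)
        also have "\<dots> \<le> m * D + m * t + m * (L * card E)"
          using gD f(1) g(3) m_pos by (intro add_mono) (auto intro: le_trans)
        also have "\<dots> < m * Suc (t + d)" using m_pos by (simp add: d_def algebra_simps)
        finally show ?thesis .
      qed
      moreover have "u \<in> exponents V"
        using gV by (auto simp: f(3) g(2) exponents_def load_outside)
      ultimately show "u \<in> cone_points V E m (t + d)" unfolding cone_points_def by blast
    qed
  qed
  then show ?thesis unfolding card_UN_torsion by blast
qed

end

section \<open>Growth rates and the free vertex\<close>

lemma poly_growth_limit:
  fixes p :: "real poly"
  assumes "Polynomial.degree p \<le> k"
  shows "(\<lambda>t. poly p (real t) / real t ^ k) \<longlonglongrightarrow> Polynomial.coeff p k"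
proof -
  have "(\<lambda>t. real t ^ i / real t ^ k) \<longlonglongrightarrow> (if i = k then 1 else 0)" if "i \<le> k" for i
  proof (cases "i = k")
    case True
    \<comment> \<open>At \<open>t = 0\<close> the quotient is 0 for positive \<open>k\<close>, by
      division by zero; hence the equality holds only eventually.\<close>
    have "\<forall>\<^sub>F t in sequentially. real t ^ i / real t ^ k = 1"
      using eventually_gt_at_top[of 0] by eventually_elim (simp add: True)
    then have "(\<lambda>t. real t ^ i / real t ^ k) \<longlonglongrightarrow> 1" by (rule tendsto_eventually)
    then show ?thesis by (simp only: True refl if_True)
  next
    case False
    have "(\<lambda>t. inverse (real t) ^ (k - i)) \<longlonglongrightarrow> 0 ^ (k - i)"
      by (intro tendsto_power lim_inverse_n)
    moreover have "\<forall>\<^sub>F t in sequentially. inverse (real t) ^ (k - i) = real t ^ i / real t ^ k"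
      using eventually_gt_at_top[of 0]
      by eventually_elim (use that in \<open>simp add: power_diff field_simps\<close>)
    ultimately show ?thesis using False that by (simp add: tendsto_cong power_0_left)
  qed
  then have "(\<lambda>t. \<Sum>i\<le>k. Polynomial.coeff p i * (real t ^ i / real t ^ k)) \<longlonglongrightarrow>
      (\<Sum>i\<le>k. Polynomial.coeff p i * (if i = k then 1 else 0))"
    by (intro tendsto_sum tendsto_mult tendsto_const) auto
  moreover have "(\<Sum>i\<le>k. Polynomial.coeff p i * (if i = k then 1 else 0)) = Polynomial.coeff p k"
    by (simp add: if_distrib[of "(*) _"] cong: if_cong)
  moreover have "poly p x = (\<Sum>i\<le>k. Polynomial.coeff p i * x ^ i)" for x
    unfolding poly_altdef using assms by (intro sum.mono_neutral_left) (auto intro: le_degree)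
  ultimately show ?thesis by (simp add: sum_divide_distrib)
qed

lemma shifted_power_limit: "(\<lambda>t. (real t + c) ^ k / real t ^ k) \<longlonglongrightarrow> 1"
proof -
  have "poly ([:c, 1:] ^ k) x = (x + c) ^ k" for x :: real by (simp add: add.commute)
  moreover have "Polynomial.degree ([:c, 1:] ^ k) \<le> k" by (simp add: degree_power_eq)
  moreover have "Polynomial.coeff ([:c, 1:] ^ k) k = (1::real)" by (simp add: coeff_linear_poly_power)
  ultimately show ?thesis using poly_growth_limit[of "[:c, 1:] ^ k" k] by simp
qed

lemma dominated_growth_limit:
  fixes h :: "nat \<Rightarrow> real"
  assumes "\<And>t. 0 \<le> h t" "\<And>t. h t \<le> C * (real t + 1) ^ k" "k < d"
  shows "(\<lambda>t. h t / real t ^ d) \<longlonglongrightarrow> 0"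
proof -
  define q where "q = Polynomial.smult C ([:1, 1:] ^ k)"
  have "Polynomial.degree q \<le> k"
    unfolding q_def by (rule order_trans[OF degree_smult_le]) (simp add: degree_power_eq)
  then have deg: "Polynomial.degree q < d" using assms(3) by simp
  have q: "poly q x = C * (x + 1) ^ k" for x by (simp add: q_def add.commute)
  have "(\<lambda>t. C * (real t + 1) ^ k / real t ^ d) \<longlonglongrightarrow> 0"
    using poly_growth_limit[OF less_imp_le[OF deg]] unfolding q coeff_eq_0[OF deg] .
  then show ?thesis
    by (rule real_tendsto_sandwich[rotated 2, OF tendsto_const])
      (use assms(1,2) in \<open>auto intro!: divide_right_mono always_eventually\<close>)
qed

text \<open>The bound forces the degree of the polynomial to be at most \<open>k\<close>: otherwise
  division by the power of its own degree would give both the limit 0 and the leading coefficient.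
  The limit is then the coefficient at \<open>k\<close>, possibly 0.\<close>

lemma eventually_poly_limit:
  assumes "eventually_poly h" "\<And>t. 0 \<le> h t" "\<And>t. h t \<le> C * (real t + 1) ^ k"
  obtains b where "(\<lambda>t. h t / real t ^ k) \<longlonglongrightarrow> b"
proof -
  obtain p where p: "\<forall>\<^sub>F t in sequentially. h t = poly p (real t)"
    using assms(1) unfolding eventually_poly_def by blast
  have lim: "(\<lambda>t. h t / real t ^ d) \<longlonglongrightarrow> Polynomial.coeff p d" if "Polynomial.degree p \<le> d" for d
  proof -
    have "\<forall>\<^sub>F t in sequentially. poly p (real t) / real t ^ d = h t / real t ^ d"
      using p by eventually_elim simp
    then show ?thesis using poly_growth_limit[OF that] by (rule Lim_transform_eventually[rotated])
  qed
  have "Polynomial.degree p \<le> k"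
  proof (rule ccontr)
    assume "\<not> Polynomial.degree p \<le> k"
    then have "(\<lambda>t. h t / real t ^ Polynomial.degree p) \<longlonglongrightarrow> 0"
      by (intro dominated_growth_limit[OF assms(2,3)]) simp
    then have "Polynomial.lead_coeff p = 0" using lim[OF order_refl] LIMSEQ_unique by blast
    then show False using \<open>\<not> Polynomial.degree p \<le> k\<close> by simp
  qed
  then show thesis using lim that by blast
qed

lemma sum_small_o:
  fixes h :: "nat \<Rightarrow> real"
  assumes "(\<lambda>t. h t / real t ^ k) \<longlonglongrightarrow> 0"
  shows "(\<lambda>t. (\<Sum>s\<le>t. h s) / real t ^ Suc k) \<longlonglongrightarrow> 0"
proof (rule LIMSEQ_I)
  fix r :: real assume r: "0 < r"
  define \<epsilon> where "\<epsilon> = r / 3"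
  have \<epsilon>: "\<epsilon> > 0" using r by (simp add: \<epsilon>_def)
  then obtain N where N: "\<And>t. t \<ge> N \<Longrightarrow> norm (h t / real t ^ k - 0) < \<epsilon>"
    using LIMSEQ_D[OF assms] by blast
  define A where "A = (\<Sum>s\<le>N. \<bar>h s\<bar>)"
  have h: "\<bar>h s\<bar> \<le> \<epsilon> * real t ^ k" if "N < s" "s \<le> t" for s t
  proof -
    have "\<bar>h s\<bar> / real s ^ k < \<epsilon>" using N[of s] that by simp
    then have "\<bar>h s\<bar> \<le> \<epsilon> * real s ^ k" using that by (simp add: divide_less_eq split: if_splits)
    also have "\<dots> \<le> \<epsilon> * real t ^ k" using \<epsilon> that by (intro mult_left_mono power_mono) auto
    finally show ?thesis .
  qed
  have sum: "\<bar>\<Sum>s\<le>t. h s\<bar> \<le> A + \<epsilon> * real t ^ Suc k" if "t \<ge> N" for t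
  proof -
    have "\<bar>\<Sum>s\<le>t. h s\<bar> \<le> (\<Sum>s\<le>t. \<bar>h s\<bar>)" by (rule sum_abs)
    also have "(\<Sum>s\<le>t. \<bar>h s\<bar>) = (\<Sum>s\<in>{..N} \<union> {N<..t}. \<bar>h s\<bar>)"
      using that by (intro sum.cong) auto
    also have "\<dots> = A + (\<Sum>s\<in>{N<..t}. \<bar>h s\<bar>)"
      unfolding A_def by (intro sum.union_disjoint) auto
    also have "(\<Sum>s\<in>{N<..t}. \<bar>h s\<bar>) \<le> real (card {N<..t}) * (\<epsilon> * real t ^ k)"
      using h by (intro sum_bounded_above) auto
    also have "\<dots> \<le> real t * (\<epsilon> * real t ^ k)"
      using \<epsilon> by (intro mult_right_mono) auto
    finally show ?thesis by (simp add: mult_ac)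
  qed
  have "(\<lambda>t. A / real t ^ Suc k) \<longlonglongrightarrow> 0"
  proof (rule dominated_growth_limit[of _ A 0])
    show "A \<le> A * (real t + 1) ^ 0" "0 \<le> A" for t by (simp_all add: A_def sum_nonneg)
  qed simp
  then obtain M where M: "\<And>t. t \<ge> M \<Longrightarrow> norm (A / real t ^ Suc k - 0) < \<epsilon>"
    using LIMSEQ_D[OF _ \<epsilon>] by blast
  have "norm ((\<Sum>s\<le>t. h s) / real t ^ Suc k - 0) < r" if "t \<ge> Suc (max M N)" for t
  proof -
    have t: "real t ^ Suc k > 0" using that by simp
    have "\<bar>\<Sum>s\<le>t. h s\<bar> / real t ^ Suc k \<le> (A + \<epsilon> * real t ^ Suc k) / real t ^ Suc k"
      using sum[of t] that by (intro divide_right_mono) auto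
    also have "\<dots> = A / real t ^ Suc k + \<epsilon>" using that by (simp add: add_divide_distrib)
    also have "\<dots> < r"
    proof -
      have "norm (A / real t ^ Suc k - 0) < \<epsilon>" using that by (intro M) simp
      then have "A / real t ^ Suc k < \<epsilon>"
        unfolding real_norm_def diff_0_right by (rule le_less_trans[OF abs_ge_self])
      then show ?thesis using r unfolding \<epsilon>_def by linarith
    qed
    finally show ?thesis using t by simp
  qed
  then show "\<exists>no. \<forall>n\<ge>no. norm ((\<Sum>s\<le>n. h s) / real n ^ Suc k - 0) < r" by blast
qed

text \<open>Compare with the telescoping sum of (s+1)^(k+1) - s^(k+1), whose terms grow like (k+1)
  s^k. Subtracting \<open>b\<close> times these terms from (k+1) h(s) leaves something of smaller
  order than s^k, and \<open>sum_small_o\<close> carries this over to the sums.\<close>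

lemma cesaro_power:
  fixes h :: "nat \<Rightarrow> real"
  assumes "(\<lambda>t. h t / real t ^ k) \<longlonglongrightarrow> b"
  shows "(\<lambda>t. (\<Sum>s\<le>t. h s) / real t ^ Suc k) \<longlonglongrightarrow> b / real (Suc k)"
proof -
  define p :: "real poly" where "p = [:1, 1:] ^ Suc k - Polynomial.monom 1 (Suc k)"
  have cp: "Polynomial.coeff p i = (if i \<le> k then real (Suc k choose i) else 0)" for i
    unfolding p_def coeff_diff by (auto simp: coeff_linear_poly_power not_le degree_power_eq intro!: coeff_eq_0 simp del: power_Suc)
  have "Polynomial.degree p \<le> k" by (rule degree_le) (simp add: cp)
  from poly_growth_limit[OF this] have "(\<lambda>t. poly p (real t) / real t ^ k) \<longlonglongrightarrow> real (Suc k)"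
    unfolding cp by simp
  moreover have poly_p: "poly p x = (x + 1) ^ Suc k - x ^ Suc k" for x
    by (simp add: p_def poly_monom add.commute del: power_Suc)
  ultimately have "(\<lambda>t. real (Suc k) * (h t / real t ^ k) - b * (((real t + 1) ^ Suc k - real t ^ Suc k) / real t ^ k))
      \<longlonglongrightarrow> real (Suc k) * b - b * real (Suc k)"
    unfolding poly_p by (intro tendsto_diff tendsto_mult tendsto_const assms)
  then have "(\<lambda>t. (real (Suc k) * h t - b * ((real t + 1) ^ Suc k - real t ^ Suc k)) / real t ^ k) \<longlonglongrightarrow> 0"
    by (simp only: diff_divide_distrib right_diff_distrib times_divide_eq_right mult.commute[of b "real (Suc k)"] diff_self)
  from sum_small_o[OF this]
  have "(\<lambda>t. (\<Sum>s\<le>t. real (Suc k) * h s - b * ((real s + 1) ^ Suc k - real s ^ Suc k)) / real t ^ Suc k) \<longlonglongrightarrow> 0" .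
  moreover have "(\<Sum>s\<le>t. real (Suc k) * h s - b * ((real s + 1) ^ Suc k - real s ^ Suc k)) =
      real (Suc k) * (\<Sum>s\<le>t. h s) - b * (real t + 1) ^ Suc k" for t
    by (induction t) (simp_all add: algebra_simps)
  ultimately have "(\<lambda>t. (real (Suc k) * (\<Sum>s\<le>t. h s) - b * (real t + 1) ^ Suc k) / real t ^ Suc k) \<longlonglongrightarrow> 0"
    by simp
  then have "(\<lambda>t. ((real (Suc k) * (\<Sum>s\<le>t. h s) - b * (real t + 1) ^ Suc k) / real t ^ Suc k
      + b * ((real t + 1) ^ Suc k / real t ^ Suc k)) / real (Suc k)) \<longlonglongrightarrow> (0 + b * 1) / real (Suc k)"
    by (intro tendsto_divide tendsto_add tendsto_mult tendsto_const shifted_power_limit) simp_all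
  then show ?thesis by (simp add: diff_divide_distrib del: power_Suc of_nat_Suc)
qed

lemma shifted_growth_limit:
  fixes h :: "nat \<Rightarrow> real"
  assumes "(\<lambda>t. h t / real t ^ k) \<longlonglongrightarrow> b"
  shows "(\<lambda>t. h (t + d) / real t ^ k) \<longlonglongrightarrow> b"
proof -
  have "(\<lambda>t. h (t + d) / real (t + d) ^ k * ((real t + real d) ^ k / real t ^ k)) \<longlonglongrightarrow> b * 1"
    by (intro tendsto_mult LIMSEQ_ignore_initial_segment[OF assms] shifted_power_limit)
  moreover have "\<forall>\<^sub>F t in sequentially.
      h (t + d) / real (t + d) ^ k * ((real t + real d) ^ k / real t ^ k) = h (t + d) / real t ^ k"
    using eventually_gt_at_top[of 0] by eventually_elim simp
  ultimately have "(\<lambda>t. h (t + d) / real t ^ k) \<longlonglongrightarrow> b * 1" by (rule Lim_transform_eventually)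
  then show ?thesis by simp
qed

section \<open>Deleting the free vertex\<close>

locale free_vertex = uniform_edges +
  fixes x e0
  assumes e0: "e0 \<in> E" "x \<in> e0" "\<And>e. e \<in> E \<Longrightarrow> x \<in> e \<Longrightarrow> e = e0"
    and ne_V': "V - {x} \<noteq> {}"
begin

abbreviation "V' \<equiv> V - {x}"
abbreviation "E' \<equiv> {e \<in> E. x \<notin> e}"

lemma x_in_V: "x \<in> V" using e0(1,2) E_sub by blast

lemma e0_notin: "e0 \<notin> E'" using e0(2) by blast

lemma E_cases: "e \<in> E \<Longrightarrow> e = e0 \<or> e \<in> E'" using e0(3) by blast

lemma card_V: "card V = Suc (card V')"
  using x_in_V fin_V by (metis card_Suc_Diff1)

sublocale del: uniform_edges V' E' m
  by standard (use fin_V ne_V' E_sub card_edge m_pos in auto)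

lemma load_split:
  fixes c :: "_ \<Rightarrow> 'b::comm_monoid_add"
  shows "load E c v = load E' c v + (if v \<in> e0 then c e0 else 0)"
proof -
  have "load E c v = (if v \<in> e0 then c e0 else 0) + (\<Sum>e\<in>E - {e0}. if v \<in> e then c e else 0)"
    unfolding load_def using fin_E e0(1) by (simp add: sum.remove)
  also have "E - {e0} = E'" using e0 by blast
  finally show ?thesis by (simp add: load_def add.commute)
qed

text \<open>The value at \<open>x\<close> occurs only in the equation for \<open>e0\<close>, which
  determines it from the other values. So a normal vector of the deletion extends to
  \<open>V\<close>, and a normal vector on \<open>V\<close> cannot live on \<open>x\<close>
  alone.\<close>

lemma deficient_delete: "deficient V' E' \<longleftrightarrow> deficient V E"
proof
  assume "deficient V' E'"
  then obtain y :: "_ \<Rightarrow> real" and v where y: "v \<in> V'" "y v \<noteq> 0" "\<And>e. e \<in> E' \<Longrightarrow> (\<Sum>v\<in>e. y v) = 0"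
    unfolding deficient_def by blast
  define z where "z = y(x := - (\<Sum>v\<in>e0 - {x}. y v))"
  have "(\<Sum>v\<in>e. z v) = 0" if "e \<in> E" for e
  proof (cases "x \<in> e")
    case True
    then have [simp]: "e = e0" using that e0 by blast
    have "finite e0" using e0(1) E_sub fin_V finite_subset by blast
    moreover have "(\<Sum>v\<in>e0 - {x}. z v) = (\<Sum>v\<in>e0 - {x}. y v)" by (intro sum.cong) (auto simp: z_def)
    ultimately show ?thesis using e0(2) by (simp add: sum.remove) (simp add: z_def)
  next
    case False
    then have "(\<Sum>v\<in>e. z v) = (\<Sum>v\<in>e. y v)" by (intro sum.cong) (auto simp: z_def)
    then show ?thesis using y(3) that False by simp
  qed
  moreover have "z v \<noteq> 0" using y by (auto simp: z_def)
  ultimately show "deficient V E" unfolding deficient_def using y(1) by blast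
next
  assume "deficient V E"
  then obtain y :: "_ \<Rightarrow> real" and v where y: "v \<in> V" "y v \<noteq> 0" "\<And>e. e \<in> E \<Longrightarrow> (\<Sum>v\<in>e. y v) = 0"
    unfolding deficient_def by blast
  have "\<exists>v\<in>V'. y v \<noteq> 0"
  proof (rule ccontr)
    assume "\<not> (\<exists>v\<in>V'. y v \<noteq> 0)"
    then have 0: "y w = 0" if "w \<in> V" "w \<noteq> x" for w using that by auto
    then have "v = x" using y by blast
    have "finite e0" "e0 \<subseteq> V" using e0(1) E_sub fin_V finite_subset by blast+
    then have "(\<Sum>v\<in>e0. y v) = y x + (\<Sum>v\<in>e0 - {x}. y v)" using e0(2) by (simp add: sum.remove)
    also have "(\<Sum>v\<in>e0 - {x}. y v) = 0" using 0 \<open>e0 \<subseteq> V\<close> by (intro sum.neutral) auto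
    finally show False using y(2) y(3)[OF e0(1)] \<open>v = x\<close> by simp
  qed
  then show "deficient V' E'" unfolding deficient_def using y(3) by blast
qed

text \<open>The cone over the edges is the product of the ray of \<open>e0\<close> with the cone over the other
  edges, and the ray coordinate of an exponent is its value at \<open>x\<close>, hence an integer.\<close>

lemma card_cone_points:
  "card (cone_points V E m t) = (\<Sum>s\<le>t. card (cone_points V' E' m s))"
proof -
  \<comment> \<open>A pair consists of the budget \<open>s\<close> left for the deletion and a point
    \<open>q\<close> within it; the remaining \<open>t - s\<close> copies of \<open>e0\<close> raise
    the degree from below \<open>m * Suc s\<close> to below \<open>m * Suc t\<close>.\<close>
  define \<Psi> where "\<Psi> = (\<lambda>(s, q) v. q v + (if v \<in> e0 then t - s else 0 :: nat))"
  define S where "S = Sigma {..t} (cone_points V' E' m)"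
  have sum_V: "(\<Sum>v\<in>V. f v) = f x + (\<Sum>v\<in>V'. f v)" for f :: "_ \<Rightarrow> nat"
    using x_in_V fin_V by (simp add: sum.remove)
  have sum_e0: "(\<Sum>v\<in>V. if v \<in> e0 then a else 0) = m * a" for a :: nat
  proof -
    have "V \<inter> e0 = e0" "card e0 = m" using E_sub e0(1) card_edge by auto
    then show ?thesis using fin_V by (simp add: sum.inter_restrict[symmetric])
  qed
  have load_x: "load E' \<xi> x = 0" for \<xi> :: "_ \<Rightarrow> real" unfolding load_def by (intro sum.neutral) auto
  have inj: "inj_on \<Psi> S"
  proof (rule inj_onI, clarify)
    fix s q s' q' assume S: "(s, q) \<in> S" "(s', q') \<in> S" and eq: "\<Psi> (s, q) = \<Psi> (s', q')"
    have "q x = 0" "q' x = 0" "s \<le> t" "s' \<le> t"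
      using S by (auto simp: S_def cone_points_def exponents_def)
    then have "s = s'" using fun_cong[OF eq, of x] e0(2) by (simp add: \<Psi>_def)
    then have "q v = q' v" for v using fun_cong[OF eq, of v] by (simp add: \<Psi>_def)
    then show "s = s' \<and> q = q'" using \<open>s = s'\<close> by auto
  qed
  have "\<Psi> ` S = cone_points V E m t"
  proof (intro equalityI subsetI)
    fix f assume "f \<in> \<Psi> ` S"
    then obtain s q where f: "f = (\<lambda>v. q v + (if v \<in> e0 then t - s else 0))" "s \<le> t"
      "q \<in> cone_points V' E' m s" by (auto simp: \<Psi>_def S_def)
    then obtain \<xi> where q: "q \<in> exponents V'" "\<And>e. e \<in> E' \<Longrightarrow> 0 \<le> \<xi> e"
        "\<And>v. real (q v) = load E' \<xi> v" "(\<Sum>v\<in>V'. q v) < m * Suc s"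
      unfolding cone_points_def by blast
    define \<zeta> where "\<zeta> = \<xi>(e0 := real (t - s))"
    have "load E' \<zeta> v = load E' \<xi> v" for v
      unfolding load_def \<zeta>_def using e0_notin by (intro sum.cong) auto
    then have "real (f v) = load E \<zeta> v" for v
      unfolding load_split using q(3)[of v] by (simp add: f(1) \<zeta>_def)
    moreover have "0 \<le> \<zeta> e" if "e \<in> E" for e
      using q(2)[of e] E_cases[OF that] by (cases "e = e0") (simp_all add: \<zeta>_def)
    moreover have "(\<Sum>v\<in>V. f v) < m * Suc t"
    proof -
      have "q x = 0" using q(1) by (simp add: exponents_def)
      then have "(\<Sum>v\<in>V. f v) = (\<Sum>v\<in>V'. q v) + m * (t - s)"
        unfolding f(1) sum.distrib sum_e0 by (simp add: sum_V)
      also have "\<dots> < m * Suc s + m * (t - s)" using q(4) by simp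
      also have "\<dots> = m * Suc t" using f(2) by (simp flip: add_mult_distrib2)
      finally show ?thesis .
    qed
    moreover have "f \<in> exponents V"
      using q(1) e0(1) E_sub by (auto simp: f(1) exponents_def)
    ultimately show "f \<in> cone_points V E m t" unfolding cone_points_def by blast
  next
    fix f assume "f \<in> cone_points V E m t"
    then obtain \<xi> where f: "f \<in> exponents V" "\<And>e. e \<in> E \<Longrightarrow> 0 \<le> \<xi> e"
        "\<And>v. real (f v) = load E \<xi> v" "(\<Sum>v\<in>V. f v) < m * Suc t"
      unfolding cone_points_def by blast
    define a where "a = f x"
    have \<xi>_e0: "\<xi> e0 = real a" using f(3)[of x] e0(2) by (simp add: a_def load_split load_x)
    have fv: "real (f v) = load E' \<xi> v + (if v \<in> e0 then real a else 0)" for v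
      using f(3)[of v] by (simp add: load_split \<xi>_e0)
    \<comment> \<open>The \<open>a\<close> copies of \<open>e0\<close> fit below \<open>f\<close>
      since the other edges contribute a non-negative amount; this makes the subtraction in
      \<open>q\<close> exact.\<close>
    have "0 \<le> load E' \<xi> v" for v unfolding load_def using f(2) by (intro sum_nonneg) auto
    then have "real (if v \<in> e0 then a else 0) \<le> real (f v)" for v
      unfolding fv by simp
    then have le: "(if v \<in> e0 then a else 0) \<le> f v" for v unfolding of_nat_le_iff .
    define q where "q = (\<lambda>v. f v - (if v \<in> e0 then a else 0))"
    have f_q: "f v = q v + (if v \<in> e0 then a else 0)" for v using le[of v] by (simp add: q_def)
    have qx: "q x = 0" using e0(2) by (simp add: q_def a_def)
    have deg: "(\<Sum>v\<in>V. f v) = (\<Sum>v\<in>V'. q v) + m * a"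
      unfolding f_q sum.distrib sum_e0 by (simp add: sum_V qx)
    then have "m * a < m * Suc t" using f(4) by simp
    then have a: "a \<le> t" unfolding mult_less_cancel1 by simp
    have "m * Suc t = m * Suc (t - a) + m * a" using a by (simp flip: add_mult_distrib2)
    then have "(\<Sum>v\<in>V'. q v) + m * a < m * Suc (t - a) + m * a"
      using f(4) unfolding deg by simp
    then have "(\<Sum>v\<in>V'. q v) < m * Suc (t - a)" by simp
    moreover have "real (q v) = load E' \<xi> v" for v
      using fv[of v] unfolding f_q[of v] by (auto split: if_splits)
    moreover have "q \<in> exponents V'" using f(1) qx by (auto simp: exponents_def q_def)
    ultimately have "q \<in> cone_points V' E' m (t - a)"
      unfolding cone_points_def using f(2) by blast
    then have "(t - a, q) \<in> S" by (simp add: S_def)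
    moreover have "\<Psi> (t - a, q) = f" using a f_q by (auto simp: \<Psi>_def)
    ultimately show "f \<in> \<Psi> ` S" by blast
  qed
  then have "card (cone_points V E m t) = card S" using inj by (metis card_image)
  also have "\<dots> = (\<Sum>s\<le>t. card (cone_points V' E' m s))"
    unfolding S_def using del.finite_cone_points by (intro card_SigmaI) auto
  finally show ?thesis .
qed

lemma sum_shift_le:
  fixes h :: "nat \<Rightarrow> nat"
  shows "(\<Sum>s\<le>t. h (s + d)) \<le> (\<Sum>s\<le>t + d. h s)"
proof -
  have "(\<Sum>s\<le>t. h (s + d)) = sum h ((\<lambda>s. s + d) ` {..t})" by (simp add: sum.reindex)
  also have "\<dots> \<le> (\<Sum>s\<le>t + d. h s)" by (intro sum_mono2) auto
  finally show ?thesis .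
qed

text \<open>Pass from torsion to the cone, apply \<open>card_cone_points\<close>, and return to
  torsion for the deletion inside the outer sum. The shifts of the two comparisons add up.\<close>

lemma torsion_le_delete:
  assumes "\<not> deficient V E"
  shows "\<exists>d. \<forall>t. (\<Sum>s\<le>t. card (torsion V E s)) \<le>
    (\<Sum>s\<le>t + d. \<Sum>r\<le>s. card (torsion V' E' r))"
proof -
  obtain d1 where d1: "\<And>t. (\<Sum>s\<le>t. card (torsion V E s)) \<le> card (cone_points V E m (t + d1))"
    using torsion_le_cone_points[OF assms] by blast
  obtain d2 where d2: "\<And>t. card (cone_points V' E' m t) \<le> (\<Sum>s\<le>t + d2. card (torsion V' E' s))"
    using del.cone_points_le_torsion assms deficient_delete by blast
  have "(\<Sum>s\<le>t. card (torsion V E s)) \<le> (\<Sum>s\<le>t + (d1 + d2). \<Sum>r\<le>s. card (torsion V' E' r))" for t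
  proof -
    have "(\<Sum>s\<le>t. card (torsion V E s)) \<le> (\<Sum>s\<le>t + d1. card (cone_points V' E' m s))"
      using d1 card_cone_points by metis
    also have "\<dots> \<le> (\<Sum>s\<le>t + d1. \<Sum>r\<le>s + d2. card (torsion V' E' r))" using d2 by (intro sum_mono)
    also have "\<dots> \<le> (\<Sum>s\<le>t + d1 + d2. \<Sum>r\<le>s. card (torsion V' E' r))" by (rule sum_shift_le)
    finally show ?thesis by (simp add: add.assoc)
  qed
  then show ?thesis by blast
qed

lemma delete_le_torsion:
  assumes "\<not> deficient V E"
  shows "\<exists>d. \<forall>t. (\<Sum>s\<le>t. \<Sum>r\<le>s. card (torsion V' E' r)) \<le>
    (\<Sum>s\<le>t + d. card (torsion V E s))"
proof -
  obtain d1 where d1: "\<And>t. (\<Sum>s\<le>t. card (torsion V' E' s)) \<le> card (cone_points V' E' m (t + d1))"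
    using del.torsion_le_cone_points assms deficient_delete by blast
  obtain d2 where d2: "\<And>t. card (cone_points V E m t) \<le> (\<Sum>s\<le>t + d2. card (torsion V E s))"
    using cone_points_le_torsion[OF assms] by blast
  have "(\<Sum>s\<le>t. \<Sum>r\<le>s. card (torsion V' E' r)) \<le> (\<Sum>s\<le>t + (d1 + d2). card (torsion V E s))" for t
  proof -
    have "(\<Sum>s\<le>t. \<Sum>r\<le>s. card (torsion V' E' r)) \<le> (\<Sum>s\<le>t. card (cone_points V' E' m (s + d1)))"
      using d1 by (intro sum_mono)
    also have "\<dots> \<le> card (cone_points V E m (t + d1))"
      unfolding card_cone_points by (rule sum_shift_le)
    also have "\<dots> \<le> (\<Sum>s\<le>t + d1 + d2. card (torsion V E s))" by (rule d2)
    finally show ?thesis by (simp add: add.assoc)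
  qed
  then show ?thesis by blast
qed

end

section \<open>Comparison of the limits\<close>

lemma (in uniform_edges) torsion_limit:
  obtains b where "(\<lambda>t. real (card (torsion V E t)) / real t ^ (card V - 1)) \<longlonglongrightarrow> b"
proof -
  obtain C where C: "\<And>t. card (torsion V E t) \<le> C * (t + 1) ^ (card V - 1)"
    using card_torsion_le by blast
  have "real (card (torsion V E t)) \<le> real C * (real t + 1) ^ (card V - 1)" for t
  proof -
    have "real (card (torsion V E t)) \<le> real (C * (t + 1) ^ (card V - 1))"
      using C of_nat_le_iff by blast
    then show ?thesis by (simp add: add.commute)
  qed
  then show thesis using eventually_poly_limit[OF eventually_poly_card_torsion] that by auto
qed

text \<open>The sums divided by t^(card V) tend to 0 by the deficient bound, and to b / card V by
  \<open>cesaro_power\<close>.\<close>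

lemma (in uniform_edges) torsion_limit_deficient:
  assumes "deficient V E" "(\<lambda>t. real (card (torsion V E t)) / real t ^ (card V - 1)) \<longlonglongrightarrow> b"
  shows "b = 0"
proof -
  have "card V > 0" using fin_V ne_V by (simp add: card_gt_0_iff)
  obtain C where C: "\<And>t. (\<Sum>s\<le>t. card (torsion V E s)) \<le> C * (t + 1) ^ (card V - 1)"
    using card_torsion_le_deficient[OF assms(1)] by blast
  have "(\<Sum>s\<le>t. real (card (torsion V E s))) \<le> real C * (real t + 1) ^ (card V - 1)" for t
  proof -
    have "real (\<Sum>s\<le>t. card (torsion V E s)) \<le> real (C * (t + 1) ^ (card V - 1))"
      using C of_nat_le_iff by blast
    then show ?thesis by (simp add: add.commute)
  qed
  then have "(\<lambda>t. (\<Sum>s\<le>t. real (card (torsion V E s))) / real t ^ Suc (card V - 1)) \<longlonglongrightarrow> 0"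
    by (intro dominated_growth_limit[of _ "real C" "card V - 1"]) (auto intro: sum_nonneg)
  from LIMSEQ_unique[OF this cesaro_power[OF assms(2)]] show ?thesis by simp
qed

lemma (in free_vertex) torsion_limits:
  obtains L where
    "(\<lambda>t. fact (card V - 1) * (real (card (torsion V E t)) / real t ^ (card V - 1))) \<longlonglongrightarrow> L"
    "(\<lambda>t. fact (card V' - 1) * (real (card (torsion V' E' t)) / real t ^ (card V' - 1))) \<longlonglongrightarrow> L"
proof -
  define k where "k = card V' - 1"
  have k: "card V' = Suc k" "card V = Suc (Suc k)"
    using card_V del.fin_V ne_V' by (auto simp: k_def card_gt_0_iff Suc_diff_1)
  define h where "h = (\<lambda>t. real (card (torsion V E t)))"
  define h' where "h' = (\<lambda>t. real (card (torsion V' E' t)))"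
  obtain b where b: "(\<lambda>t. h t / real t ^ Suc k) \<longlonglongrightarrow> b"
    using torsion_limit unfolding h_def k by auto
  obtain a where a: "(\<lambda>t. h' t / real t ^ k) \<longlonglongrightarrow> a"
    using del.torsion_limit unfolding h'_def k by auto
  \<comment> \<open>The hypergraph has k + 2 vertices and its deletion k + 1, so this relation is
    what makes the normalizing factors (k+1)! and k! agree.\<close>
  have "b * real (Suc k) = a"
  proof (cases "deficient V E")
    case True
    then have "b = 0" using torsion_limit_deficient[of b] b by (simp add: h_def k)
    moreover have "a = 0"
      using True deficient_delete del.torsion_limit_deficient[of a] a by (simp add: h'_def k)
    ultimately show ?thesis by simp
  next
    case False
    \<comment> \<open>One summation for the hypergraph and two for its deletion bring both to the
      order t^(k+2), where each is bounded by a shift of the other.\<close>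
    define D where "D = (\<lambda>t. \<Sum>s\<le>t. h s)"
    define D' where "D' = (\<lambda>t. \<Sum>s\<le>t. \<Sum>r\<le>s. h' r)"
    have D: "(\<lambda>t. D t / real t ^ Suc (Suc k)) \<longlonglongrightarrow> b / real (Suc (Suc k))"
      unfolding D_def by (rule cesaro_power[OF b])
    have D': "(\<lambda>t. D' t / real t ^ Suc (Suc k)) \<longlonglongrightarrow> a / real (Suc k) / real (Suc (Suc k))"
      unfolding D'_def by (intro cesaro_power a)
    obtain d where d: "\<And>t. (\<Sum>s\<le>t. card (torsion V E s)) \<le>
        (\<Sum>s\<le>t + d. \<Sum>r\<le>s. card (torsion V' E' r))"
      using torsion_le_delete[OF False] by blast
    have "D t \<le> D' (t + d)" for t
      unfolding D_def D'_def h_def h'_def using d[of t] by (simp flip: of_nat_sum)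
    then have "b / real (Suc (Suc k)) \<le> a / real (Suc k) / real (Suc (Suc k))"
      by (intro LIMSEQ_le[OF D shifted_growth_limit[OF D', of d]] exI allI impI divide_right_mono) auto
    then have 1: "b \<le> a / real (Suc k)" by (simp only: divide_le_cancel)
    obtain d where d: "\<And>t. (\<Sum>s\<le>t. \<Sum>r\<le>s. card (torsion V' E' r)) \<le>
        (\<Sum>s\<le>t + d. card (torsion V E s))"
      using delete_le_torsion[OF False] by blast
    have "D' t \<le> D (t + d)" for t
      unfolding D_def D'_def h_def h'_def using d[of t] by (simp flip: of_nat_sum)
    then have "a / real (Suc k) / real (Suc (Suc k)) \<le> b / real (Suc (Suc k))"
      by (intro LIMSEQ_le[OF D' shifted_growth_limit[OF D, of d]] exI allI impI divide_right_mono) auto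
    then have 2: "a / real (Suc k) \<le> b" by (simp only: divide_le_cancel)
    have "b = a / real (Suc k)" using 1 2 by (rule antisym)
    then show ?thesis by simp
  qed
  then have eq: "fact (Suc k) * b = fact k * a" by auto
  have "(\<lambda>t. fact (Suc k) * (h t / real t ^ Suc k)) \<longlonglongrightarrow> fact k * a"
    unfolding eq[symmetric] by (intro tendsto_mult tendsto_const b)
  moreover have "(\<lambda>t. fact k * (h' t / real t ^ k)) \<longlonglongrightarrow> fact k * a"
    by (intro tendsto_mult tendsto_const a)
  ultimately show thesis
    by (intro that[of "fact k * a"]) (simp_all only: h_def h'_def k diff_Suc_1)
qed

section \<open>Monomial ideals in the local ring\<close>

abbreviation lookup :: "('a \<Rightarrow>\<^sub>0 'b::zero) \<Rightarrow> 'a \<Rightarrow> 'b"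
  where "lookup \<equiv> Poly_Mapping.lookup"

abbreviation keys :: "('a \<Rightarrow>\<^sub>0 'b::zero) \<Rightarrow> 'a set"
  where "keys \<equiv> Poly_Mapping.keys"

abbreviation single :: "'a \<Rightarrow> 'b \<Rightarrow> 'a \<Rightarrow>\<^sub>0 'b::zero"
  where "single \<equiv> Poly_Mapping.single"

section \<open>Polynomials with prescribed support\<close>

definition monomials :: "'v set \<Rightarrow> ('v \<Rightarrow>\<^sub>0 nat) set"
  where "monomials V = {\<alpha>. keys \<alpha> \<subseteq> V}"

definition supported :: "('v \<Rightarrow>\<^sub>0 nat) set \<Rightarrow> ('v, 'k::zero) mpoly set"
  where "supported U = {p. keys p \<subseteq> U}"

text \<open>The exponent sets of monomial ideals in the polynomial ring over
  \<open>V\<close>.\<close>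

definition upward :: "'v set \<Rightarrow> ('v \<Rightarrow>\<^sub>0 nat) set \<Rightarrow> bool"
  where "upward V U \<longleftrightarrow> U \<subseteq> monomials V \<and> (\<forall>\<alpha>\<in>U. \<forall>\<beta>\<in>monomials V. \<alpha> + \<beta> \<in> U)"

definition total_degree :: "'v set \<Rightarrow> ('v \<Rightarrow>\<^sub>0 nat) \<Rightarrow> nat"
  where "total_degree V \<alpha> = (\<Sum>v\<in>V. lookup \<alpha> v)"

abbreviation monomial :: "('v \<Rightarrow>\<^sub>0 nat) \<Rightarrow> ('v, 'k::{zero, one}) mpoly"
  where "monomial \<alpha> \<equiv> single \<alpha> 1"

lemma monomials_0 [simp]: "0 \<in> monomials V"
  by (simp add: monomials_def)

lemma monomials_add: "\<alpha> \<in> monomials V \<Longrightarrow> \<beta> \<in> monomials V \<Longrightarrow> \<alpha> + \<beta> \<in> monomials V"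
  using keys_add[of \<alpha> \<beta>] by (auto simp: monomials_def)

lemma monomials_add_D:
  fixes \<alpha> \<beta> :: "'v \<Rightarrow>\<^sub>0 nat"
  assumes "\<alpha> + \<beta> \<in> monomials V"
  shows "\<alpha> \<in> monomials V" "\<beta> \<in> monomials V"
  using assms unfolding monomials_def by (auto simp: in_keys_iff lookup_add subset_iff)

lemma monomials_single [simp]: "single v k \<in> monomials V \<longleftrightarrow> k = 0 \<or> v \<in> V"
  by (auto simp: monomials_def)

lemma total_degree_add: "total_degree V (\<alpha> + \<beta>) = total_degree V \<alpha> + total_degree V \<beta>"
  by (simp add: total_degree_def lookup_add sum.distrib)

lemma total_degree_eq_0:
  assumes "finite V" "\<alpha> \<in> monomials V"
  shows "total_degree V \<alpha> = 0 \<longleftrightarrow> \<alpha> = 0"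
proof
  assume "total_degree V \<alpha> = 0"
  then have "lookup \<alpha> v = 0" for v
    using assms by (cases "v \<in> V") (auto simp: total_degree_def monomials_def in_keys_iff subset_iff)
  then show "\<alpha> = 0" by (intro poly_mapping_eqI) simp
qed (simp add: total_degree_def)

lemma upward_monomials: "upward V (monomials V)"
  by (simp add: upward_def monomials_add)

lemma upward_empty: "upward V {}"
  by (simp add: upward_def)

lemma upward_addI: "upward V U \<Longrightarrow> \<alpha> \<in> U \<Longrightarrow> \<beta> \<in> monomials V \<Longrightarrow> \<alpha> + \<beta> \<in> U"
  by (simp add: upward_def)

lemma supported_mono: "U \<subseteq> U' \<Longrightarrow> supported U \<subseteq> supported U'"
  by (auto simp: supported_def)

lemma supported_add: "p \<in> supported U \<Longrightarrow> q \<in> supported U \<Longrightarrow> p + q \<in> supported U"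
  using keys_add[of p q] by (auto simp: supported_def)

lemma supported_0 [simp]: "0 \<in> supported U"
  by (simp add: supported_def)

lemma supported_1 [simp]: "0 \<in> U \<Longrightarrow> (1 :: ('v, 'k::field) mpoly) \<in> supported U"
  by (simp add: supported_def)

lemma supported_uminus: "p \<in> supported U \<Longrightarrow> - p \<in> supported U"
  for p :: "('v, 'k::field) mpoly"
  by (auto simp: supported_def in_keys_iff subset_iff)

lemma supported_single [simp]: "single \<alpha> c \<in> supported U \<longleftrightarrow> c = 0 \<or> \<alpha> \<in> U"
  by (auto simp: supported_def)

lemma supported_mult:
  assumes "p \<in> supported U" "q \<in> supported U'" "\<And>\<alpha> \<beta>. \<alpha> \<in> U \<Longrightarrow> \<beta> \<in> U' \<Longrightarrow> \<alpha> + \<beta> \<in> W"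
  shows "p * q \<in> supported W"
  using keys_mult[of p q] assms unfolding supported_def by blast

lemma supported_mult_upward:
  fixes p q :: "('v, 'k::field) mpoly"
  assumes "upward V U" "p \<in> supported U" "q \<in> supported (monomials V)"
  shows "p * q \<in> supported U" "q * p \<in> supported U"
proof -
  show "p * q \<in> supported U"
    using assms by (auto intro: supported_mult[OF assms(2,3)] upward_addI)
  then show "q * p \<in> supported U" by (simp add: mult.commute)
qed

lemma sum_singles:
  fixes p :: "('v, 'k::field) mpoly"
  shows "(\<Sum>\<alpha>\<in>keys p. single \<alpha> (lookup p \<alpha>)) = p"
  by (rule poly_mapping_eqI)
    (auto simp: lookup_sum lookup_single when_def in_keys_iff)

lemma supported_induct [consumes 1, case_names zero add single]:
  fixes p :: "('v, 'k::field) mpoly"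
  assumes "p \<in> supported U" "P 0" "\<And>p q. P p \<Longrightarrow> P q \<Longrightarrow> P (p + q)"
    "\<And>\<alpha> c. \<alpha> \<in> U \<Longrightarrow> P (single \<alpha> c)"
  shows "P p"
proof -
  have "P (\<Sum>\<alpha>\<in>F. single \<alpha> (lookup p \<alpha>))"
    if "F \<subseteq> keys p" for F
    using finite_subset[OF that finite_keys] that
    by (induction F rule: finite_induct) (use assms in \<open>auto simp: supported_def\<close>)
  then show ?thesis using sum_singles[of p] by (metis order_refl)
qed

text \<open>No other pair of terms contributes to this coefficient. The uniqueness assumption holds
  for terms that are extremal in a suitable sense, such as least degree or largest weight, so this
  is the common core of the leading term arguments below.\<close>

lemma lookup_mult_unique:
  fixes p q :: "('v, 'k::field) mpoly"
  assumes "\<And>\<gamma> \<delta>. \<gamma> \<in> keys p \<Longrightarrow> \<delta> \<in> keys q \<Longrightarrow>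
    \<gamma> + \<delta> = \<alpha> + \<beta> \<Longrightarrow> \<gamma> = \<alpha> \<and> \<delta> = \<beta>"
  shows "lookup (p * q) (\<alpha> + \<beta>) = lookup p \<alpha> * lookup q \<beta>"
proof -
  have inner: "lookup p \<gamma> * (\<Sum>\<delta>. lookup q \<delta> when \<alpha> + \<beta> = \<gamma> + \<delta>) =
      (lookup p \<alpha> * lookup q \<beta> when \<gamma> = \<alpha>)" for \<gamma>
  proof (cases "\<gamma> = \<alpha>")
    case True
    then show ?thesis by (simp add: when_def)
  next
    case False
    have "lookup p \<gamma> * (lookup q \<delta> when \<alpha> + \<beta> = \<gamma> + \<delta>) = 0" for \<delta>
    proof (rule ccontr)
      assume "\<not> ?thesis"
      then have "\<gamma> \<in> keys p" "\<delta> \<in> keys q" "\<gamma> + \<delta> = \<alpha> + \<beta>"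
        by (auto simp: in_keys_iff when_def split: if_splits)
      then show False using assms False by blast
    qed
    then have "lookup p \<gamma> = 0 \<or> (\<forall>\<delta>. (lookup q \<delta> when \<alpha> + \<beta> = \<gamma> + \<delta>) = 0)"
      by auto
    then show ?thesis using False by auto
  qed
  show ?thesis unfolding lookup_mult inner by simp
qed

lemma lookup_mult_zero:
  fixes p q :: "('v, 'k::field) mpoly"
  shows "lookup (p * q) 0 = lookup p 0 * lookup q 0"
proof -
  have *: "\<gamma> = 0 \<and> \<delta> = 0" if "\<gamma> + \<delta> = 0" for \<gamma> \<delta> :: "'v \<Rightarrow>\<^sub>0 nat"
  proof -
    have "lookup \<gamma> v = 0" "lookup \<delta> v = 0" for v
      using arg_cong[OF that, of "\<lambda>x. lookup x v"] by (auto simp: lookup_add)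
    then show ?thesis by (auto intro: poly_mapping_eqI)
  qed
  have "lookup (p * q) (0 + 0) = lookup p 0 * lookup q 0"
    by (rule lookup_mult_unique) (metis * add_0)
  then show ?thesis by simp
qed

text \<open>A term of \<open>p\<close> of least degree outside \<open>U\<close> would survive in the product.\<close>

lemma supported_cancel:
  fixes p s :: "('v, 'k::field) mpoly"
  assumes "upward V U" "p \<in> supported (monomials V)" "s \<in> supported (monomials V)"
    "lookup s 0 \<noteq> 0" "finite V" "s * p \<in> supported U"
  shows "p \<in> supported U"
proof (rule ccontr)
  assume "p \<notin> supported U"
  then have "\<exists>\<alpha>. \<alpha> \<in> keys p - U" by (auto simp: supported_def)
  then obtain \<alpha> where \<alpha>: "\<alpha> \<in> keys p - U"
    "\<And>\<beta>. \<beta> \<in> keys p - U \<Longrightarrow> total_degree V \<alpha> \<le> total_degree V \<beta>"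
    using ex_has_least_nat[of "\<lambda>\<alpha>. \<alpha> \<in> keys p - U" _ "total_degree V"] by blast
  have "\<gamma> = 0 \<and> \<delta> = \<alpha>" if "\<gamma> \<in> keys s" "\<delta> \<in> keys p" "\<gamma> + \<delta> = 0 + \<alpha>" for \<gamma> \<delta>
  proof -
    have \<gamma>: "\<gamma> \<in> monomials V" using that assms(3) by (auto simp: supported_def)
    then have "\<delta> \<notin> U" using \<alpha>(1) that(3) upward_addI[OF assms(1)] by (auto simp: add.commute)
    then have "total_degree V \<alpha> \<le> total_degree V \<delta>" using \<alpha>(2) that(2) by blast
    moreover have "total_degree V \<alpha> = total_degree V \<gamma> + total_degree V \<delta>"
      using that(3) total_degree_add by (metis add_0)
    ultimately have "\<gamma> = 0" using total_degree_eq_0[OF assms(5) \<gamma>] by simp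
    then show ?thesis using that(3) by simp
  qed
  then have "lookup (s * p) (0 + \<alpha>) = lookup s 0 * lookup p \<alpha>"
    by (rule lookup_mult_unique)
  then have "\<alpha> \<in> keys (s * p)" using assms(4) \<alpha>(1) by (simp add: in_keys_iff)
  then show False using assms(6) \<alpha>(1) by (auto simp: supported_def)
qed

section \<open>The polynomial ring localized at the origin\<close>

locale local_polynomials =
  fixes K :: "'k::field itself" and V :: "'v set"
  assumes finV: "finite V"
begin

abbreviation R where "R \<equiv> mpoly_ring K V"
abbreviation S where "S \<equiv> non_origin K V"
abbreviation A where "A \<equiv> local_mpoly_ring K V"
abbreviation frac where "frac a s \<equiv> fraction R S a s"

lemma R_simps [simp]:
  "x \<otimes>\<^bsub>R\<^esub> y = x * y" "\<one>\<^bsub>R\<^esub> = 1" "\<zero>\<^bsub>R\<^esub> = 0" "x \<oplus>\<^bsub>R\<^esub> y = x + y"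
  by (simp_all add: mpoly_ring_def)

lemma carrier_R: "carrier R = supported (monomials V)"
  by (auto simp: mpoly_ring_def supported_def monomials_def)

lemma R_closed:
  assumes "a \<in> carrier R" "b \<in> carrier R"
  shows "a + b \<in> carrier R" "a * b \<in> carrier R" "- a \<in> carrier R" "0 \<in> carrier R" "1 \<in> carrier R"
  using assms supported_mult[of a "monomials V" b "monomials V" "monomials V"]
  by (auto simp: carrier_R supported_add supported_uminus monomials_add)

lemma cring_R: "cring R"
proof (rule cringI)
  show "abelian_group R"
  proof (rule abelian_groupI)
    show "\<exists>y\<in>carrier R. y \<oplus>\<^bsub>R\<^esub> x = \<zero>\<^bsub>R\<^esub>" if "x \<in> carrier R" for x
      using R_closed(3)[OF that that] by (intro bexI[of _ "- x"]) auto
  qed (use R_closed in \<open>auto simp: carrier_R add_ac\<close>)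
  show "comm_monoid R"
    by (rule comm_monoidI) (use R_closed in \<open>auto simp: carrier_R mult_ac\<close>)
qed (simp add: distrib_right)

text \<open>Every monomial other than 1 is divisible by a variable, so the ideal generated by the
  variables consists of the polynomials without constant term.\<close>

lemma S_iff: "s \<in> S \<longleftrightarrow> s \<in> carrier R \<and> lookup s 0 \<noteq> 0"
proof -
  interpret cring R by (rule cring_R)
  have Var: "Var ` V \<subseteq> carrier R" by (auto simp: carrier_R Var_def)
  have *: "ideal {p \<in> carrier R. lookup p 0 = 0} R"
  proof (rule idealI[OF ring_axioms])
    have inv: "inv\<^bsub>add_monoid R\<^esub> a = - a" if "a \<in> carrier R" for a
      using that R_closed(3)[OF that that] minus_equality[of "- a" a] by (simp add: a_inv_def)
    show "subgroup {p \<in> carrier R. lookup p 0 = 0} (add_monoid R)"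
    proof (rule subgroup.intro)
      fix x assume "x \<in> {p \<in> carrier R. lookup p 0 = 0}"
      then show "inv\<^bsub>add_monoid R\<^esub> x \<in> {p \<in> carrier R. lookup p 0 = 0}"
        using R_closed(3)[of x x] by (subst inv) auto
    qed (auto simp: lookup_add carrier_R supported_add)
  qed (auto simp: lookup_mult_zero R_closed(2))
  have "Idl\<^bsub>R\<^esub> (Var ` V) = {p \<in> carrier R. lookup p 0 = 0}"
  proof
    show "Idl\<^bsub>R\<^esub> (Var ` V) \<subseteq> {p \<in> carrier R. lookup p 0 = 0}"
    proof (rule genideal_minimal[OF *])
      have "lookup (Var v :: ('v, 'k) mpoly) 0 = 0" for v
        unfolding Var_def by (intro lookup_single_not_eq) (metis lookup_single_eq lookup_zero one_neq_zero)
      then show "Var ` V \<subseteq> {p \<in> carrier R. lookup p 0 = 0}" using Var by auto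
    qed
    show "{p \<in> carrier R. lookup p 0 = 0} \<subseteq> Idl\<^bsub>R\<^esub> (Var ` V)"
    proof
      fix p assume "p \<in> {p \<in> carrier R. lookup p 0 = 0}"
      then have "p \<in> supported (monomials V - {0})"
        by (auto simp: carrier_R supported_def in_keys_iff)
      then show "p \<in> Idl\<^bsub>R\<^esub> (Var ` V)"
      proof (induction rule: supported_induct)
        case zero
        then show ?case
          using additive_subgroup.zero_closed[OF ideal.axioms(1)[OF genideal_ideal[OF Var]]] by simp
      next
        case (add p q)
        then show ?case
          using additive_subgroup.a_closed[OF ideal.axioms(1)[OF genideal_ideal[OF Var]]] by simp
      next
        case (single \<alpha> c)
        then have "\<exists>v. v \<in> keys \<alpha>" by (metis DiffD2 ex_in_conv keys_eq_empty singletonI)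
        then obtain v where v: "v \<in> keys \<alpha>" by blast
        define \<beta> where "\<beta> = \<alpha> - single v 1"
        have \<alpha>: "\<alpha> = \<beta> + single v 1"
          using v by (intro poly_mapping_eqI) (auto simp: \<beta>_def lookup_add lookup_minus lookup_single when_def in_keys_iff)
        have "v \<in> V" "\<beta> \<in> monomials V"
          using v single monomials_add_D(1)[of \<beta>] \<alpha> by (auto simp: monomials_def)
        then have "single \<beta> c * Var v \<in> Idl\<^bsub>R\<^esub> (Var ` V)"
          using ideal.I_l_closed[OF genideal_ideal[OF Var], of "Var v" "single \<beta> c"]
            genideal_self[OF Var] by (auto simp: carrier_R)
        then show ?case using \<alpha> by (simp add: Var_def mult_single)
      qed
    qed
  qed
  then show ?thesis by (auto simp: non_origin_def)
qed

lemma S_closed: "s \<in> S \<Longrightarrow> t \<in> S \<Longrightarrow> s * t \<in> S"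
  using R_closed by (simp add: S_iff lookup_mult_zero)

lemma S_R: "s \<in> S \<Longrightarrow> s \<in> carrier R" by (simp add: S_iff)

lemma S_1: "1 \<in> S" by (simp add: S_iff carrier_R)

text \<open>The empty set is upward closed and supports only 0, so \<open>supported_cancel\<close>
  shows that a polynomial with non-zero constant term is not a zero divisor.\<close>

lemma S_cancel:
  assumes "s \<in> S" "a \<in> carrier R" "b \<in> carrier R" "s * a = s * b"
  shows "a = b"
proof -
  have "s * (a - b) = 0" using assms(4) by (simp add: right_diff_distrib)
  moreover have "a - b \<in> supported (monomials V)"
    using R_closed(1,3) assms(2,3) unfolding carrier_R by (metis diff_conv_add_uminus)
  ultimately have "a - b \<in> supported {}"
    using assms(1) finV by (intro supported_cancel[OF upward_empty[of V], of "a - b" s])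
      (auto simp: S_iff carrier_R)
  then show ?thesis by (simp add: supported_def)
qed

lemma fraction_rel_eq: "fraction_rel R S =
    {((a, s), (b, t)). a \<in> carrier R \<and> s \<in> S \<and> b \<in> carrier R \<and> t \<in> S \<and> a * t = b * s}"
proof -
  have "a * t = b * s"
    if "u * (a * t) = u * (b * s)" "a \<in> carrier R" "s \<in> S" "b \<in> carrier R" "t \<in> S" "u \<in> S" for a s b t u
    using that R_closed(2) S_R by - (rule S_cancel[of u], auto)
  then show ?thesis unfolding fraction_rel_def R_simps by (auto intro: bexI[OF _ S_1])
qed

lemma equiv_fraction_rel: "equiv (carrier R \<times> S) (fraction_rel R S)"
proof (rule equivI)
  show "trans (fraction_rel R S)"
  proof (rule transI, clarsimp simp: fraction_rel_eq)
    fix a s b t c u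
    assume *: "a \<in> carrier R" "s \<in> S" "b \<in> carrier R" "t \<in> S" "c \<in> carrier R" "u \<in> S"
      "a * t = b * s" "b * u = c * t"
    have "t * (a * u) = (a * t) * u" by (simp add: mult_ac)
    also have "\<dots> = (b * u) * s" unfolding *(7) by (simp add: mult_ac)
    also have "\<dots> = t * (c * s)" unfolding *(8) by (simp add: mult_ac)
    finally have "t * (a * u) = t * (c * s)" .
    then show "a * u = c * s" using *(1-6) R_closed(2) S_R by - (rule S_cancel[of t], auto)
  qed
qed (auto simp: fraction_rel_eq refl_on_def sym_def)

lemma frac_eq_iff:
  assumes "a \<in> carrier R" "s \<in> S" "b \<in> carrier R" "t \<in> S"
  shows "frac a s = frac b t \<longleftrightarrow> a * t = b * s"
  using eq_equiv_class_iff[OF equiv_fraction_rel, of "(a, s)" "(b, t)"] assms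
  by (simp add: fraction_def fraction_rel_eq)

lemma in_frac_iff:
  assumes "a \<in> carrier R" "s \<in> S"
  shows "(b, t) \<in> frac a s \<longleftrightarrow> b \<in> carrier R \<and> t \<in> S \<and> a * t = b * s"
  using assms by (simp add: fraction_def fraction_rel_eq)

lemma A_cases:
  assumes "x \<in> carrier A"
  obtains a s where "a \<in> carrier R" "s \<in> S" "x = frac a s"
  using assms unfolding local_mpoly_ring_def localization_def fraction_def
  by (auto elim!: quotientE)

lemma frac_closed: "a \<in> carrier R \<Longrightarrow> s \<in> S \<Longrightarrow> frac a s \<in> carrier A"
  unfolding local_mpoly_ring_def localization_def fraction_def by (auto intro: quotientI)

text \<open>The definition takes a union over all pairs of representatives. All pairs give the same
  class, hence the union is that class; \<open>frac_add\<close> follows the same pattern.\<close>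

lemma frac_mult:
  assumes "a \<in> carrier R" "s \<in> S" "b \<in> carrier R" "t \<in> S"
  shows "frac a s \<otimes>\<^bsub>A\<^esub> frac b t = frac (a * b) (s * t)"
proof -
  have "frac (a' * b') (s' * t') = frac (a * b) (s * t)"
    if "(a', s') \<in> frac a s" "(b', t') \<in> frac b t" for a' s' b' t'
  proof -
    have *: "a' \<in> carrier R" "s' \<in> S" "b' \<in> carrier R" "t' \<in> S" "a * s' = a' * s" "b * t' = b' * t"
      using that assms in_frac_iff by auto
    have "(a' * b') * (s * t) = (a' * s) * (b' * t)" by (simp add: mult_ac)
    also have "\<dots> = (a * b) * (s' * t')" unfolding *(5,6)[symmetric] by (simp add: mult_ac)
    finally have "(a' * b') * (s * t) = (a * b) * (s' * t')" .
    then show ?thesis using * assms R_closed(2) S_closed by (subst frac_eq_iff) auto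
  qed
  moreover have "(a, s) \<in> frac a s" "(b, t) \<in> frac b t" using assms in_frac_iff by auto
  moreover have "frac a s \<otimes>\<^bsub>A\<^esub> frac b t = (\<Union>(a', s')\<in>frac a s. \<Union>(b', t')\<in>frac b t. frac (a' * b') (s' * t'))"
    by (simp add: local_mpoly_ring_def localization_def)
  ultimately show ?thesis by fast
qed

lemma frac_add:
  assumes "a \<in> carrier R" "s \<in> S" "b \<in> carrier R" "t \<in> S"
  shows "frac a s \<oplus>\<^bsub>A\<^esub> frac b t = frac (a * t + b * s) (s * t)"
proof -
  have "frac (a' * t' + b' * s') (s' * t') = frac (a * t + b * s) (s * t)"
    if "(a', s') \<in> frac a s" "(b', t') \<in> frac b t" for a' s' b' t'
  proof -
    have *: "a' \<in> carrier R" "s' \<in> S" "b' \<in> carrier R" "t' \<in> S" "a * s' = a' * s" "b * t' = b' * t"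
      using that assms in_frac_iff by auto
    have "(a' * t' + b' * s') * (s * t) = (a' * s) * (t * t') + (b' * t) * (s * s')"
      by (simp add: algebra_simps)
    also have "\<dots> = (a * t + b * s) * (s' * t')"
      unfolding *(5,6)[symmetric] by (simp add: algebra_simps)
    finally show ?thesis using * assms R_closed(1,2) S_closed S_R by (subst frac_eq_iff) auto
  qed
  moreover have "(a, s) \<in> frac a s" "(b, t) \<in> frac b t" using assms in_frac_iff by auto
  moreover have "frac a s \<oplus>\<^bsub>A\<^esub> frac b t =
      (\<Union>(a', s')\<in>frac a s. \<Union>(b', t')\<in>frac b t. frac (a' * t' + b' * s') (s' * t'))"
    by (simp add: local_mpoly_ring_def localization_def)
  ultimately show ?thesis by fast
qed

lemma frac_add_same:
  assumes "a \<in> carrier R" "s \<in> S" "b \<in> carrier R"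
  shows "frac a s \<oplus>\<^bsub>A\<^esub> frac b s = frac (a + b) s"
  using assms R_closed S_closed S_R
  by (subst frac_add) (auto simp: frac_eq_iff algebra_simps)

lemma A_zero: "\<zero>\<^bsub>A\<^esub> = frac 0 1" and A_one: "\<one>\<^bsub>A\<^esub> = frac 1 1"
  by (simp_all add: local_mpoly_ring_def localization_def)

lemma zero_R: "0 \<in> carrier R" and one_R: "1 \<in> carrier R"
  by (simp_all add: carrier_R)

lemma frac_zero: "s \<in> S \<Longrightarrow> frac 0 s = \<zero>\<^bsub>A\<^esub>"
  using S_1 by (simp add: A_zero frac_eq_iff zero_R)

lemma frac_self: "s \<in> S \<Longrightarrow> frac s s = \<one>\<^bsub>A\<^esub>"
  using S_1 by (simp add: A_one frac_eq_iff one_R S_R)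

lemma cring_A: "cring A"
proof (rule cringI)
  show "abelian_group A"
  proof (rule abelian_groupI)
    fix x y z assume xyz: "x \<in> carrier A" "y \<in> carrier A" "z \<in> carrier A"
    then obtain a s b t c u where
      "a \<in> carrier R" "s \<in> S" "x = frac a s" "b \<in> carrier R" "t \<in> S" "y = frac b t"
      "c \<in> carrier R" "u \<in> S" "z = frac c u" by (metis A_cases)
    then show "x \<oplus>\<^bsub>A\<^esub> y \<oplus>\<^bsub>A\<^esub> z = x \<oplus>\<^bsub>A\<^esub> (y \<oplus>\<^bsub>A\<^esub> z)"
      using R_closed(1,2) S_R S_closed by (simp add: frac_add algebra_simps)
  next
    fix x y assume "x \<in> carrier A" "y \<in> carrier A"
    then obtain a s b t where
      *: "a \<in> carrier R" "s \<in> S" "x = frac a s" "b \<in> carrier R" "t \<in> S" "y = frac b t" by (metis A_cases)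
    then show "x \<oplus>\<^bsub>A\<^esub> y \<in> carrier A"
      using R_closed(1,2) S_R S_closed by (simp add: frac_add frac_closed)
    show "x \<oplus>\<^bsub>A\<^esub> y = y \<oplus>\<^bsub>A\<^esub> x" using * by (simp add: frac_add add.commute mult.commute)
  next
    show "\<zero>\<^bsub>A\<^esub> \<in> carrier A" using A_zero frac_closed zero_R S_1 by simp
  next
    fix x assume "x \<in> carrier A"
    then obtain a s where *: "a \<in> carrier R" "s \<in> S" "x = frac a s" by (metis A_cases)
    then show "\<zero>\<^bsub>A\<^esub> \<oplus>\<^bsub>A\<^esub> x = x" using zero_R S_1 by (simp add: A_zero frac_add)
    have "frac (- a) s \<oplus>\<^bsub>A\<^esub> x = \<zero>\<^bsub>A\<^esub>"
      using * R_closed(3)[of a] by (simp add: frac_add_same frac_zero)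
    then show "\<exists>y\<in>carrier A. y \<oplus>\<^bsub>A\<^esub> x = \<zero>\<^bsub>A\<^esub>" using * R_closed(3)[of a] frac_closed by blast
  qed
  show "comm_monoid A"
  proof (rule comm_monoidI)
    fix x y z assume xyz: "x \<in> carrier A" "y \<in> carrier A" "z \<in> carrier A"
    then obtain a s b t c u where
      "a \<in> carrier R" "s \<in> S" "x = frac a s" "b \<in> carrier R" "t \<in> S" "y = frac b t"
      "c \<in> carrier R" "u \<in> S" "z = frac c u" by (metis A_cases)
    then show "x \<otimes>\<^bsub>A\<^esub> y \<otimes>\<^bsub>A\<^esub> z = x \<otimes>\<^bsub>A\<^esub> (y \<otimes>\<^bsub>A\<^esub> z)"
      using R_closed(2) S_closed by (simp add: frac_mult mult.assoc)
  next
    fix x y assume "x \<in> carrier A" "y \<in> carrier A"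
    then obtain a s b t where
      *: "a \<in> carrier R" "s \<in> S" "x = frac a s" "b \<in> carrier R" "t \<in> S" "y = frac b t" by (metis A_cases)
    then show "x \<otimes>\<^bsub>A\<^esub> y \<in> carrier A"
      using R_closed(2) S_closed by (simp add: frac_mult frac_closed)
    show "x \<otimes>\<^bsub>A\<^esub> y = y \<otimes>\<^bsub>A\<^esub> x" using * by (simp add: frac_mult mult.commute)
  next
    show "\<one>\<^bsub>A\<^esub> \<in> carrier A" using A_one frac_closed one_R S_1 by simp
  next
    fix x assume "x \<in> carrier A"
    then obtain a s where *: "a \<in> carrier R" "s \<in> S" "x = frac a s" by (metis A_cases)
    then show "\<one>\<^bsub>A\<^esub> \<otimes>\<^bsub>A\<^esub> x = x" using one_R S_1 by (simp add: A_one frac_mult)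
  qed
  fix x y z assume xyz: "x \<in> carrier A" "y \<in> carrier A" "z \<in> carrier A"
  then obtain a s b t c u where
    *: "a \<in> carrier R" "s \<in> S" "x = frac a s" "b \<in> carrier R" "t \<in> S" "y = frac b t"
    "c \<in> carrier R" "u \<in> S" "z = frac c u" by (metis A_cases)
  then have "(x \<oplus>\<^bsub>A\<^esub> y) \<otimes>\<^bsub>A\<^esub> z = frac ((a * t + b * s) * c) (s * t * u)"
    "x \<otimes>\<^bsub>A\<^esub> z \<oplus>\<^bsub>A\<^esub> y \<otimes>\<^bsub>A\<^esub> z = frac ((a * c) * (t * u) + (b * c) * (s * u)) (s * u * (t * u))"
    using R_closed(1,2) S_R S_closed by (simp_all add: frac_add frac_mult)
  then show "(x \<oplus>\<^bsub>A\<^esub> y) \<otimes>\<^bsub>A\<^esub> z = x \<otimes>\<^bsub>A\<^esub> z \<oplus>\<^bsub>A\<^esub> y \<otimes>\<^bsub>A\<^esub> z"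
    using * R_closed(1,2) S_R S_closed by (simp add: frac_eq_iff algebra_simps)
qed

sublocale A: cring A by (rule cring_A)

lemma A_uminus:
  assumes "a \<in> carrier R" "s \<in> S"
  shows "\<ominus>\<^bsub>A\<^esub> frac a s = frac (- a) s"
  using assms R_closed(3)[of a] frac_closed
  by (intro A.minus_equality) (auto simp: frac_add_same frac_zero)

section \<open>Ideals of the local ring generated by monomials\<close>

definition monomial_ideal :: "('v \<Rightarrow>\<^sub>0 nat) set \<Rightarrow> (('v, 'k) mpoly \<times> ('v, 'k) mpoly) set set"
  where "monomial_ideal U = {frac a s | a s. a \<in> carrier R \<and> s \<in> S \<and> a \<in> supported U}"

text \<open>Cross multiplication relates the numerators of a class by factors with non-zero constant
  term, and \<open>supported_cancel\<close> removes these. Membership can thus be read off from any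
  representative.\<close>

lemma frac_in_monomial_ideal:
  assumes "upward V U" "a \<in> carrier R" "s \<in> S"
  shows "frac a s \<in> monomial_ideal U \<longleftrightarrow> a \<in> supported U"
proof
  assume "frac a s \<in> monomial_ideal U"
  then obtain b t where b: "frac a s = frac b t" "b \<in> carrier R" "t \<in> S" "b \<in> supported U"
    unfolding monomial_ideal_def by blast
  have "b * s \<in> supported U"
    using supported_mult_upward(1)[OF assms(1) b(4)] assms(3) by (simp add: S_iff carrier_R)
  moreover have "a * t = b * s" using assms b frac_eq_iff by blast
  ultimately have "t * a \<in> supported U" by (simp add: mult.commute[of t])
  then show "a \<in> supported U"
    using supported_cancel[OF assms(1) _ _ _ finV \<open>t * a \<in> supported U\<close>] assms(2) b(3)
    by (simp add: S_iff carrier_R)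
qed (use assms in \<open>auto simp: monomial_ideal_def\<close>)

lemma monomial_ideal_subset: "monomial_ideal U \<subseteq> carrier A"
  unfolding monomial_ideal_def using frac_closed by blast

lemma monomial_ideal_mono: "U \<subseteq> U' \<Longrightarrow> monomial_ideal U \<subseteq> monomial_ideal U'"
  unfolding monomial_ideal_def using supported_mono by blast

lemma monomial_ideal_psubset:
  assumes "upward V U" "upward V U'" "U \<subset> U'"
  shows "monomial_ideal U \<subset> monomial_ideal U'"
proof -
  obtain \<alpha> where \<alpha>: "\<alpha> \<in> U'" "\<alpha> \<notin> U" using assms(3) by blast
  then have "monomial \<alpha> \<in> carrier R" using assms(2) by (auto simp: carrier_R upward_def)
  then have "frac (monomial \<alpha>) 1 \<in> monomial_ideal U'" "frac (monomial \<alpha>) 1 \<notin> monomial_ideal U"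
    using \<alpha> S_1 assms(1,2) by (simp_all add: frac_in_monomial_ideal)
  then show ?thesis using monomial_ideal_mono[of U U'] assms(3) by blast
qed

lemma monomial_ideal_monomials: "monomial_ideal (monomials V) = carrier A"
proof
  show "carrier A \<subseteq> monomial_ideal (monomials V)"
  proof
    fix x assume "x \<in> carrier A"
    then obtain a s where "a \<in> carrier R" "s \<in> S" "x = frac a s" by (rule A_cases)
    then show "x \<in> monomial_ideal (monomials V)" by (auto simp: monomial_ideal_def carrier_R)
  qed
qed (rule monomial_ideal_subset)

lemma ideal_monomial_ideal:
  assumes "upward V U"
  shows "ideal (monomial_ideal U) A"
proof (rule idealI[OF A.ring_axioms])
  have mult: "x \<otimes>\<^bsub>A\<^esub> a \<in> monomial_ideal U" if aL: "a \<in> monomial_ideal U" and xA: "x \<in> carrier A" for a x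
  proof -
    obtain b t where b: "a = frac b t" "b \<in> carrier R" "t \<in> S" "b \<in> supported U"
      using aL unfolding monomial_ideal_def by blast
    obtain c u where c: "c \<in> carrier R" "u \<in> S" "x = frac c u" using xA A_cases by blast
    have "c * b \<in> supported U"
      using supported_mult_upward(2)[OF assms b(4)] c by (simp add: carrier_R)
    then show ?thesis using b c R_closed(2) S_closed assms by (simp add: frac_mult frac_in_monomial_ideal)
  qed
  then show "\<And>a x. a \<in> monomial_ideal U \<Longrightarrow> x \<in> carrier A \<Longrightarrow> x \<otimes>\<^bsub>A\<^esub> a \<in> monomial_ideal U" .
  show "a \<otimes>\<^bsub>A\<^esub> x \<in> monomial_ideal U" if "a \<in> monomial_ideal U" "x \<in> carrier A" for a x
    using mult[OF that] A.m_comm[of a x] that subsetD[OF monomial_ideal_subset] by metis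
  show "subgroup (monomial_ideal U) (add_monoid A)"
  proof (rule subgroup.intro)
    show "monomial_ideal U \<subseteq> carrier (add_monoid A)" using monomial_ideal_subset by simp
    show "\<one>\<^bsub>add_monoid A\<^esub> \<in> monomial_ideal U" using S_1 zero_R assms by (simp add: A_zero frac_in_monomial_ideal)
    fix x assume x: "x \<in> monomial_ideal U"
    then obtain b t where b: "x = frac b t" "b \<in> carrier R" "t \<in> S" "b \<in> supported U"
      unfolding monomial_ideal_def by blast
    then show "inv\<^bsub>add_monoid A\<^esub> x \<in> monomial_ideal U"
      using assms R_closed(3)[of b] A_uminus[of b t] by (simp add: a_inv_def frac_in_monomial_ideal supported_uminus)
    fix y assume "y \<in> monomial_ideal U"
    then obtain c u where c: "y = frac c u" "c \<in> carrier R" "u \<in> S" "c \<in> supported U"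
      unfolding monomial_ideal_def by blast
    have "b * u \<in> supported U" "c * t \<in> supported U"
      by (rule supported_mult_upward(1)[OF assms]; use b c in \<open>simp add: S_iff carrier_R\<close>)+
    then have "b * u + c * t \<in> supported U" by (rule supported_add)
    then show "x \<otimes>\<^bsub>add_monoid A\<^esub> y \<in> monomial_ideal U"
      using b c R_closed(1,2) S_closed S_R assms by (simp add: frac_add frac_in_monomial_ideal)
  qed
qed

lemma monomial_ideal_least:
  assumes "ideal J A" "upward V U" "\<And>\<alpha>. \<alpha> \<in> U \<Longrightarrow> frac (monomial \<alpha>) 1 \<in> J"
  shows "monomial_ideal U \<subseteq> J"
proof
  interpret J: ideal J A by fact
  fix x assume "x \<in> monomial_ideal U"
  then obtain a s where a: "x = frac a s" "a \<in> carrier R" "s \<in> S" "a \<in> supported U"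
    unfolding monomial_ideal_def by blast
  have "a \<in> carrier R \<and> frac a 1 \<in> J" using a(4)
  proof (induction rule: supported_induct)
    case zero
    show ?case using J.zero_closed by (simp add: A_zero zero_R)
  next
    case (add p q)
    then show ?case using J.a_closed[of "frac p 1" "frac q 1"] S_1 R_closed(1) by (simp add: frac_add_same)
  next
    case (single \<alpha> c)
    have \<alpha>: "\<alpha> \<in> monomials V" using single assms(2) by (auto simp: upward_def)
    have "frac (single 0 c) 1 \<otimes>\<^bsub>A\<^esub> frac (monomial \<alpha>) 1 \<in> J"
      using single assms(3) S_1 by (intro J.I_l_closed frac_closed) (auto simp: carrier_R)
    then show ?case using \<alpha> S_1 by (simp add: frac_mult carrier_R mult_single)
  qed
  moreover have "frac 1 s \<otimes>\<^bsub>A\<^esub> frac a 1 = x"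
    using a S_1 one_R by (simp add: frac_mult)
  ultimately show "x \<in> J"
    using J.I_l_closed[of "frac a 1" "frac 1 s"] frac_closed[OF one_R a(3)] by simp
qed

definition up_closure :: "('v \<Rightarrow>\<^sub>0 nat) set \<Rightarrow> ('v \<Rightarrow>\<^sub>0 nat) set"
  where "up_closure B = {\<beta> + \<gamma> | \<beta> \<gamma>. \<beta> \<in> B \<and> \<gamma> \<in> monomials V}"

lemma upward_up_closure:
  assumes "B \<subseteq> monomials V"
  shows "upward V (up_closure B)"
  using assms monomials_add unfolding upward_def up_closure_def
  by (auto simp: add.assoc) blast+

lemma genideal_monomials:
  assumes "B \<subseteq> monomials V"
  shows "Idl\<^bsub>A\<^esub> {frac (monomial \<beta>) 1 | \<beta>. \<beta> \<in> B} = monomial_ideal (up_closure B)"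
proof
  have sub: "{frac (monomial \<beta>) 1 | \<beta>. \<beta> \<in> B} \<subseteq> carrier A"
    using assms S_1 by (auto intro!: frac_closed simp: carrier_R)
  have "\<beta> \<in> up_closure B" if "\<beta> \<in> B" for \<beta>
    unfolding up_closure_def using that by (auto intro: exI[of _ \<beta>] exI[of _ 0])
  then show "Idl\<^bsub>A\<^esub> {frac (monomial \<beta>) 1 | \<beta>. \<beta> \<in> B} \<subseteq> monomial_ideal (up_closure B)"
    using assms S_1 frac_in_monomial_ideal[OF upward_up_closure[OF assms]]
    by (intro A.genideal_minimal ideal_monomial_ideal upward_up_closure) (fastforce simp: carrier_R)+
  show "monomial_ideal (up_closure B) \<subseteq> Idl\<^bsub>A\<^esub> {frac (monomial \<beta>) 1 | \<beta>. \<beta> \<in> B}"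
  proof (rule monomial_ideal_least[OF A.genideal_ideal[OF sub] upward_up_closure[OF assms]])
    fix \<alpha> assume "\<alpha> \<in> up_closure B"
    then obtain \<beta> \<gamma> where *: "\<alpha> = \<beta> + \<gamma>" "\<beta> \<in> B" "\<gamma> \<in> monomials V" unfolding up_closure_def by blast
    have "frac (monomial \<gamma>) 1 \<otimes>\<^bsub>A\<^esub> frac (monomial \<beta>) 1 \<in> Idl\<^bsub>A\<^esub> {frac (monomial \<beta>) 1 | \<beta>. \<beta> \<in> B}"
      using * S_1 A.genideal_self[OF sub]
      by (intro ideal.I_l_closed[OF A.genideal_ideal[OF sub]] frac_closed) (auto simp: carrier_R)
    then show "frac (monomial \<alpha>) 1 \<in> Idl\<^bsub>A\<^esub> {frac (monomial \<beta>) 1 | \<beta>. \<beta> \<in> B}"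
      using * S_1 assms by (auto simp: frac_mult carrier_R mult_single add.commute)
  qed
qed

definition add_sets :: "('v \<Rightarrow>\<^sub>0 nat) set \<Rightarrow> ('v \<Rightarrow>\<^sub>0 nat) set \<Rightarrow> ('v \<Rightarrow>\<^sub>0 nat) set"
  where "add_sets U U' = {\<alpha> + \<beta> | \<alpha> \<beta>. \<alpha> \<in> U \<and> \<beta> \<in> U'}"

lemma upward_add_sets:
  assumes "upward V U" "upward V U'"
  shows "upward V (add_sets U U')"
  using assms monomials_add unfolding upward_def add_sets_def
  by (auto simp: add.assoc) blast+

lemma prod_monomial_ideal:
  assumes "upward V U" "upward V U'"
  shows "ideal_prod A (monomial_ideal U) (monomial_ideal U') = monomial_ideal (add_sets U U')"
proof
  show "ideal_prod A (monomial_ideal U) (monomial_ideal U') \<subseteq> monomial_ideal (add_sets U U')"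
  proof
    fix x assume "x \<in> ideal_prod A (monomial_ideal U) (monomial_ideal U')"
    then show "x \<in> monomial_ideal (add_sets U U')"
    proof (induction rule: ideal_prod.induct)
      case (prod i j)
      then obtain a s b t where *: "i = frac a s" "a \<in> carrier R" "s \<in> S" "a \<in> supported U"
        "j = frac b t" "b \<in> carrier R" "t \<in> S" "b \<in> supported U'"
        unfolding monomial_ideal_def by blast
      have "a * b \<in> supported (add_sets U U')"
        by (rule supported_mult[OF *(4,8)]) (auto simp: add_sets_def)
      then show ?case
        using * R_closed(2) S_closed upward_add_sets[OF assms] by (simp add: frac_mult frac_in_monomial_ideal)
    next
      case (sum s1 s2)
      then show ?case
        using additive_subgroup.a_closed[OF ideal.axioms(1)[OF ideal_monomial_ideal[OF upward_add_sets[OF assms]]]] by blast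
    qed
  qed
  show "monomial_ideal (add_sets U U') \<subseteq> ideal_prod A (monomial_ideal U) (monomial_ideal U')"
  proof (rule monomial_ideal_least[OF A.ideal_prod_is_ideal[OF ideal_monomial_ideal ideal_monomial_ideal] upward_add_sets[OF assms]])
    fix \<alpha> assume "\<alpha> \<in> add_sets U U'"
    then obtain \<beta> \<gamma> where *: "\<alpha> = \<beta> + \<gamma>" "\<beta> \<in> U" "\<gamma> \<in> U'" unfolding add_sets_def by blast
    then have c: "monomial \<beta> \<in> carrier R" "monomial \<gamma> \<in> carrier R"
      using assms by (auto simp: carrier_R upward_def)
    have "frac (monomial \<beta>) 1 \<otimes>\<^bsub>A\<^esub> frac (monomial \<gamma>) 1 \<in> ideal_prod A (monomial_ideal U) (monomial_ideal U')"
      using * c S_1 assms by (intro ideal_prod.prod) (auto simp: frac_in_monomial_ideal)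
    then show "frac (monomial \<alpha>) 1 \<in> ideal_prod A (monomial_ideal U) (monomial_ideal U')"
      using * c S_1 by (simp add: frac_mult mult_single)
  qed (use assms in auto)
qed

text \<open>Exponents of the powers of a monomial ideal, not a set of subsets. The value at 0
  contains all monomials because the zeroth power of an ideal is the whole ring.\<close>

primrec power_set :: "('v \<Rightarrow>\<^sub>0 nat) set \<Rightarrow> nat \<Rightarrow> ('v \<Rightarrow>\<^sub>0 nat) set"
  where "power_set U 0 = monomials V"
  | "power_set U (Suc t) = add_sets (power_set U t) U"

lemma upward_power_set: "upward V U \<Longrightarrow> upward V (power_set U t)"
  by (induction t) (simp_all add: upward_monomials upward_add_sets)

lemma power_monomial_ideal:
  assumes "upward V U"
  shows "ideal_power A (monomial_ideal U) t = monomial_ideal (power_set U t)"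
proof (induction t)
  case 0
  then show ?case by (simp add: monomial_ideal_monomials) (simp add: nat_pow_def ideals_set_def)
next
  case (Suc t)
  have "ideal_power A (monomial_ideal U) (Suc t) = ideal_prod A (ideal_power A (monomial_ideal U) t) (monomial_ideal U)"
    by (simp add: nat_pow_def ideals_set_def)
  then show ?case using Suc prod_monomial_ideal[OF upward_power_set[OF assms] assms] by simp
qed

lemma frac_inverse:
  assumes "a \<in> carrier R" "s \<in> S" "a \<notin> supported (monomials V - {0})"
  shows "frac s a \<in> carrier A" "frac s a \<otimes>\<^bsub>A\<^esub> frac a s = \<one>\<^bsub>A\<^esub>"
proof -
  have a: "a \<in> S" using assms(1,3) by (auto simp: S_iff carrier_R supported_def in_keys_iff)
  then show "frac s a \<in> carrier A" using assms S_R frac_closed by blast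
  show "frac s a \<otimes>\<^bsub>A\<^esub> frac a s = \<one>\<^bsub>A\<^esub>"
    using a assms S_R S_closed frac_self[of "s * a"] by (simp add: frac_mult mult.commute)
qed

lemma upward_maximal: "upward V (monomials V - {0})"
  unfolding upward_def
proof (intro conjI ballI)
  fix \<alpha> \<beta> assume *: "\<alpha> \<in> monomials V - {0}" "\<beta> \<in> monomials V"
  then have "total_degree V (\<alpha> + \<beta>) \<noteq> 0"
    using total_degree_eq_0[OF finV, of \<alpha>] by (simp add: total_degree_add)
  then have "\<alpha> + \<beta> \<noteq> 0" by (auto simp: total_degree_def)
  then show "\<alpha> + \<beta> \<in> monomials V - {0}" using * monomials_add by blast
qed auto

text \<open>A numerator with non-zero constant term makes a fraction a unit, so none occurs in a
  proper ideal. This is why the ring is local.\<close>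

lemma proper_ideal_subset:
  assumes "ideal J A" "J \<noteq> carrier A"
  shows "J \<subseteq> monomial_ideal (monomials V - {0})"
proof
  interpret J: ideal J A by fact
  fix x assume x: "x \<in> J"
  then obtain a s where a: "a \<in> carrier R" "s \<in> S" "x = frac a s" using J.Icarr A_cases by blast
  show "x \<in> monomial_ideal (monomials V - {0})"
  proof (rule ccontr)
    assume "x \<notin> monomial_ideal (monomials V - {0})"
    then have "a \<notin> supported (monomials V - {0})" using a upward_maximal by (simp add: frac_in_monomial_ideal)
    then have "\<one>\<^bsub>A\<^esub> \<in> J" using frac_inverse[OF a(1,2)] J.I_l_closed[OF x] a(3) by metis
    then show False using J.one_imp_carrier assms(2) by blast
  qed
qed

lemma the_maximal_ideal_A: "the_maximal_ideal A = monomial_ideal (monomials V - {0})"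
  unfolding the_maximal_ideal_def
proof (rule the_equality)
  have ne: "carrier A \<noteq> monomial_ideal (monomials V - {0})"
  proof
    assume "carrier A = monomial_ideal (monomials V - {0})"
    then have "frac 1 1 \<in> monomial_ideal (monomials V - {0})" using A_one A.one_closed by simp
    then show False using upward_maximal one_R S_1 by (simp add: frac_in_monomial_ideal supported_def)
  qed
  show *: "maximalideal (monomial_ideal (monomials V - {0})) A"
    using ne proper_ideal_subset by (intro maximalidealI ideal_monomial_ideal upward_maximal) blast+
  fix M assume M: "maximalideal M A"
  then have "M \<subseteq> monomial_ideal (monomials V - {0})"
    using proper_ideal_subset maximalideal.axioms(1) maximalideal.I_notcarr by metis
  then show "M = monomial_ideal (monomials V - {0})"
    using maximalideal.I_maximal[OF M ideal_monomial_ideal[OF upward_maximal]] monomial_ideal_subset ne by blast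
qed

end

section \<open>Length of the local cohomology\<close>

text \<open>The local cohomology is the image of \<open>T\<close> modulo \<open>J0\<close>. Taking
  images and preimages under the quotient map preserves strict inclusions in both directions, so
  chains of submodules and chains of ideals between \<open>J0\<close> and \<open>T\<close> have the
  same lengths.\<close>

lemma (in cring) local_cohomology_chains:
  assumes J0: "ideal J0 R" and T: "ideal T R" and J0T: "J0 \<subseteq> T"
    and T_def: "T = {a \<in> J1. \<exists>k. \<forall>r\<in>ideal_power R M k. r \<otimes> a \<in> J0}"
    and pow: "\<And>k. ideal_power R M k \<subseteq> carrier R"
    and J1: "J1 \<subseteq> carrier R"
  shows "module_length R (local_cohomology0 R M (quotient_module (ideal_module R J1) J0)) =
    Sup {enat n | n. \<exists>N :: nat \<Rightarrow> 'a set.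
      (\<forall>i\<le>n. ideal (N i) R \<and> J0 \<subseteq> N i \<and> N i \<subseteq> T) \<and> (\<forall>i<n. N i \<subset> N (Suc i))}"
proof -
  interpret J0: ideal J0 R by fact
  interpret T: ideal T R by fact
  define H where "H = local_cohomology0 R M (quotient_module (ideal_module R J1) J0)"
  have coset: "J0 +>\<^bsub>ideal_module R J1\<^esub> a = J0 +> a" for a
    by (simp add: a_r_coset_def r_coset_def ideal_module_def)
  have set_add: "set_add (ideal_module R J1) X Y = X <+> Y" for X Y
    by (simp add: set_add_def set_mult_def ideal_module_def)
  have smult_coset: "(\<Union>x\<in>J0 +> a. J0 +> (r \<otimes> x)) = J0 +> (r \<otimes> a)"
    if "r \<in> carrier R" "a \<in> carrier R" for r a
  proof -
    have "J0 +> (r \<otimes> x) = J0 +> (r \<otimes> a)" if x: "x \<in> J0 +> a" for x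
    proof -
      obtain h where h: "h \<in> J0" "x = h \<oplus> a" using x by (auto simp: a_r_coset_def')
      then have "r \<otimes> x = (r \<otimes> h) \<oplus> (r \<otimes> a)"
        using that \<open>r \<in> carrier R\<close> \<open>a \<in> carrier R\<close> J0.Icarr by (simp add: r_distr)
      moreover have "r \<otimes> h \<in> J0" using J0.I_l_closed h \<open>r \<in> carrier R\<close> by blast
      ultimately have "r \<otimes> x \<in> J0 +> (r \<otimes> a)" by (auto simp: a_r_coset_def')
      then show ?thesis
        using J0.a_repr_independence' \<open>r \<in> carrier R\<close> \<open>a \<in> carrier R\<close> by (metis m_closed)
    qed
    moreover have "a \<in> J0 +> a" using J0.a_rcos_self that by blast
    ultimately show ?thesis by blast
  qed
  have coset_eq_J0: "J0 +> a = J0 \<longleftrightarrow> a \<in> J0" if "a \<in> carrier R" for a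
    using J0.a_rcos_self[OF that] J0.a_rcos_const by metis
  have H_add: "X \<oplus>\<^bsub>H\<^esub> Y = X <+> Y" and H_zero: "\<zero>\<^bsub>H\<^esub> = J0"
    and H_smult: "r \<odot>\<^bsub>H\<^esub> X = (\<Union>x\<in>X. J0 +> (r \<otimes> x))" for r X Y
    by (simp_all add: H_def local_cohomology0_def quotient_module_def coset set_add)
      (simp add: ideal_module_def)
  have H_carrier: "carrier H = (\<lambda>a. J0 +> a) ` T"
  proof -
    have 1: "carrier (quotient_module (ideal_module R J1) J0) = (\<lambda>a. J0 +> a) ` J1"
      by (auto simp: quotient_module_def A_RCOSETS_def' coset) (auto simp: ideal_module_def)
    have 2: "(\<exists>k. \<forall>r\<in>ideal_power R M k. (\<Union>x\<in>J0 +> a. J0 +> (r \<otimes> x)) = J0) \<longleftrightarrow>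
        (\<exists>k. \<forall>r\<in>ideal_power R M k. r \<otimes> a \<in> J0)" if "a \<in> J1" for a
    proof -
      have eq: "(\<Union>x\<in>J0 +> a. J0 +> (r \<otimes> x)) = J0 \<longleftrightarrow> r \<otimes> a \<in> J0" if "r \<in> ideal_power R M k" for r k
      proof -
        have "r \<in> carrier R" "a \<in> carrier R" using that pow J1 \<open>a \<in> J1\<close> by blast+
        then show ?thesis by (simp add: smult_coset coset_eq_J0)
      qed
      show ?thesis by (intro ex_cong1 ball_cong refl eq)
    qed
    have 3: "carrier H = {u \<in> carrier (quotient_module (ideal_module R J1) J0).
        \<exists>k. \<forall>r\<in>ideal_power R M k. (\<Union>x\<in>u. J0 +> (r \<otimes> x)) = J0}"
      by (simp add: H_def local_cohomology0_def quotient_module_def coset) (simp add: ideal_module_def)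
    have "{u \<in> f ` B. Q u} = f ` {a \<in> B. Q (f a)}" for f :: "'a \<Rightarrow> 'a set" and B Q by blast
    note this[of "\<lambda>a. J0 +> a" J1 "\<lambda>u. \<exists>k. \<forall>r\<in>ideal_power R M k. (\<Union>x\<in>u. J0 +> (r \<otimes> x)) = J0"]
    moreover have "{a \<in> J1. \<exists>k. \<forall>r\<in>ideal_power R M k. (\<Union>x\<in>J0 +> a. J0 +> (r \<otimes> x)) = J0} = T"
      unfolding T_def by (intro Collect_cong conj_cong refl 2)
    ultimately show ?thesis unfolding 3 1 by simp
  qed
  have H_smult': "r \<odot>\<^bsub>H\<^esub> (J0 +> a) = J0 +> (r \<otimes> a)" if "r \<in> carrier R" "a \<in> T" for r a
    unfolding H_smult using smult_coset that T.Icarr by blast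
  have H_add': "(J0 +> a) \<oplus>\<^bsub>H\<^esub> (J0 +> b) = J0 +> (a \<oplus> b)" if "a \<in> T" "b \<in> T" for a b
    unfolding H_add using J0.a_rcos_sum that T.Icarr by blast
  have coset_D: "\<exists>h\<in>J0. a = h \<oplus> b" if "J0 +> a = J0 +> b" "a \<in> T" for a b
    using that J0.a_rcos_self[of a] T.Icarr by (auto simp: a_r_coset_def')
  define to_ideal where "to_ideal = (\<lambda>N. {a \<in> T. J0 +> a \<in> N})"
  have to_ideal: "ideal (to_ideal N) R" "J0 \<subseteq> to_ideal N" "to_ideal N \<subseteq> T" "N = (\<lambda>a. J0 +> a) ` to_ideal N"
    if "submodule N R H" for N
  proof -
    interpret N: submodule N R H by fact
    have N_zero: "J0 \<in> N" using N.one_closed by (simp add: H_zero)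
    have N_add: "X \<oplus>\<^bsub>H\<^esub> Y \<in> N" if "X \<in> N" "Y \<in> N" for X Y using N.m_closed[OF that] by simp
    show "J0 \<subseteq> to_ideal N"
    proof
      fix a assume a: "a \<in> J0"
      then have "J0 +> a = J0" using coset_eq_J0 J0.Icarr by blast
      then show "a \<in> to_ideal N" using a J0T N_zero by (auto simp: to_ideal_def)
    qed
    show "to_ideal N \<subseteq> T" by (auto simp: to_ideal_def)
    show "N = (\<lambda>a. J0 +> a) ` to_ideal N"
      using N.subset by (auto simp: H_carrier to_ideal_def)
    have mult: "x \<otimes> a \<in> to_ideal N" if "a \<in> to_ideal N" "x \<in> carrier R" for a x
      using that N.smult_closed[of x "J0 +> a"] H_smult' T.I_l_closed by (simp add: to_ideal_def)
    show "ideal (to_ideal N) R"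
    proof (rule idealI[OF ring_axioms])
      show "subgroup (to_ideal N) (add_monoid R)"
      proof (rule subgroup.intro)
        show "to_ideal N \<subseteq> carrier (add_monoid R)" using T.Icarr by (auto simp: to_ideal_def)
        show "\<one>\<^bsub>add_monoid R\<^esub> \<in> to_ideal N"
          using \<open>J0 \<subseteq> to_ideal N\<close> J0.zero_closed by auto
        fix a assume a: "a \<in> to_ideal N"
        then have "\<ominus> \<one> \<otimes> a = \<ominus> a" using T.Icarr by (simp add: to_ideal_def l_minus)
        then show "inv\<^bsub>add_monoid R\<^esub> a \<in> to_ideal N"
          using mult[OF a, of "\<ominus> \<one>"] by (simp add: a_inv_def)
        fix b assume "b \<in> to_ideal N"
        then show "a \<otimes>\<^bsub>add_monoid R\<^esub> b \<in> to_ideal N"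
          using a N_add[of "J0 +> a" "J0 +> b"] H_add' T.a_closed by (simp add: to_ideal_def)
      qed
      show "x \<otimes> a \<in> to_ideal N" if "a \<in> to_ideal N" "x \<in> carrier R" for a x using mult that .
      then show "a \<otimes> x \<in> to_ideal N" if "a \<in> to_ideal N" "x \<in> carrier R" for a x
        using mult[OF that] m_comm[of a x] that T.Icarr by (simp add: to_ideal_def)
    qed
  qed
  have from_ideal: "submodule ((\<lambda>a. J0 +> a) ` J) R H"
    if J: "ideal J R" "J0 \<subseteq> J" "J \<subseteq> T" for J
  proof -
    interpret J: ideal J R by fact
    show ?thesis
    proof (intro submodule.intro subgroup.intro submodule_axioms.intro)
      show "(\<lambda>a. J0 +> a) ` J \<subseteq> carrier (add_monoid H)" using J(3) by (auto simp: H_carrier)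
      show "X \<otimes>\<^bsub>add_monoid H\<^esub> Y \<in> (\<lambda>a. J0 +> a) ` J"
        if "X \<in> (\<lambda>a. J0 +> a) ` J" "Y \<in> (\<lambda>a. J0 +> a) ` J" for X Y
        using that H_add' J(3) J.a_closed by auto
      show "\<one>\<^bsub>add_monoid H\<^esub> \<in> (\<lambda>a. J0 +> a) ` J"
        using coset_eq_J0[of \<zero>] J0.zero_closed J.zero_closed by (force simp: H_zero)
      show "r \<odot>\<^bsub>H\<^esub> X \<in> (\<lambda>a. J0 +> a) ` J" if "r \<in> carrier R" "X \<in> (\<lambda>a. J0 +> a) ` J" for r X
        using that H_smult' J(3) J.I_l_closed by auto
      show "inv\<^bsub>add_monoid H\<^esub> X \<in> (\<lambda>a. J0 +> a) ` J" if X: "X \<in> (\<lambda>a. J0 +> a) ` J" for X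
      proof -
        obtain a where a: "a \<in> J" "X = J0 +> a" using X by blast
        have aT: "a \<in> T" "\<ominus> a \<in> T" using a J(3) T.a_inv_closed by auto
        \<comment> \<open>Inverses are definite descriptions over the carrier of \<open>H\<close>,
          so besides these two equations the uniqueness of the inverse class has to be
          verified.\<close>
        have sum: "(J0 +> a) \<oplus>\<^bsub>H\<^esub> (J0 +> \<ominus> a) = J0" "(J0 +> \<ominus> a) \<oplus>\<^bsub>H\<^esub> (J0 +> a) = J0"
          using aT T.Icarr J0.zero_closed by (auto simp: H_add' r_neg l_neg coset_eq_J0)
        have "inv\<^bsub>add_monoid H\<^esub> X = J0 +> \<ominus> a"
          unfolding m_inv_def
        proof (rule the_equality)
          show "J0 +> \<ominus> a \<in> carrier (add_monoid H) \<and>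
              X \<otimes>\<^bsub>add_monoid H\<^esub> (J0 +> \<ominus> a) = \<one>\<^bsub>add_monoid H\<^esub> \<and>
              (J0 +> \<ominus> a) \<otimes>\<^bsub>add_monoid H\<^esub> X = \<one>\<^bsub>add_monoid H\<^esub>"
            using sum aT by (simp add: a(2) H_zero H_carrier)
          fix Y assume Y: "Y \<in> carrier (add_monoid H) \<and> X \<otimes>\<^bsub>add_monoid H\<^esub> Y = \<one>\<^bsub>add_monoid H\<^esub> \<and>
              Y \<otimes>\<^bsub>add_monoid H\<^esub> X = \<one>\<^bsub>add_monoid H\<^esub>"
          then obtain b where b: "b \<in> T" "Y = J0 +> b" by (auto simp: H_carrier)
          then have "J0 +> (b \<oplus> a) = J0" using Y aT by (simp add: a(2) H_zero H_add')
          then have "b \<oplus> a \<in> J0" using coset_eq_J0 b aT T.Icarr by simp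
          moreover have "b = (b \<oplus> a) \<oplus> \<ominus> a"
            using b aT T.Icarr by (simp add: a_assoc r_neg)
          ultimately have "b \<in> J0 +> \<ominus> a" by (auto simp: a_r_coset_def')
          then show "Y = J0 +> \<ominus> a"
            using b J0.a_repr_independence' aT T.Icarr by metis
        qed
        then show ?thesis using a J.a_inv_closed by blast
      qed
    qed
  qed
  have from_mono: "(\<lambda>a. J0 +> a) ` J \<subset> (\<lambda>a. J0 +> a) ` J'"
    if J: "ideal J R" "J0 \<subseteq> J" "J \<subset> J'" "J' \<subseteq> T" for J J'
  proof -
    obtain a where a: "a \<in> J'" "a \<notin> J" using J(3) by blast
    have "J0 +> a \<notin> (\<lambda>a. J0 +> a) ` J"
    proof
      assume "J0 +> a \<in> (\<lambda>a. J0 +> a) ` J"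
      then obtain b where b: "b \<in> J" "J0 +> a = J0 +> b" by blast
      then obtain h where "h \<in> J0" "a = h \<oplus> b" using coset_D J(4) a by blast
      then have "a \<in> J"
        using J(1,2) b additive_subgroup.a_closed[OF ideal.axioms(1)[OF J(1)]] by blast
      then show False using a by blast
    qed
    then show ?thesis using a J(3) by blast
  qed
  have to_mono: "to_ideal N \<subset> to_ideal N'" if "submodule N R H" "submodule N' R H" "N \<subset> N'" for N N'
  proof -
    have "to_ideal N \<subseteq> to_ideal N'" using that(3) by (auto simp: to_ideal_def)
    moreover have "to_ideal N \<noteq> to_ideal N'" using to_ideal(4)[OF that(1)] to_ideal(4)[OF that(2)] that(3) by auto
    ultimately show ?thesis by blast
  qed
  have "(\<exists>N :: nat \<Rightarrow> 'a set set. (\<forall>i\<le>n. submodule (N i) R H) \<and> (\<forall>i<n. N i \<subset> N (Suc i))) \<longleftrightarrow>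
    (\<exists>N :: nat \<Rightarrow> 'a set. (\<forall>i\<le>n. ideal (N i) R \<and> J0 \<subseteq> N i \<and> N i \<subseteq> T) \<and> (\<forall>i<n. N i \<subset> N (Suc i)))"
    (is "?A \<longleftrightarrow> ?B") for n
  proof
    assume ?A
    then obtain N where N: "\<And>i. i \<le> n \<Longrightarrow> submodule (N i) R H" "\<And>i. i < n \<Longrightarrow> N i \<subset> N (Suc i)" by blast
    show ?B
    proof (intro exI[of _ "\<lambda>i. to_ideal (N i)"] conjI allI impI)
      show "to_ideal (N i) \<subset> to_ideal (N (Suc i))" if "i < n" for i
        using that by (intro to_mono N) auto
    qed (use N(1) to_ideal in blast)+
  next
    assume ?B
    then obtain N where N: "\<And>i. i \<le> n \<Longrightarrow> ideal (N i) R \<and> J0 \<subseteq> N i \<and> N i \<subseteq> T"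
      "\<And>i. i < n \<Longrightarrow> N i \<subset> N (Suc i)" by blast
    show ?A
    proof (intro exI[of _ "\<lambda>i. (\<lambda>a. J0 +> a) ` N i"] conjI allI impI)
      show "(\<lambda>a. J0 +> a) ` N i \<subset> (\<lambda>a. J0 +> a) ` N (Suc i)" if "i < n" for i
        using that N(1)[of i] N(1)[of "Suc i"] N(2)[OF that] by (intro from_mono) auto
      show "submodule ((\<lambda>a. J0 +> a) ` N i) R H" if "i \<le> n" for i
        using N(1)[OF that] by (intro from_ideal) auto
    qed
  qed
  then show ?thesis unfolding module_length_def H_def by simp
qed

section \<open>Chains of ideals between two monomial ideals\<close>

context local_polynomials
begin

text \<open>Take \<open>u\<close> of least degree in \<open>W - U\<close>. A proper divisor of
  \<open>u\<close> in \<open>W\<close> cannot lie in \<open>U\<close>, as \<open>u\<close> does not,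
  and it would have smaller degree than \<open>u\<close>.\<close>

lemma remove_minimal:
  assumes "upward V U" "upward V W" "U \<subset> W"
  obtains u where "u \<in> W - U" "upward V (W - {u})"
proof -
  have "\<exists>u. u \<in> W - U" using assms(3) by blast
  then obtain u where u: "u \<in> W - U" "\<And>w. w \<in> W - U \<Longrightarrow> total_degree V u \<le> total_degree V w"
    using ex_has_least_nat[of "\<lambda>u. u \<in> W - U" _ "total_degree V"] by blast
  have "\<alpha> + \<beta> \<noteq> u" if "\<alpha> \<in> W - {u}" "\<beta> \<in> monomials V" for \<alpha> \<beta>
  proof
    assume eq: "\<alpha> + \<beta> = u"
    then have "\<alpha> \<notin> U" using upward_addI[OF assms(1) _ that(2)] u(1) by blast
    then have "total_degree V u \<le> total_degree V \<alpha>" using u(2) that by blast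
    then have "total_degree V \<beta> = 0" using eq total_degree_add by (metis add_le_same_cancel1 le_zero_eq)
    then have "\<beta> = 0" using total_degree_eq_0[OF finV that(2)] by blast
    then show False using that eq by simp
  qed
  then have "upward V (W - {u})" using assms(2) unfolding upward_def by blast
  then show thesis using u(1) that by blast
qed

text \<open>Hence a single monomial contributes a simple quotient.\<close>

lemma eliminate_monomial:
  assumes "upward V W" "upward V (W - {u})" "x \<in> monomial_ideal W" "y \<in> monomial_ideal W" "y \<notin> monomial_ideal (W - {u})"
  obtains r where "r \<in> carrier A" "x \<oplus>\<^bsub>A\<^esub> (r \<otimes>\<^bsub>A\<^esub> y) \<in> monomial_ideal (W - {u})"
proof -
  obtain a s where a: "x = frac a s" "a \<in> carrier R" "s \<in> S" "a \<in> supported W"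
    using assms(3) unfolding monomial_ideal_def by blast
  obtain b t where b: "y = frac b t" "b \<in> carrier R" "t \<in> S" "b \<in> supported W"
    using assms(4) unfolding monomial_ideal_def by blast
  have "b \<notin> supported (W - {u})" using assms(2,5) b by (simp add: frac_in_monomial_ideal)
  then have bu: "lookup b u \<noteq> 0" using b(4) by (auto simp: supported_def in_keys_iff)
  define c :: "('v, 'k) mpoly"
    where "c = single 0 (- lookup a u / lookup b u)"
  have c: "c \<in> carrier R" by (simp add: c_def carrier_R)
  have cb: "lookup (c * b) u = - lookup a u"
  proof -
    have "lookup (c * b) (0 + u) = lookup c 0 * lookup b u"
      by (rule lookup_mult_unique) (auto simp: c_def split: if_splits)
    then show ?thesis using bu by (simp add: c_def)
  qed
  have "c * b \<in> supported W"
    using supported_mult_upward(2)[OF assms(1) b(4)] c by (simp add: carrier_R)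
  then have "a + c * b \<in> supported W" using a(4) by (intro supported_add)
  moreover have "lookup (a + c * b) u = 0" using cb by (simp add: lookup_add)
  ultimately have acb: "a + c * b \<in> supported (W - {u})" by (auto simp: supported_def in_keys_iff)
  have ct: "c * t \<in> carrier R" using c b S_R R_closed(2) by blast
  have "frac (c * t) s \<otimes>\<^bsub>A\<^esub> y = frac (c * b) s"
    using a b c ct R_closed(2) S_closed S_R by (simp add: frac_mult frac_eq_iff mult_ac)
  then have "x \<oplus>\<^bsub>A\<^esub> (frac (c * t) s \<otimes>\<^bsub>A\<^esub> y) = frac (a + c * b) s"
    using a b c R_closed(2) by (simp add: frac_add_same)
  moreover have "frac (a + c * b) s \<in> monomial_ideal (W - {u})"
    using acb a b c R_closed(1,2) assms(2) by (simp add: frac_in_monomial_ideal)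
  ultimately show thesis using that[of "frac (c * t) s"] frac_closed[OF ct a(3)] by simp
qed

text \<open>A strictly monotone rank with values up to \<open>card (W - U)\<close> bounds all chains
  at once, whether or not their members are monomial. Removing one minimal monomial from
  \<open>W\<close>, the rank of \<open>N\<close> is that of its intersection with the smaller ideal,
  plus 1 if \<open>N\<close> is not contained in that ideal.\<close>

lemma ideal_chain_rank:
  assumes "upward V U" "upward V W" "U \<subseteq> W" "finite (W - U)"
  shows "\<exists>\<nu>. (\<forall>N. ideal N A \<and> monomial_ideal U \<subseteq> N \<and> N \<subseteq> monomial_ideal W \<longrightarrow> \<nu> N \<le> card (W - U)) \<and>
    (\<forall>N N'. ideal N A \<and> monomial_ideal U \<subseteq> N \<and> ideal N' A \<and> N' \<subseteq> monomial_ideal W \<and> N \<subset> N' \<longrightarrow> \<nu> N < (\<nu> N' :: nat))"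
  using assms
proof (induction "card (W - U)" arbitrary: W)
  case 0
  then have "W = U" by auto
  then show ?case by (intro exI[of _ "\<lambda>_. 0"]) auto
next
  case (Suc n)
  then have "U \<subset> W" by (metis Diff_cancel card.empty nat.distinct(1) psubsetI)
  then obtain u where u: "u \<in> W - U" "upward V (W - {u})"
    using remove_minimal Suc.prems by blast
  define W' where "W' = W - {u}"
  have W': "upward V W'" "U \<subseteq> W'" "W' \<subseteq> W" "W' - U = (W - U) - {u}"
    using u Suc.prems by (auto simp: W'_def)
  then have card: "card (W' - U) = n" "finite (W' - U)" using Suc.hyps(2) u Suc.prems(4) by simp_all
  then obtain \<nu> where \<nu>: "\<And>N. ideal N A \<Longrightarrow> monomial_ideal U \<subseteq> N \<Longrightarrow> N \<subseteq> monomial_ideal W' \<Longrightarrow> \<nu> N \<le> n"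
    "\<And>N N'. ideal N A \<Longrightarrow> monomial_ideal U \<subseteq> N \<Longrightarrow> ideal N' A \<Longrightarrow> N' \<subseteq> monomial_ideal W' \<Longrightarrow> N \<subset> N' \<Longrightarrow> \<nu> N < (\<nu> N' :: nat)"
    using Suc.hyps(1)[of W'] W' Suc.prems(1) by metis
  define \<rho> where "\<rho> = (\<lambda>N. \<nu> (N \<inter> monomial_ideal W') + (if N \<subseteq> monomial_ideal W' then 0 else 1))"
  have int: "ideal (N \<inter> monomial_ideal W') A" if "ideal N A" for N
    using A.i_intersect that ideal_monomial_ideal W' by blast
  have LU: "monomial_ideal U \<subseteq> monomial_ideal W'" using W' monomial_ideal_mono by blast
  have "\<rho> N \<le> card (W - U)" if "ideal N A" "monomial_ideal U \<subseteq> N" "N \<subseteq> monomial_ideal W" for N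
    using \<nu>(1)[OF int[OF that(1)]] that LU Suc.hyps(2) by (auto simp: \<rho>_def)
  moreover have "\<rho> N < \<rho> N'" if N: "ideal N A" "monomial_ideal U \<subseteq> N" "ideal N' A" "N' \<subseteq> monomial_ideal W" "N \<subset> N'" for N N'
  proof (cases "N \<inter> monomial_ideal W' = N' \<inter> monomial_ideal W'")
    case False
    then have "\<nu> (N \<inter> monomial_ideal W') < \<nu> (N' \<inter> monomial_ideal W')" using N LU int by (intro \<nu>(2)) auto
    then show ?thesis using N(5) by (auto simp: \<rho>_def)
  next
    case True
    \<comment> \<open>If \<open>N\<close> contained some \<open>y\<close> outside, multiples of
      \<open>y\<close> would move every element of \<open>N'\<close> into the common intersection,
      hence into \<open>N\<close>, against strictness. So only \<open>N'\<close> receives the extra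
      1.\<close>
    have "N \<subseteq> monomial_ideal W'"
    proof (rule ccontr)
      assume "\<not> N \<subseteq> monomial_ideal W'"
      then obtain y where y: "y \<in> N" "y \<notin> monomial_ideal W'" by blast
      have "N' \<subseteq> N"
      proof
        fix x assume x: "x \<in> N'"
        interpret N: ideal N A by fact
        interpret N': ideal N' A by fact
        have xy: "x \<in> monomial_ideal W" "y \<in> monomial_ideal W" using x y N by auto
        then obtain r where r: "r \<in> carrier A" "x \<oplus>\<^bsub>A\<^esub> (r \<otimes>\<^bsub>A\<^esub> y) \<in> monomial_ideal W'"
          using eliminate_monomial[OF Suc.prems(2) u(2) xy] y(2) unfolding W'_def by blast
        have ry: "r \<otimes>\<^bsub>A\<^esub> y \<in> N" using N.I_l_closed y(1) r(1) .
        then have "x \<oplus>\<^bsub>A\<^esub> (r \<otimes>\<^bsub>A\<^esub> y) \<in> N' \<inter> monomial_ideal W'" using x N(5) r(2) N'.a_closed by blast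
        then have "x \<oplus>\<^bsub>A\<^esub> (r \<otimes>\<^bsub>A\<^esub> y) \<in> N" using True by blast
        then have "(x \<oplus>\<^bsub>A\<^esub> (r \<otimes>\<^bsub>A\<^esub> y)) \<oplus>\<^bsub>A\<^esub> (\<ominus>\<^bsub>A\<^esub> (r \<otimes>\<^bsub>A\<^esub> y)) \<in> N"
          using ry N.a_closed N.a_inv_closed by blast
        then show "x \<in> N" using N'.Icarr[OF x] N.Icarr[OF ry] by (simp add: A.a_assoc A.r_neg)
      qed
      then show False using N(5) by blast
    qed
    moreover have "\<not> N' \<subseteq> monomial_ideal W'" using True N(5) calculation by blast
    ultimately show ?thesis using True by (simp add: \<rho>_def)
  qed
  ultimately show ?case by blast
qed

lemma ideal_chain_exists:
  assumes "upward V U" "upward V W" "U \<subseteq> W" "finite (W - U)"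
  shows "\<exists>N :: nat \<Rightarrow> _. (\<forall>i\<le>card (W - U). ideal (N i) A \<and> monomial_ideal U \<subseteq> N i \<and> N i \<subseteq> monomial_ideal W) \<and>
    (\<forall>i<card (W - U). N i \<subset> N (Suc i))"
  using assms
proof (induction "card (W - U)" arbitrary: W)
  case 0
  then have "W = U" by auto
  then show ?case using ideal_monomial_ideal[OF assms(1)] by (intro exI[of _ "\<lambda>_. monomial_ideal U"]) auto
next
  case (Suc n)
  then have "U \<subset> W" by (metis Diff_cancel card.empty nat.distinct(1) psubsetI)
  then obtain u where u: "u \<in> W - U" "upward V (W - {u})"
    using remove_minimal Suc.prems by blast
  define W' where "W' = W - {u}"
  have W': "upward V W'" "U \<subseteq> W'" "W' \<subset> W" "W' - U = (W - U) - {u}"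
    using u Suc.prems by (auto simp: W'_def)
  then have card: "card (W' - U) = n" "finite (W' - U)" using Suc.hyps(2) u Suc.prems(4) by simp_all
  then obtain N where N: "\<And>i. i \<le> n \<Longrightarrow> ideal (N i) A \<and> monomial_ideal U \<subseteq> N i \<and> N i \<subseteq> monomial_ideal W'"
    "\<And>i. i < n \<Longrightarrow> N i \<subset> N (Suc i)"
    using Suc.hyps(1)[of W'] W' Suc.prems(1) by metis
  have strict: "monomial_ideal W' \<subset> monomial_ideal W" by (rule monomial_ideal_psubset[OF W'(1) Suc.prems(2) W'(3)])
  define N' where "N' = N(Suc n := monomial_ideal W)"
  have "ideal (N' i) A \<and> monomial_ideal U \<subseteq> N' i \<and> N' i \<subseteq> monomial_ideal W" if "i \<le> Suc n" for i
    using N(1)[of i] strict ideal_monomial_ideal[OF Suc.prems(2)] monomial_ideal_mono[OF Suc.prems(3)] that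
    by (cases "i = Suc n") (auto simp: N'_def)
  moreover have "N' i \<subset> N' (Suc i)" if "i < Suc n" for i
    using N(1)[of n] N(2)[of i] strict that by (cases "i = n") (auto simp: N'_def)
  ultimately show ?case unfolding Suc.hyps(2)[symmetric] by blast
qed

lemma Sup_ideal_chains:
  assumes "upward V U" "upward V W" "U \<subseteq> W" "finite (W - U)"
  shows "Sup {enat n | n. \<exists>N :: nat \<Rightarrow> _. (\<forall>i\<le>n. ideal (N i) A \<and> monomial_ideal U \<subseteq> N i \<and> N i \<subseteq> monomial_ideal W) \<and>
    (\<forall>i<n. N i \<subset> N (Suc i))} = enat (card (W - U))"
proof (rule antisym)
  obtain \<nu> where \<nu>: "\<And>N. ideal N A \<Longrightarrow> monomial_ideal U \<subseteq> N \<Longrightarrow> N \<subseteq> monomial_ideal W \<Longrightarrow> \<nu> N \<le> card (W - U)"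
    "\<And>N N'. ideal N A \<Longrightarrow> monomial_ideal U \<subseteq> N \<Longrightarrow> ideal N' A \<Longrightarrow> N' \<subseteq> monomial_ideal W \<Longrightarrow> N \<subset> N' \<Longrightarrow> \<nu> N < (\<nu> N' :: nat)"
    using ideal_chain_rank[OF assms] by metis
  have "n \<le> card (W - U)" if N: "\<forall>i\<le>n. ideal (N i) A \<and> monomial_ideal U \<subseteq> N i \<and> N i \<subseteq> monomial_ideal W"
    "\<forall>i<n. N i \<subset> N (Suc i)" for n and N :: "nat \<Rightarrow> _"
  proof -
    have "i \<le> \<nu> (N i)" if "i \<le> n" for i
      using that
    proof (induction i)
      case (Suc i)
      then have "\<nu> (N i) < \<nu> (N (Suc i))" using N by (intro \<nu>(2)) auto
      then show ?case using Suc by simp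
    qed simp
    then show ?thesis using \<nu>(1)[of "N n"] N(1) le_trans by blast
  qed
  then show "Sup {enat n | n. \<exists>N :: nat \<Rightarrow> _. (\<forall>i\<le>n. ideal (N i) A \<and> monomial_ideal U \<subseteq> N i \<and> N i \<subseteq> monomial_ideal W) \<and>
    (\<forall>i<n. N i \<subset> N (Suc i))} \<le> enat (card (W - U))"
    by (intro Sup_least) auto
  show "enat (card (W - U)) \<le> Sup {enat n | n. \<exists>N :: nat \<Rightarrow> _. (\<forall>i\<le>n. ideal (N i) A \<and> monomial_ideal U \<subseteq> N i \<and> N i \<subseteq> monomial_ideal W) \<and>
    (\<forall>i<n. N i \<subset> N (Suc i))}"
    using ideal_chain_exists[OF assms] by (intro Sup_upper) auto
qed

end

section \<open>Krull dimension\<close>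

text \<open>Exponents read as digits in base \<open>B\<close>: an additive function of the exponent
  vector that separates vectors with entries below \<open>B\<close>.\<close>

primrec weighted :: "nat \<Rightarrow> 'v list \<Rightarrow> ('v \<Rightarrow> nat) \<Rightarrow> nat"
  where "weighted B [] f = 0"
  | "weighted B (v # vs) f = f v + B * weighted B vs f"

lemma weighted_add: "weighted B vs (\<lambda>v. f v + g v) = weighted B vs f + weighted B vs g"
  by (induction vs) (simp_all add: algebra_simps)

lemma weighted_inj:
  assumes "weighted B vs f = weighted B vs g" "\<And>v. v \<in> set vs \<Longrightarrow> f v < B \<and> g v < B"
  shows "\<forall>v\<in>set vs. f v = g v"
  using assms
proof (induction vs)
  case (Cons v vs)
  have "(f v + B * weighted B vs f) mod B = (g v + B * weighted B vs g) mod B"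
    using Cons.prems(1) by simp
  then have fg: "f v = g v" using Cons.prems(2)[of v] by simp
  moreover have "0 < B" using Cons.prems(2)[of v] by simp
  ultimately have "weighted B vs f = weighted B vs g" using Cons.prems(1) by simp
  then show ?case using Cons fg by simp
qed simp

text \<open>Exponents of the ideal generated by the variables in \<open>W\<close>, which
  \<open>meets_prime\<close> shows to be prime.\<close>

definition meets :: "'v set \<Rightarrow> 'v set \<Rightarrow> ('v \<Rightarrow>\<^sub>0 nat) set"
  where "meets V W = {\<alpha> \<in> monomials V. \<exists>v\<in>W. lookup \<alpha> v \<noteq> 0}"

lemma upward_meets: "upward V (meets V W)"
  by (auto simp: upward_def meets_def monomials_add lookup_add)

lemma monomials_eqI:
  assumes "\<alpha> \<in> monomials V" "\<beta> \<in> monomials V"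
    "\<And>v. v \<in> V \<Longrightarrow> lookup \<alpha> v = lookup \<beta> v"
  shows "\<alpha> = \<beta>"
proof (rule poly_mapping_eqI)
  fix v show "lookup \<alpha> v = lookup \<beta> v"
  proof (cases "v \<in> V")
    case False
    then have "v \<notin> keys \<alpha>" "v \<notin> keys \<beta>"
      using assms(1,2) by (auto simp: monomials_def)
    then show ?thesis by (simp add: in_keys_iff)
  qed (rule assms(3))
qed

text \<open>Compare the terms that are largest for an additive weight separating all the monomials that
  occur.\<close>

lemma meets_prime:
  fixes p q :: "('v, 'k::field) mpoly"
  assumes "finite V" "p \<in> supported (monomials V)" "q \<in> supported (monomials V)"
    "p \<notin> supported (meets V W)" "q \<notin> supported (meets V W)"
  shows "p * q \<notin> supported (meets V W)"
proof -
  obtain vs where vs: "set vs = V" using assms(1) finite_list by blast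
  define U where "U = meets V W"
  define X where "X = keys p \<union> keys q"
  have X: "finite X" "X \<subseteq> monomials V" using assms(2,3) by (auto simp: X_def supported_def)
  define B where "B = Suc (\<Sum>\<alpha>\<in>X. total_degree V \<alpha>)"
  have B: "lookup \<alpha> v < B" if "\<alpha> \<in> X" "v \<in> V" for \<alpha> v
  proof -
    have "lookup \<alpha> v \<le> total_degree V \<alpha>"
      unfolding total_degree_def using that assms(1) by (intro member_le_sum) auto
    also have "\<dots> \<le> (\<Sum>\<alpha>\<in>X. total_degree V \<alpha>)" using that X by (intro member_le_sum) auto
    finally show ?thesis by (simp add: B_def)
  qed
  define w where "w = (\<lambda>\<alpha>. weighted B vs (lookup \<alpha>))"
  have w_add: "w (\<alpha> + \<beta>) = w \<alpha> + w \<beta>" for \<alpha> \<beta>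
  proof -
    have "lookup (\<alpha> + \<beta>) = (\<lambda>v. lookup \<alpha> v + lookup \<beta> v)"
      by (rule ext) (rule lookup_add)
    then show ?thesis by (simp add: w_def weighted_add)
  qed
  have w_inj: "\<alpha> = \<beta>" if "\<alpha> \<in> X" "\<beta> \<in> X" "w \<alpha> = w \<beta>" for \<alpha> \<beta>
  proof (rule monomials_eqI)
    show "\<alpha> \<in> monomials V" "\<beta> \<in> monomials V" using that X by auto
    show "lookup \<alpha> v = lookup \<beta> v" if "v \<in> V" for v
      using weighted_inj[of B vs "lookup \<alpha>" "lookup \<beta>"]
        \<open>w \<alpha> = w \<beta>\<close> B \<open>\<alpha> \<in> X\<close> \<open>\<beta> \<in> X\<close> that vs by (simp add: w_def)
  qed
  have greatest: "\<exists>\<alpha>\<in>Y. \<forall>\<beta>\<in>Y. w \<beta> \<le> w \<alpha>" if "finite Y" "Y \<noteq> {}" for Y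
  proof -
    have "Max (w ` Y) \<in> w ` Y" using that by (intro Max_in) auto
    then obtain \<alpha> where "\<alpha> \<in> Y" "w \<alpha> = Max (w ` Y)" by auto
    then show ?thesis using that by (intro bexI[of _ \<alpha>]) auto
  qed
  have "keys p - U \<noteq> {}" "keys q - U \<noteq> {}"
    using assms(4,5) by (auto simp: supported_def U_def)
  then obtain \<alpha> \<beta> where \<alpha>: "\<alpha> \<in> keys p - U" "\<forall>\<gamma>\<in>keys p - U. w \<gamma> \<le> w \<alpha>"
    and \<beta>: "\<beta> \<in> keys q - U" "\<forall>\<gamma>\<in>keys q - U. w \<gamma> \<le> w \<beta>"
    using greatest[of "keys p - U"] greatest[of "keys q - U"] by auto
  have mon: "\<gamma> \<in> monomials V" if "\<gamma> \<in> X" for \<gamma> using that X by blast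
  have \<alpha>\<beta>: "\<alpha> + \<beta> \<notin> U"
    using \<alpha>(1) \<beta>(1) mon by (auto simp: U_def meets_def lookup_add X_def)
  have "lookup (p * q) (\<alpha> + \<beta>) = lookup p \<alpha> * lookup q \<beta>"
  proof (rule lookup_mult_unique)
    fix \<gamma> \<delta> assume *: "\<gamma> \<in> keys p" "\<delta> \<in> keys q" "\<gamma> + \<delta> = \<alpha> + \<beta>"
    have "\<gamma> \<notin> U" "\<delta> \<notin> U"
      using * \<alpha>\<beta> upward_addI[OF upward_meets] mon unfolding U_def X_def
      by (metis UnI1 UnI2 add.commute)+
    then have "w \<gamma> \<le> w \<alpha>" "w \<delta> \<le> w \<beta>" using * \<alpha>(2) \<beta>(2) by blast+
    moreover have "w \<gamma> + w \<delta> = w \<alpha> + w \<beta>" using *(3) w_add by metis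
    ultimately have "w \<gamma> = w \<alpha>" by simp
    then have "\<gamma> = \<alpha>" using w_inj * \<alpha>(1) by (auto simp: X_def)
    then show "\<gamma> = \<alpha> \<and> \<delta> = \<beta>" using *(3) by simp
  qed
  then have "\<alpha> + \<beta> \<in> keys (p * q)"
    using \<alpha>(1) \<beta>(1) by (simp add: in_keys_iff)
  then show ?thesis using \<alpha>\<beta> by (auto simp: supported_def U_def)
qed

section \<open>Algebraic dependence of more polynomials than variables\<close>

definition exponent_lists :: "nat \<Rightarrow> nat \<Rightarrow> nat list set"
  where "exponent_lists N l = {\<beta>. set \<beta> \<subseteq> {..<N} \<and> length \<beta> = l}"

lemma finite_exponent_lists: "finite (exponent_lists N l)"
  unfolding exponent_lists_def by (rule finite_lists_length_eq) simp

lemma card_exponent_lists: "card (exponent_lists N l) = N ^ l"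
  unfolding exponent_lists_def by (subst card_lists_length_eq) auto

lemma exponent_lists_0: "exponent_lists N 0 = {[]}"
  by (auto simp: exponent_lists_def)

lemma sum_exponent_lists_Suc:
  "(\<Sum>\<beta>\<in>exponent_lists N (Suc l). f \<beta>) = (\<Sum>b<N. \<Sum>\<beta>\<in>exponent_lists N l. f (b # \<beta>))"
proof -
  have "exponent_lists N (Suc l) = (\<lambda>(b, \<beta>). b # \<beta>) ` ({..<N} \<times> exponent_lists N l)"
    by (auto simp: exponent_lists_def length_Suc_conv image_iff)
  moreover have "inj_on (\<lambda>(b, \<beta>). b # \<beta>) ({..<N} \<times> exponent_lists N l)" by (auto intro: inj_onI)
  ultimately have "(\<Sum>\<beta>\<in>exponent_lists N (Suc l). f \<beta>) =
      (\<Sum>(b, \<beta>)\<in>{..<N} \<times> exponent_lists N l. f (b # \<beta>))"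
    by (simp add: sum.reindex case_prod_unfold)
  then show ?thesis by (simp add: sum.cartesian_product)
qed

primrec monomial_value :: "'a::comm_semiring_1 list \<Rightarrow> nat list \<Rightarrow> 'a"
  where "monomial_value [] \<beta> = 1"
  | "monomial_value (y # ys) \<beta> = y ^ hd \<beta> * monomial_value ys (tl \<beta>)"

definition exponents_le :: "nat \<Rightarrow> ('v, 'k::field) mpoly \<Rightarrow> bool"
  where "exponents_le B p \<longleftrightarrow> (\<forall>\<alpha>\<in>keys p. \<forall>v. lookup \<alpha> v \<le> B)"

lemma exponents_le_mult:
  assumes "exponents_le B p" "exponents_le C q"
  shows "exponents_le (B + C) (p * q)"
  unfolding exponents_le_def
proof (intro ballI allI)
  fix \<alpha> v assume "\<alpha> \<in> keys (p * q)"
  then obtain \<beta> \<gamma> where "\<alpha> = \<beta> + \<gamma>" "\<beta> \<in> keys p" "\<gamma> \<in> keys q"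
    using keys_mult[of p q] by blast
  then show "lookup \<alpha> v \<le> B + C"
    using assms by (auto simp: exponents_le_def lookup_add intro: add_mono)
qed

lemma exponents_le_mono: "exponents_le B p \<Longrightarrow> B \<le> C \<Longrightarrow> exponents_le C p"
  unfolding exponents_le_def using le_trans by blast

lemma exponents_le_power: "exponents_le B p \<Longrightarrow> exponents_le (n * B) (p ^ n)"
proof (induction n)
  case 0
  then show ?case by (simp add: exponents_le_def)
next
  case (Suc n)
  then show ?case using exponents_le_mult[of B p "n * B" "p ^ n"] by simp
qed

lemma exponents_le_monomial_value:
  assumes "\<And>y. y \<in> set ys \<Longrightarrow> exponents_le D y" "\<beta> \<in> exponent_lists N (length ys)"
  shows "exponents_le (length ys * (N * D)) (monomial_value ys \<beta>)"
  using assms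
proof (induction ys arbitrary: \<beta>)
  case Nil
  then show ?case by (simp add: exponents_le_def)
next
  case (Cons y ys)
  obtain b \<gamma> where \<beta>: "\<beta> = b # \<gamma>" using Cons.prems(2) by (cases \<beta>) (auto simp: exponent_lists_def)
  then have "b \<le> N" "\<gamma> \<in> exponent_lists N (length ys)" using Cons.prems(2) by (auto simp: exponent_lists_def)
  then have "exponents_le (N * D) (y ^ b)" "exponents_le (length ys * (N * D)) (monomial_value ys \<gamma>)"
    using Cons exponents_le_mono[OF exponents_le_power[of D y b], of "N * D"] by auto
  from exponents_le_mult[OF this] show ?case by (simp add: \<beta>)
qed

lemma monomial_value_supported:
  fixes ys :: "('v, 'k::field) mpoly list"
  assumes "\<And>y. y \<in> set ys \<Longrightarrow> y \<in> supported (monomials V)"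
  shows "monomial_value ys \<beta> \<in> supported (monomials V)"
proof -
  have mult: "p * q \<in> supported (monomials V)" if "p \<in> supported (monomials V)" "q \<in> supported (monomials V)"
    for p q :: "('v, 'k) mpoly"
    using that by (rule supported_mult) (rule monomials_add)
  have "y ^ b \<in> supported (monomials V)" if "y \<in> supported (monomials V)" for y :: "('v, 'k) mpoly" and b
    by (induction b) (use that mult in auto)
  then show ?thesis using assms by (induction ys arbitrary: \<beta>) (auto intro: mult)
qed

lemma supported_sum:
  "(\<And>i. i \<in> I \<Longrightarrow> f i \<in> supported U) \<Longrightarrow> (\<Sum>i\<in>I. f i) \<in> supported U"
  by (induction I rule: infinite_finite_induct) (auto intro: supported_add)

text \<open>Dimension count: there are \<open>N\<^sup>l\<close> values, where \<open>l > card V\<close>, but only \<open>O(N\<^bsup>card V\<^esup>)\<close>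
  monomials can occur in them.\<close>

lemma algebraic_dependence:
  fixes ys :: "('v, 'k::field) mpoly list"
  assumes "finite V" "\<And>y. y \<in> set ys \<Longrightarrow> y \<in> supported (monomials V)" "card V < length ys"
  obtains N and c :: "nat list \<Rightarrow> 'k" where "\<exists>\<beta>\<in>exponent_lists N (length ys). c \<beta> \<noteq> 0"
    "(\<Sum>\<beta>\<in>exponent_lists N (length ys). single 0 (c \<beta>) * monomial_value ys \<beta>) = 0"
proof -
  have "\<exists>D. exponents_le D y" for y :: "('v, 'k) mpoly"
  proof -
    have "exponents_le (\<Sum>\<alpha>\<in>keys y. \<Sum>v\<in>keys \<alpha>. lookup \<alpha> v) y"
      unfolding exponents_le_def
    proof (intro ballI allI)
      fix \<alpha> v assume \<alpha>: "\<alpha> \<in> keys y"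
      have "lookup \<alpha> v \<le> (\<Sum>v\<in>keys \<alpha>. lookup \<alpha> v)"
        by (cases "v \<in> keys \<alpha>") (auto intro: member_le_sum simp: in_keys_iff)
      also have "\<dots> \<le> (\<Sum>\<alpha>\<in>keys y. \<Sum>v\<in>keys \<alpha>. lookup \<alpha> v)"
        using \<alpha> by (intro member_le_sum[of \<alpha> _ "\<lambda>\<alpha>. \<Sum>v\<in>keys \<alpha>. lookup \<alpha> v"]) auto
      finally show "lookup \<alpha> v \<le> (\<Sum>\<alpha>\<in>keys y. \<Sum>v\<in>keys \<alpha>. lookup \<alpha> v)" .
    qed
    then show ?thesis ..
  qed
  then obtain D0 where D0: "\<And>y::('v, 'k) mpoly. exponents_le (D0 y) y" by metis
  define D where "D = (\<Sum>y\<in>set ys. D0 y)"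
  have D: "exponents_le D y" if "y \<in> set ys" for y
    using exponents_le_mono[OF D0[of y], of D] that unfolding D_def by (simp add: member_le_sum)
  define l where "l = length ys"
  \<comment> \<open>All products have exponents at most \<open>B\<close>, and \<open>B + 1\<close>
    is at most \<open>(l * D + 1) * N\<close>. As \<open>N\<close> exceeds the factor
    \<open>(l * D + 1) ^ card V\<close>, fewer than \<open>N ^ (card V + 1)\<close>, hence fewer
    than \<open>N ^ l\<close>, monomials can occur.\<close>
  define N where "N = Suc ((l * D + 1) ^ card V)"
  define B where "B = l * (N * D)"
  define X where "X = {\<alpha> \<in> monomials V. \<forall>v\<in>V. lookup \<alpha> v \<le> B}"
  have inj: "inj_on (\<lambda>\<alpha>. restrict (lookup \<alpha>) V) X"
  proof (rule inj_onI)
    fix \<alpha> \<beta> assume *: "\<alpha> \<in> X" "\<beta> \<in> X" "restrict (lookup \<alpha>) V = restrict (lookup \<beta>) V"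
    show "\<alpha> = \<beta>"
    proof (rule monomials_eqI)
      show "lookup \<alpha> v = lookup \<beta> v" if "v \<in> V" for v
        using fun_cong[OF *(3), of v] that by simp
    qed (use * in \<open>auto simp: X_def\<close>)
  qed
  have img: "(\<lambda>\<alpha>. restrict (lookup \<alpha>) V) ` X \<subseteq> V \<rightarrow>\<^sub>E {..B}" by (auto simp: X_def)
  have finPi: "finite (V \<rightarrow>\<^sub>E {..B})" using assms(1) by (intro finite_PiE) auto
  have X: "finite X" "card X \<le> (B + 1) ^ card V"
    using inj_on_finite[OF inj img finPi] card_inj_on_le[OF inj img finPi] assms(1)
    by (simp_all add: card_funcsetE)
  have "(B + 1) ^ card V \<le> ((l * D + 1) * N) ^ card V"
    by (intro power_mono) (auto simp: B_def N_def algebra_simps)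
  also have "\<dots> < N * N ^ card V"
    unfolding power_mult_distrib by (rule mult_strict_right_mono) (simp_all add: N_def)
  also have "\<dots> \<le> N ^ l"
  proof -
    have "Suc (card V) \<le> l" using assms(3) by (simp add: l_def)
    then have "N ^ Suc (card V) \<le> N ^ l" by (intro power_increasing) (auto simp: N_def)
    then show ?thesis by simp
  qed
  finally have "card X < card (exponent_lists N l)" using X(2) by (simp add: card_exponent_lists)
  \<comment> \<open>The products are the columns and the monomials in \<open>X\<close> the rows of
    the linear system; there are more columns than rows.\<close>
  then obtain c where c: "\<exists>\<beta>\<in>exponent_lists N l. c \<beta> \<noteq> (0::'k)"
    "\<forall>\<alpha>\<in>X. (\<Sum>\<beta>\<in>exponent_lists N l. c \<beta> * lookup (monomial_value ys \<beta>) \<alpha>) = 0"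
    using elimination[OF finite_exponent_lists X(1), of N l "\<lambda>\<alpha> \<beta>. lookup (monomial_value ys \<beta>) \<alpha>"]
    by (metis not_le)
  have lookup_scale: "lookup (single 0 a * p) \<alpha> = a * lookup p \<alpha>"
    for a and p :: "('v, 'k) mpoly" and \<alpha>
  proof -
    define s :: "('v, 'k) mpoly" where "s = single 0 a"
    have "lookup (s * p) (0 + \<alpha>) = lookup s 0 * lookup p \<alpha>"
      by (rule lookup_mult_unique) (auto simp: s_def split: if_splits)
    then show ?thesis by (simp add: s_def)
  qed
  have "(\<Sum>\<beta>\<in>exponent_lists N l. single 0 (c \<beta>) * monomial_value ys \<beta>) = 0"
  proof (rule poly_mapping_eqI)
    fix \<alpha>
    have "(\<Sum>\<beta>\<in>exponent_lists N l. c \<beta> * lookup (monomial_value ys \<beta>) \<alpha>) = 0"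
    proof (cases "\<alpha> \<in> X")
      case False
      have "lookup (monomial_value ys \<beta>) \<alpha> = 0" if "\<beta> \<in> exponent_lists N l" for \<beta>
      proof (rule ccontr)
        assume "lookup (monomial_value ys \<beta>) \<alpha> \<noteq> 0"
        then have \<alpha>: "\<alpha> \<in> keys (monomial_value ys \<beta>)" by (simp add: in_keys_iff)
        then have "\<alpha> \<in> monomials V"
          using monomial_value_supported[of ys V \<beta>] assms(2) by (auto simp: supported_def)
        moreover have "lookup \<alpha> v \<le> B" for v
          using exponents_le_monomial_value[of ys D \<beta> N] D that \<alpha>
          by (auto simp: exponents_le_def B_def l_def)
        ultimately show False using False by (simp add: X_def)
      qed
      then show ?thesis by simp
    qed (use c in auto)
    then show "lookup (\<Sum>\<beta>\<in>exponent_lists N l. single 0 (c \<beta>) * monomial_value ys \<beta>) \<alpha> =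
        lookup 0 \<alpha>"
      by (simp add: lookup_sum lookup_scale)
  qed
  then show thesis using that c(1) unfolding l_def by blast
qed

section \<open>Chains of prime ideals\<close>

context local_polynomials
begin

lemma prime_meets: "primeideal (monomial_ideal (meets V W)) A"
proof (rule primeidealI[OF ideal_monomial_ideal[OF upward_meets] cring_A])
  show "carrier A \<noteq> monomial_ideal (meets V W)"
  proof
    assume "carrier A = monomial_ideal (meets V W)"
    then have "frac 1 1 \<in> monomial_ideal (meets V W)" using A_one A.one_closed by simp
    then have "(1 :: ('v, 'k) mpoly) \<in> supported (meets V W)" using frac_in_monomial_ideal[OF upward_meets one_R S_1, of W] by simp
    then show False by (simp add: supported_def meets_def)
  qed
  fix x y assume "x \<in> carrier A" "y \<in> carrier A" and xy: "x \<otimes>\<^bsub>A\<^esub> y \<in> monomial_ideal (meets V W)"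
  then obtain a s b t where *: "a \<in> carrier R" "s \<in> S" "x = frac a s" "b \<in> carrier R" "t \<in> S" "y = frac b t"
    by (metis A_cases)
  then have "a * b \<in> supported (meets V W)"
    using xy R_closed(2) S_closed by (simp add: frac_mult frac_in_monomial_ideal[OF upward_meets])
  then have "a \<in> supported (meets V W) \<or> b \<in> supported (meets V W)"
    using meets_prime[OF finV, of a b W] *(1,4) by (auto simp: carrier_R)
  then show "x \<in> monomial_ideal (meets V W) \<or> y \<in> monomial_ideal (meets V W)"
    using * by (simp add: frac_in_monomial_ideal[OF upward_meets])
qed

lemma prime_chain_exists:
  "\<exists>P :: nat \<Rightarrow> _. (\<forall>i\<le>card V. primeideal (P i) A) \<and> (\<forall>i<card V. P i \<subset> P (Suc i))"
proof -
  obtain vs where vs: "set vs = V" "distinct vs" using finV finite_distinct_list by blast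
  then have len: "length vs = card V" using distinct_card by metis
  have "monomial_ideal (meets V (set (take i vs))) \<subset> monomial_ideal (meets V (set (take (Suc i) vs)))" if "i < card V" for i
  proof (rule monomial_ideal_psubset[OF upward_meets upward_meets])
    define v where "v = vs ! i"
    have take: "set (take (Suc i) vs) = insert v (set (take i vs))"
      using that len by (simp add: take_Suc_conv_app_nth v_def)
    have "v \<notin> set (take i vs)"
    proof
      assume "v \<in> set (take i vs)"
      then obtain j where "j < i" "vs ! j = vs ! i" using that len by (auto simp: in_set_conv_nth v_def)
      then show False using vs(2) that len by (simp add: nth_eq_iff_index_eq)
    qed
    moreover have "v \<in> V" using that len vs(1) by (auto simp: v_def)
    ultimately have "single v 1 \<in> meets V (set (take (Suc i) vs))"
      "single v 1 \<notin> meets V (set (take i vs))"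
      by (auto simp: meets_def take lookup_single when_def)
    moreover have "meets V (set (take i vs)) \<subseteq> meets V (set (take (Suc i) vs))"
      by (auto simp: meets_def take)
    ultimately show "meets V (set (take i vs)) \<subset> meets V (set (take (Suc i) vs))" by blast
  qed
  then show ?thesis
    by (intro exI[of _ "\<lambda>i. monomial_ideal (meets V (set (take i vs)))"]) (auto intro: prime_meets)
qed

text \<open>Look at the least power of \<open>y\<close> with a non-zero coefficient: modulo the next prime ideal only
  this coefficient survives.\<close>

lemma no_relation_along_chain:
  assumes "\<And>i. i \<le> n \<Longrightarrow> 0 \<in> Q i" "\<And>i p q. i \<le> n \<Longrightarrow> p \<in> Q i \<Longrightarrow> q \<in> Q i \<Longrightarrow> p - q \<in> Q i"
    "\<And>i p q. i \<le> n \<Longrightarrow> p \<in> Q i \<Longrightarrow> q \<in> carrier R \<Longrightarrow> p * q \<in> Q i"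
    "\<And>i p q. i \<le> n \<Longrightarrow> p \<in> carrier R \<Longrightarrow> q \<in> carrier R \<Longrightarrow> p * q \<in> Q i \<Longrightarrow> p \<in> Q i \<or> q \<in> Q i"
    "\<And>i. i \<le> n \<Longrightarrow> 1 \<notin> Q i" "\<And>i. i < n \<Longrightarrow> Q i \<subseteq> Q (Suc i)"
    and "j + length ys \<le> n"
    and "\<And>i. i < length ys \<Longrightarrow> ys ! i \<in> carrier R \<and> ys ! i \<in> Q (Suc (j + i)) \<and> ys ! i \<notin> Q (j + i)"
    and "(\<Sum>\<beta>\<in>exponent_lists N (length ys). single 0 (c \<beta>) * monomial_value ys \<beta>) \<in> Q j"
  shows "\<forall>\<beta>\<in>exponent_lists N (length ys). c \<beta> = 0"
  using assms(7-9)
proof (induction ys arbitrary: j c)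
  case Nil
  have "c [] = 0"
  proof (rule ccontr)
    assume c: "c [] \<noteq> 0"
    have "single 0 (c []) \<in> Q j" using Nil.prems(3) by (simp add: exponent_lists_0)
    then have "single 0 (c []) * single 0 (1 / c []) \<in> Q j"
      using assms(3)[of j] Nil.prems(1) by (simp add: carrier_R)
    then show False using assms(5)[of j] Nil.prems(1) c by (simp add: mult_single)
  qed
  then show ?case by (simp add: exponent_lists_0)
next
  case (Cons y ys)
  define q where "q = (\<lambda>b. \<Sum>\<beta>\<in>exponent_lists N (length ys). single 0 (c (b # \<beta>)) * monomial_value ys \<beta>)"
  have y: "y \<in> carrier R" "y \<in> Q (Suc j)" "y \<notin> Q j" using Cons.prems(2)[of 0] by auto
  have ys: "ys ! i \<in> carrier R \<and> ys ! i \<in> Q (Suc (Suc j + i)) \<and> ys ! i \<notin> Q (Suc j + i)" if "i < length ys" for i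
    using Cons.prems(2)[of "Suc i"] that by simp
  have ys_R: "z \<in> supported (monomials V)" if "z \<in> set ys" for z
    using that ys by (auto simp: in_set_conv_nth carrier_R)
  have q_R: "q b \<in> carrier R" for b
    unfolding q_def carrier_R
  proof (rule supported_sum)
    show "single 0 (c (b # \<beta>)) * monomial_value ys \<beta> \<in> supported (monomials V)" for \<beta>
      by (rule supported_mult[of _ "monomials V" _ "monomials V"])
        (auto intro: monomial_value_supported ys_R monomials_add)
  qed
  have sum: "(\<Sum>b<N. y ^ b * q b) \<in> Q j"
  proof -
    have "(\<Sum>\<beta>\<in>exponent_lists N (length (y # ys)). single 0 (c \<beta>) * monomial_value (y # ys) \<beta>) =
        (\<Sum>b<N. y ^ b * q b)"
      by (simp add: sum_exponent_lists_Suc q_def sum_distrib_left mult_ac)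
    then show ?thesis using Cons.prems(3) by simp
  qed
  have pow_R: "y ^ b \<in> carrier R" for b
    by (induction b) (use R_closed y(1) in auto)
  have "c (b # \<beta>) = 0" if "b < N" "\<beta> \<in> exponent_lists N (length ys)" for b \<beta>
  proof (rule ccontr)
    assume "c (b # \<beta>) \<noteq> 0"
    define P where "P = (\<lambda>b. b < N \<and> (\<exists>\<beta>\<in>exponent_lists N (length ys). c (b # \<beta>) \<noteq> 0))"
    have "P b" using that \<open>c (b # \<beta>) \<noteq> 0\<close> by (auto simp: P_def)
    define b0 where "b0 = (LEAST b. P b)"
    have b0: "P b0" "\<And>b. b < b0 \<Longrightarrow> \<not> P b"
      unfolding b0_def using LeastI[of P b, OF \<open>P b\<close>] not_less_Least by auto
    have q0: "q b = 0" if "b < b0" for b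
    proof -
      have "c (b # \<beta>) = 0" if "\<beta> \<in> exponent_lists N (length ys)" for \<beta>
        using b0 \<open>b < b0\<close> that unfolding P_def by (meson less_trans)
      then show ?thesis by (simp add: q_def)
    qed
    \<comment> \<open>The relation becomes \<open>y ^ b0 * (q b0 + y * r)\<close>. Powers of
      \<open>y\<close> avoid the prime \<open>Q j\<close>, so the second factor lies in
      \<open>Q j\<close>; in the next ideal, which contains \<open>y\<close>, it leaves
      \<open>q b0\<close>, a relation among the remaining polynomials.\<close>
    define r where "r = (\<Sum>b\<in>{Suc b0..<N}. y ^ (b - Suc b0) * q b)"
    have r_R: "r \<in> carrier R"
      unfolding r_def carrier_R using R_closed(2)[OF pow_R q_R] by (intro supported_sum) (simp add: carrier_R)
    have "(\<Sum>b<N. y ^ b * q b) = y ^ b0 * (q b0 + y * r)"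
    proof -
      have split: "{..<N} = {..<b0} \<union> {b0} \<union> {Suc b0..<N}" using b0(1) by (auto simp: P_def)
      have "(\<Sum>b<N. y ^ b * q b) = (\<Sum>b\<in>{..<b0} \<union> {b0}. y ^ b * q b) + (\<Sum>b\<in>{Suc b0..<N}. y ^ b * q b)"
        unfolding split by (rule sum.union_disjoint) auto
      also have "(\<Sum>b\<in>{..<b0} \<union> {b0}. y ^ b * q b) = y ^ b0 * q b0"
        using q0 by (subst sum.union_disjoint) auto
      also have "(\<Sum>b\<in>{Suc b0..<N}. y ^ b * q b) = y ^ b0 * (y * r)"
        unfolding r_def sum_distrib_left
      proof (intro sum.cong refl)
        fix b assume "b \<in> {Suc b0..<N}"
        then have "b = b0 + Suc (b - Suc b0)" by auto
        then have "y ^ b = y ^ b0 * (y * y ^ (b - Suc b0))" by (metis power_Suc power_add)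
        then show "y ^ b * q b = y ^ b0 * (y * (y ^ (b - Suc b0) * q b))" by (simp add: mult.assoc)
      qed
      finally show ?thesis by (simp add: distrib_left)
    qed
    then have in_Q: "y ^ b0 * (q b0 + y * r) \<in> Q j" using sum by simp
    have j: "j \<le> n" "Suc j \<le> n" "j < n" using Cons.prems(1) by auto
    have "y ^ b \<notin> Q j" for b
    proof (induction b)
      case 0
      then show ?case using assms(5) j by simp
    next
      case (Suc b)
      then show ?case using assms(4)[OF j(1) y(1) pow_R] y(3) by auto
    qed
    then have "q b0 + y * r \<in> Q j"
      using assms(4)[OF j(1) pow_R _ in_Q] R_closed(1,2) q_R y(1) r_R by blast
    then have "q b0 + y * r \<in> Q (Suc j)" using assms(6) j by blast
    moreover have "y * r \<in> Q (Suc j)" using assms(3)[OF j(2) y(2) r_R] .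
    ultimately have "q b0 \<in> Q (Suc j)" using assms(2)[OF j(2), of "q b0 + y * r" "y * r"] by simp
    then have "\<forall>\<beta>\<in>exponent_lists N (length ys). c (b0 # \<beta>) = 0"
      using Cons.prems(1) ys unfolding q_def by (intro Cons.IH[of "Suc j"]) auto
    then show False using b0(1) by (auto simp: P_def)
  qed
  then show ?case by (auto simp: exponent_lists_def length_Suc_conv)
qed

text \<open>Contract the primes to the polynomial ring and pick a polynomial from each step of the
  chain. More of them than variables are algebraically dependent, which contradicts
  \<open>no_relation_along_chain\<close>.\<close>

lemma prime_chain_bound:
  assumes P: "\<And>i. i \<le> n \<Longrightarrow> primeideal (P i) A" "\<And>i. i < n \<Longrightarrow> P i \<subset> P (Suc i)"
  shows "n \<le> card V"
proof (rule ccontr)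
  assume n: "\<not> n \<le> card V"
  define Q where "Q = (\<lambda>i. {p \<in> carrier R. frac p 1 \<in> P i})"
  have ideal: "ideal (P i) A" if "i \<le> n" for i using P(1)[OF that] primeideal.axioms(1) by blast
  have Q_diff: "p - q \<in> Q i" if "i \<le> n" "p \<in> Q i" "q \<in> Q i" for i p q
  proof -
    have R: "p \<in> carrier R" "q \<in> carrier R" "- q \<in> carrier R" using that R_closed(3) by (auto simp: Q_def)
    interpret Pi: ideal "P i" A using ideal that by blast
    have "frac p 1 \<oplus>\<^bsub>A\<^esub> (\<ominus>\<^bsub>A\<^esub> frac q 1) \<in> P i"
      using that by (intro Pi.a_closed Pi.a_inv_closed) (auto simp: Q_def)
    then have "frac (p + - q) 1 \<in> P i" using R S_1 by (simp add: A_uminus frac_add_same)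
    then show ?thesis using R R_closed(1)[of p "- q"] by (simp add: Q_def)
  qed
  have Q_mult: "p * q \<in> Q i" if "i \<le> n" "p \<in> Q i" "q \<in> carrier R" for i p q
  proof -
    interpret Pi: ideal "P i" A using ideal that by blast
    have "frac p 1 \<otimes>\<^bsub>A\<^esub> frac q 1 \<in> P i"
      using that S_1 by (intro Pi.I_r_closed frac_closed) (auto simp: Q_def)
    then show ?thesis using that R_closed(2)[of p q] S_1 by (simp add: Q_def frac_mult)
  qed
  have Q_prime: "p \<in> Q i \<or> q \<in> Q i" if "i \<le> n" "p \<in> carrier R" "q \<in> carrier R" "p * q \<in> Q i" for i p q
  proof -
    have "frac p 1 \<otimes>\<^bsub>A\<^esub> frac q 1 \<in> P i" using that S_1 by (simp add: Q_def frac_mult)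
    then have "frac p 1 \<in> P i \<or> frac q 1 \<in> P i"
      using primeideal.I_prime[OF P(1)[OF that(1)]] that S_1 frac_closed by blast
    then show ?thesis using that by (simp add: Q_def)
  qed
  have Q_1: "1 \<notin> Q i" if "i \<le> n" for i
  proof
    assume "1 \<in> Q i"
    then have "\<one>\<^bsub>A\<^esub> \<in> P i" by (simp add: Q_def A_one)
    then show False
      using ideal.one_imp_carrier[OF ideal[OF that]] primeideal.I_notcarr[OF P(1)[OF that]] by blast
  qed
  have "\<exists>y. y \<in> Q (Suc i) \<and> y \<notin> Q i" if i: "i < n" for i
  proof -
    obtain x where x: "x \<in> P (Suc i)" "x \<notin> P i" using P(2)[OF i] by blast
    interpret P1: ideal "P (Suc i)" A using ideal[of "Suc i"] i by simp
    interpret P0: ideal "P i" A using ideal[of i] i by simp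
    obtain a s where a: "a \<in> carrier R" "s \<in> S" "x = frac a s" using P1.Icarr[OF x(1)] A_cases by blast
    have s: "s \<in> carrier R" using a S_R by blast
    \<comment> \<open>The denominator is a unit of the local ring, so numerator and fraction lie in
      the same ideals and the inclusions stay strict after contraction.\<close>
    have "frac a s \<otimes>\<^bsub>A\<^esub> frac s 1 = frac a 1" "frac a 1 \<otimes>\<^bsub>A\<^esub> frac 1 s = frac a s"
      using a s S_1 one_R R_closed(2) by (simp_all add: frac_mult frac_eq_iff)
    then have "frac a 1 \<in> P (Suc i)" "frac a 1 \<notin> P i"
      using P1.I_r_closed[OF x(1), of "frac s 1"] P0.I_r_closed[of "frac a 1" "frac 1 s"]
        x a s S_1 one_R frac_closed by auto
    then show ?thesis using a by (auto simp: Q_def)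
  qed
  then obtain f where f: "\<And>i. i < n \<Longrightarrow> f i \<in> Q (Suc i) \<and> f i \<notin> Q i" by metis
  define ys where "ys = map f [0..<n]"
  have ys_R: "y \<in> supported (monomials V)" if "y \<in> set ys" for y
    using that f by (auto simp: ys_def Q_def carrier_R)
  obtain N and c :: "nat list \<Rightarrow> 'k" where c: "\<exists>\<beta>\<in>exponent_lists N (length ys). c \<beta> \<noteq> 0"
    "(\<Sum>\<beta>\<in>exponent_lists N (length ys). single 0 (c \<beta>) * monomial_value ys \<beta>) = 0"
    by (rule algebraic_dependence[OF finV, of ys]) (use ys_R n in \<open>auto simp: ys_def\<close>)
  have Q_0: "0 \<in> Q i" if "i \<le> n" for i
    using additive_subgroup.zero_closed[OF ideal.axioms(1)[OF ideal[OF that]]] zero_R by (simp add: Q_def A_zero)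
  have "\<forall>\<beta>\<in>exponent_lists N (length ys). c \<beta> = 0"
  proof (rule no_relation_along_chain[where Q = Q and n = n and j = 0])
    show "Q i \<subseteq> Q (Suc i)" if "i < n" for i using P(2)[OF that] by (auto simp: Q_def)
    show "ys ! i \<in> carrier R \<and> ys ! i \<in> Q (Suc (0 + i)) \<and> ys ! i \<notin> Q (0 + i)" if "i < length ys" for i
      using f[of i] that by (auto simp: ys_def Q_def)
    show "(\<Sum>\<beta>\<in>exponent_lists N (length ys). single 0 (c \<beta>) * monomial_value ys \<beta>) \<in> Q 0"
      unfolding c(2) by (rule Q_0) simp
  qed (use Q_0 Q_diff Q_mult Q_prime Q_1 in \<open>auto simp: ys_def\<close>)
  then show False using c(1) by blast
qed

lemma krull_dim_A: "krull_dim A = enat (card V)"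
  unfolding krull_dim_def
proof (rule antisym)
  have bound: "n \<le> card V" if "\<forall>i\<le>n. primeideal (P i) A" "\<forall>i<n. P i \<subset> P (Suc i)" for n P
    using prime_chain_bound[of n P] that by blast
  show "Sup {enat n | n. \<exists>P :: nat \<Rightarrow> _. (\<forall>i\<le>n. primeideal (P i) A) \<and> (\<forall>i<n. P i \<subset> P (Suc i))}
      \<le> enat (card V)"
    using bound by (intro Sup_least) auto
  show "enat (card V) \<le>
      Sup {enat n | n. \<exists>P :: nat \<Rightarrow> _. (\<forall>i\<le>n. primeideal (P i) A) \<and> (\<forall>i<n. P i \<subset> P (Suc i))}"
    using prime_chain_exists by (intro Sup_upper) auto
qed

end

section \<open>The j-multiplicity of an edge ideal\<close>

definition edge_monomial :: "'v set \<Rightarrow> 'v \<Rightarrow>\<^sub>0 nat"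
  where "edge_monomial e = (\<Sum>v\<in>e. single v 1)"

lemma lookup_edge_monomial:
  assumes "finite e"
  shows "lookup (edge_monomial e) v = (if v \<in> e then 1 else 0)"
  using assms by (simp add: edge_monomial_def lookup_sum lookup_single when_def)

lemma prod_Var:
  assumes "finite e"
  shows "(\<Prod>v\<in>e. Var v) = (monomial (edge_monomial e) :: ('v, 'k::field) mpoly)"
  using assms
  by (induction e rule: finite_induct) (simp_all add: edge_monomial_def Var_def mult_single)

locale edge_polynomials = local_polynomials K V + uniform_edges V E m
  for K :: "'k::field itself" and V :: "'v set" and E m
begin

text \<open>Exponents of the monomials in the \<open>t\<close>-th power of the edge ideal, by
  \<open>power_set_edges\<close>.\<close>

definition packed :: "nat \<Rightarrow> ('v \<Rightarrow>\<^sub>0 nat) set"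
  where "packed t = {\<alpha> \<in> monomials V. packs E t (lookup \<alpha>)}"

lemma finite_edge: "e \<in> E \<Longrightarrow> finite e"
  using E_sub fin_V finite_subset by blast

lemma edge_monomial_in: "e \<in> E \<Longrightarrow> edge_monomial e \<in> monomials V"
  using E_sub
  by (auto simp: monomials_def in_keys_iff lookup_edge_monomial[OF finite_edge] subset_iff Pow_def split: if_splits)

lemma upward_packed: "upward V (packed t)"
  unfolding upward_def packed_def
proof (intro conjI ballI)
  fix \<alpha> \<beta> assume "\<alpha> \<in> {\<alpha> \<in> monomials V. packs E t (lookup \<alpha>)}" "\<beta> \<in> monomials V"
  then show "\<alpha> + \<beta> \<in> {\<alpha> \<in> monomials V. packs E t (lookup \<alpha>)}"
    using packs_mono[of t "lookup \<alpha>" "lookup (\<alpha> + \<beta>)"]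
    by (auto simp: monomials_add lookup_add)
qed auto

lemma power_set_edges: "power_set (up_closure (edge_monomial ` E)) t = packed t"
proof (induction t)
  case 0
  then show ?case by (simp add: packed_def packs_0)
next
  case (Suc t)
  have "add_sets (packed t) (up_closure (edge_monomial ` E)) = packed (Suc t)"
  proof (intro equalityI subsetI)
    fix \<alpha> assume "\<alpha> \<in> add_sets (packed t) (up_closure (edge_monomial ` E))"
    then obtain \<beta> e \<gamma> where *: "\<alpha> = \<beta> + (edge_monomial e + \<gamma>)" "\<beta> \<in> packed t" "e \<in> E" "\<gamma> \<in> monomials V"
      unfolding add_sets_def up_closure_def by blast
    have "packs E 1 (load E (\<lambda>e'. if e' = e then 1 else 0))"
      using packs_load[of "\<lambda>e'. if e' = e then 1 else 0"] load_single(2)[OF *(3)] by simp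
    moreover have "packs E t (lookup \<beta>)" using *(2) by (simp add: packed_def)
    ultimately have "packs E (t + 1) (\<lambda>v. lookup \<beta> v + load E (\<lambda>e'. if e' = e then 1 else 0) v)"
      by (intro packs_add)
    then have "packs E (Suc t) (lookup \<alpha>)"
      using lookup_edge_monomial[OF finite_edge[OF *(3)]] load_single(1)[OF *(3)]
      by (auto elim!: packs_mono simp: *(1) lookup_add)
    moreover have "\<alpha> \<in> monomials V"
      using * edge_monomial_in by (auto simp: packed_def intro!: monomials_add)
    ultimately show "\<alpha> \<in> packed (Suc t)" by (simp add: packed_def)
  next
    fix \<alpha> assume \<alpha>: "\<alpha> \<in> packed (Suc t)"
    then obtain c where c: "\<And>v. load E c v \<le> lookup \<alpha> v" "sum c E = Suc t"
      unfolding packed_def packs_def by blast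
    have "\<exists>e\<in>E. c e \<noteq> 0" using c(2) by (metis nat.simps(3) sum.neutral)
    then obtain e where e: "e \<in> E" "c e \<noteq> 0" by blast
    define d where "d = c(e := c e - 1)"
    have c_d: "c = (\<lambda>e'. d e' + (if e' = e then 1 else 0))" using e by (auto simp: d_def)
    have "load E c v = load E d v + (if v \<in> e then 1 else 0)" for v
      by (subst c_d) (simp add: load_add load_single(1)[OF e(1)])
    then have le: "load E d v + (if v \<in> e then 1 else 0) \<le> lookup \<alpha> v" for v
      using c(1) by metis
    have "sum c E = sum d E + 1"
      by (subst c_d) (simp add: sum.distrib load_single(2)[OF e(1)] del: sum.delta sum.delta')
    then have d: "sum d E = t" using c(2) by simp
    define \<beta> where "\<beta> = \<alpha> - edge_monomial e"
    have \<beta>: "lookup \<beta> v = lookup \<alpha> v - (if v \<in> e then 1 else 0)" for v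
      by (simp add: \<beta>_def lookup_minus lookup_edge_monomial[OF finite_edge[OF e(1)]])
    have \<alpha>_eq: "\<alpha> = \<beta> + edge_monomial e"
    proof (rule poly_mapping_eqI)
      fix v show "lookup \<alpha> v = lookup (\<beta> + edge_monomial e) v"
        using le[of v] by (auto simp: lookup_add \<beta> lookup_edge_monomial[OF finite_edge[OF e(1)]])
    qed
    have "load E d v \<le> lookup \<beta> v" for v using le[of v] unfolding \<beta> by linarith
    then have "packs E t (lookup \<beta>)" unfolding packs_def using d by blast
    moreover have "\<beta> \<in> monomials V"
      using \<alpha> \<alpha>_eq monomials_add_D(1) by (metis (mono_tags, lifting) mem_Collect_eq packed_def)
    ultimately have "\<beta> \<in> packed t" by (simp add: packed_def)
    moreover have "edge_monomial e + 0 \<in> up_closure (edge_monomial ` E)"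
      unfolding up_closure_def using e(1) monomials_0 by blast
    ultimately show "\<alpha> \<in> add_sets (packed t) (up_closure (edge_monomial ` E))"
      unfolding add_sets_def using \<alpha>_eq by force
  qed
  then show ?case using Suc by simp
qed

lemma edge_ideal_eq:
  assumes "nodes G = V" "edges G = E"
  shows "edge_ideal K G = monomial_ideal (up_closure (edge_monomial ` E))"
proof -
  have "{frac (\<Prod>v\<in>e. Var v) 1 | e. e \<in> E} = (\<lambda>e. frac (\<Prod>v\<in>e. Var v) 1) ` E" by blast
  also have "\<dots> = (\<lambda>e. frac (monomial (edge_monomial e)) 1) ` E"
    by (intro image_cong refl) (simp add: prod_Var[OF finite_edge])
  also have "\<dots> = {frac (monomial \<beta>) 1 | \<beta>. \<beta> \<in> edge_monomial ` E}" by blast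
  finally have "{frac (\<Prod>v\<in>e. Var v) 1 | e. e \<in> E} = {frac (monomial \<beta>) 1 | \<beta>. \<beta> \<in> edge_monomial ` E}" .
  then show ?thesis
    unfolding edge_ideal_def assms using genideal_monomials[of "edge_monomial ` E"] edge_monomial_in by auto
qed

lemma edge_ideal_power:
  assumes "nodes G = V" "edges G = E"
  shows "ideal_power A (edge_ideal K G) t = monomial_ideal (packed t)"
proof -
  have "upward V (up_closure (edge_monomial ` E))"
    by (rule upward_up_closure) (use edge_monomial_in in auto)
  then show ?thesis using power_monomial_ideal power_set_edges edge_ideal_eq[OF assms] by simp
qed

text \<open>Exponents of the preimage of the local cohomology in the \<open>t\<close>-th power of
  the ideal.\<close>

definition saturated :: "nat \<Rightarrow> ('v \<Rightarrow>\<^sub>0 nat) set"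
  where "saturated t = {\<alpha> \<in> packed t. torsion_at V E t (lookup \<alpha>)}"

lemma upward_saturated: "upward V (saturated t)"
  unfolding upward_def
proof (intro conjI ballI)
  show "saturated t \<subseteq> monomials V" by (auto simp: saturated_def packed_def)
  fix \<alpha> \<beta> assume *: "\<alpha> \<in> saturated t" "\<beta> \<in> monomials V"
  then have "\<alpha> + \<beta> \<in> packed t" using upward_addI[OF upward_packed] by (auto simp: saturated_def)
  then show "\<alpha> + \<beta> \<in> saturated t"
    using * torsion_at_mono[of t "lookup \<alpha>" "lookup (\<alpha> + \<beta>)"]
    by (auto simp: saturated_def lookup_add)
qed

lemma packed_Suc_subset: "packed (Suc t) \<subseteq> saturated t"
proof
  fix \<alpha> assume \<alpha>: "\<alpha> \<in> packed (Suc t)"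
  then have "torsion_at V E t (lookup \<alpha>)"
    unfolding torsion_at_def packed_def by (auto intro!: exI[of _ 0])
  then show "\<alpha> \<in> saturated t" using \<alpha> packs_Suc by (auto simp: saturated_def packed_def)
qed

lemma bij_saturated: "bij_betw lookup (saturated t - packed (Suc t)) (torsion V E t)"
  unfolding bij_betw_def
proof
  show "inj_on lookup (saturated t - packed (Suc t))"
    by (intro inj_onI poly_mapping_eqI) (rule fun_cong)
  show "lookup ` (saturated t - packed (Suc t)) = torsion V E t"
  proof (intro equalityI subsetI)
    fix f assume "f \<in> lookup ` (saturated t - packed (Suc t))"
    then obtain \<alpha> where \<alpha>: "f = lookup \<alpha>" "\<alpha> \<in> saturated t" "\<alpha> \<notin> packed (Suc t)" by blast
    then have "f v = 0" if "v \<notin> V" for v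
    proof -
      have "v \<notin> keys \<alpha>" using \<alpha>(2) that by (auto simp: saturated_def packed_def monomials_def)
      then show ?thesis by (simp add: \<alpha>(1) in_keys_iff)
    qed
    then show "f \<in> torsion V E t"
      using \<alpha> by (auto simp: saturated_def packed_def torsion_def exponents_def)
  next
    fix f assume f: "f \<in> torsion V E t"
    then have "{v. f v \<noteq> 0} \<subseteq> V" by (auto simp: torsion_def exponents_def)
    then have "finite {v. f v \<noteq> 0}" using fin_V finite_subset by blast
    then have lookup: "lookup (Abs_poly_mapping f) = f" by simp
    then have "Abs_poly_mapping f \<in> saturated t - packed (Suc t)"
      using f \<open>{v. f v \<noteq> 0} \<subseteq> V\<close>
      by (auto simp: saturated_def packed_def torsion_def monomials_def in_keys_iff)
    then show "f \<in> lookup ` (saturated t - packed (Suc t))" using lookup by (metis imageI)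
  qed
qed

lemma single_power_set: "v \<in> V \<Longrightarrow> single v k \<in> power_set (monomials V - {0}) k"
proof (induction k)
  case (Suc k)
  have "single v (1::nat) \<noteq> 0" by (metis lookup_single_eq lookup_zero one_neq_zero)
  then have "single v 1 \<in> monomials V - {0}" using Suc.prems by simp
  moreover have "single v (Suc k) = single v k + single v 1"
    by (simp flip: single_add)
  ultimately show ?case using Suc unfolding power_set.simps add_sets_def by blast
qed simp

lemma power_set_degree: "\<delta> \<in> power_set (monomials V - {0}) k \<Longrightarrow> \<delta> \<in> monomials V \<and> k \<le> total_degree V \<delta>"
proof (induction k arbitrary: \<delta>)
  case (Suc k)
  then obtain \<beta> \<gamma> where *: "\<delta> = \<beta> + \<gamma>" "\<beta> \<in> power_set (monomials V - {0}) k" "\<gamma> \<in> monomials V - {0}"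
    by (auto simp: add_sets_def)
  then have "total_degree V \<gamma> \<noteq> 0" using total_degree_eq_0[OF fin_V] by blast
  then show ?case using Suc.IH[OF *(2)] *(1,3) by (simp add: total_degree_add monomials_add)
qed simp

lemma lookup_add_single:
  "lookup (\<alpha> + single v k) =
    (lookup \<alpha>)(v := lookup \<alpha> v + k)"
  by (rule ext) (simp add: lookup_add lookup_single when_def)

text \<open>A monomial of large degree is divisible by a high power of some variable, so powers of
  the maximal ideal can be replaced by powers of single variables. The finitely many terms of a
  numerator share a common bound, and conversely each term can be tested separately.\<close>

lemma torsion_monomial_ideal: "monomial_ideal (saturated t) = {a \<in> monomial_ideal (packed t).
  \<exists>k. \<forall>r\<in>ideal_power A (monomial_ideal (monomials V - {0})) k. r \<otimes>\<^bsub>A\<^esub> a \<in> monomial_ideal (packed (Suc t))}"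
proof (intro equalityI subsetI)
  fix x assume "x \<in> monomial_ideal (saturated t)"
  then obtain p s where p: "x = frac p s" "p \<in> carrier R" "s \<in> S" "p \<in> supported (saturated t)"
    unfolding monomial_ideal_def by blast
  have "\<exists>k. packs E (Suc t) ((lookup \<alpha>)(v := lookup \<alpha> v + k))"
    if "\<alpha> \<in> keys p" "v \<in> V" for \<alpha> v
    using that p(4) by (auto simp: supported_def saturated_def torsion_at_def)
  then obtain k where k: "\<And>\<alpha> v. \<alpha> \<in> keys p \<Longrightarrow> v \<in> V \<Longrightarrow>
      packs E (Suc t) ((lookup \<alpha>)(v := lookup \<alpha> v + k \<alpha> v))" by metis
  define k0 where "k0 = (\<Sum>\<alpha>\<in>keys p. \<Sum>v\<in>V. k \<alpha> v)"
  have k0: "k \<alpha> v \<le> k0" if "\<alpha> \<in> keys p" "v \<in> V" for \<alpha> v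
  proof -
    have "k \<alpha> v \<le> (\<Sum>v\<in>V. k \<alpha> v)" using that fin_V by (intro member_le_sum) auto
    also have "\<dots> \<le> k0" unfolding k0_def using that
      by (intro member_le_sum[of \<alpha> _ "\<lambda>\<alpha>. \<Sum>v\<in>V. k \<alpha> v"]) auto
    finally show ?thesis .
  qed
  \<comment> \<open>Pigeonhole: if all exponents were below \<open>k0\<close>, the degree would be
    at most \<open>card V * k0\<close>, which is less than \<open>n\<close>.\<close>
  define n where "n = card V * k0 + 1"
  have "\<alpha> + \<delta> \<in> packed (Suc t)"
    if \<alpha>: "\<alpha> \<in> keys p" and \<delta>: "\<delta> \<in> power_set (monomials V - {0}) n" for \<alpha> \<delta>
  proof -
    have \<delta>': "\<delta> \<in> monomials V" "n \<le> total_degree V \<delta>" using power_set_degree[OF \<delta>] by auto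
    have "\<exists>v\<in>V. k0 \<le> lookup \<delta> v"
    proof (rule ccontr)
      assume "\<not> (\<exists>v\<in>V. k0 \<le> lookup \<delta> v)"
      then have "total_degree V \<delta> \<le> card V * k0"
        unfolding total_degree_def using sum_bounded_above[of V "lookup \<delta>" k0] by force
      then show False using \<delta>'(2) by (simp add: n_def)
    qed
    then obtain v where v: "v \<in> V" "k0 \<le> lookup \<delta> v" by blast
    have "packs E (Suc t) (lookup (\<alpha> + \<delta>))"
      using k[OF \<alpha> v(1)]
      by (rule packs_mono) (use k0[OF \<alpha> v(1)] v(2) in \<open>auto simp: lookup_add\<close>)
    moreover have "\<alpha> \<in> monomials V" using \<alpha> p(2) by (auto simp: carrier_R supported_def)
    ultimately show ?thesis using \<delta>'(1) monomials_add by (simp add: packed_def)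
  qed
  then have *: "p * q \<in> supported (packed (Suc t))"
    if "q \<in> supported (power_set (monomials V - {0}) n)" for q
    by (intro supported_mult[of p "keys p" q, OF _ that]) (auto simp: supported_def)
  have "r \<otimes>\<^bsub>A\<^esub> x \<in> monomial_ideal (packed (Suc t))" if r: "r \<in> ideal_power A (monomial_ideal (monomials V - {0})) n" for r
  proof -
    have "r \<in> monomial_ideal (power_set (monomials V - {0}) n)" using r power_monomial_ideal[OF upward_maximal] by simp
    then obtain q u where q: "r = frac q u" "q \<in> carrier R" "u \<in> S"
      "q \<in> supported (power_set (monomials V - {0}) n)"
      unfolding monomial_ideal_def by blast
    have "q * p \<in> supported (packed (Suc t))" using *[OF q(4)] by (simp add: mult.commute)
    then show ?thesis
      using p q R_closed(2) S_closed by (simp add: frac_mult frac_in_monomial_ideal[OF upward_packed])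
  qed
  moreover have "x \<in> monomial_ideal (packed t)"
    using \<open>x \<in> monomial_ideal (saturated t)\<close> monomial_ideal_mono[of "saturated t" "packed t"] by (auto simp: saturated_def)
  ultimately show "x \<in> {a \<in> monomial_ideal (packed t).
      \<exists>k. \<forall>r\<in>ideal_power A (monomial_ideal (monomials V - {0})) k. r \<otimes>\<^bsub>A\<^esub> a \<in> monomial_ideal (packed (Suc t))}" by blast
next
  fix x assume x: "x \<in> {a \<in> monomial_ideal (packed t).
      \<exists>k. \<forall>r\<in>ideal_power A (monomial_ideal (monomials V - {0})) k. r \<otimes>\<^bsub>A\<^esub> a \<in> monomial_ideal (packed (Suc t))}"
  then obtain k where k: "\<And>r. r \<in> monomial_ideal (power_set (monomials V - {0}) k) \<Longrightarrow> r \<otimes>\<^bsub>A\<^esub> x \<in> monomial_ideal (packed (Suc t))"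
    unfolding power_monomial_ideal[OF upward_maximal] by blast
  obtain p s where p: "x = frac p s" "p \<in> carrier R" "s \<in> S" "p \<in> supported (packed t)"
    using x unfolding monomial_ideal_def by blast
  have "packs E (Suc t) ((lookup \<alpha>)(v := lookup \<alpha> v + k))"
    if \<alpha>: "\<alpha> \<in> keys p" and v: "v \<in> V" for \<alpha> v
  proof -
    \<comment> \<open>The test element is the \<open>k\<close>-th power of \<open>v\<close>.
      Multiplication by one monomial shifts the terms of \<open>p\<close> without
      cancellation.\<close>
    define \<delta> where "\<delta> = single v k"
    have \<delta>: "\<delta> \<in> power_set (monomials V - {0}) k" using single_power_set[OF v] by (simp add: \<delta>_def)
    then have R: "monomial \<delta> \<in> carrier R" using power_set_degree by (simp add: carrier_R)
    have "frac (monomial \<delta>) 1 \<in> monomial_ideal (power_set (monomials V - {0}) k)"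
      using \<delta> R S_1 by (simp add: frac_in_monomial_ideal[OF upward_power_set[OF upward_maximal]])
    from k[OF this] have "monomial \<delta> * p \<in> supported (packed (Suc t))"
      using p R S_1 R_closed(2) by (simp add: frac_mult frac_in_monomial_ideal[OF upward_packed])
    moreover have "lookup (monomial \<delta> * p) (\<delta> + \<alpha>) =
        lookup (monomial \<delta> :: ('v, 'k) mpoly) \<delta> * lookup p \<alpha>"
      by (rule lookup_mult_unique) auto
    then have "\<delta> + \<alpha> \<in> keys (monomial \<delta> * p)" using \<alpha> by (simp add: in_keys_iff)
    ultimately have "\<alpha> + \<delta> \<in> packed (Suc t)" by (auto simp: supported_def add.commute)
    then show ?thesis by (simp add: packed_def \<delta>_def lookup_add_single)
  qed
  then have "p \<in> supported (saturated t)"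
    using p(4) by (auto simp: supported_def saturated_def torsion_at_def)
  then show "x \<in> monomial_ideal (saturated t)" using p by (simp add: frac_in_monomial_ideal[OF upward_saturated])
qed

lemma module_length_local_cohomology:
  assumes "nodes G = V" "edges G = E"
  shows "module_length A (local_cohomology0 A (the_maximal_ideal A)
      (quotient_module (ideal_module A (ideal_power A (edge_ideal K G) t))
        (ideal_power A (edge_ideal K G) (t + 1)))) = enat (card (torsion V E t))"
proof -
  have "finite (saturated t - packed (Suc t))" "card (saturated t - packed (Suc t)) = card (torsion V E t)"
    using bij_betw_finite[OF bij_saturated] bij_betw_same_card[OF bij_saturated] finite_torsion by auto
  moreover have "ideal_power A (monomial_ideal (monomials V - {0})) k \<subseteq> carrier A" for k
    unfolding power_monomial_ideal[OF upward_maximal] by (rule monomial_ideal_subset)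
  ultimately show ?thesis
    unfolding edge_ideal_power[OF assms] the_maximal_ideal_A Suc_eq_plus1[symmetric]
    using A.local_cohomology_chains[OF ideal_monomial_ideal[OF upward_packed] ideal_monomial_ideal[OF upward_saturated]
        monomial_ideal_mono[OF packed_Suc_subset] torsion_monomial_ideal _ monomial_ideal_subset]
      Sup_ideal_chains[OF upward_packed upward_saturated packed_Suc_subset]
    by simp
qed

lemma j_multiplicity_edge_ideal:
  assumes "nodes G = V" "edges G = E"
    and "(\<lambda>t. fact (card V - 1) * (real (card (torsion V E t)) / real t ^ (card V - 1))) \<longlonglongrightarrow> l"
  shows "j_multiplicity A (edge_ideal K G) = ereal l"
proof -
  define d where "d = card V - 1"
  have "(\<lambda>t. fact d * (real (card (torsion V E t)) / real t ^ d) / fact d) \<longlonglongrightarrow> l / fact d"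
    using assms(3) unfolding d_def by (intro tendsto_divide tendsto_const) auto
  then have "(\<lambda>t. ereal (real (card (torsion V E t)) / real t ^ d)) \<longlonglongrightarrow> ereal (l / fact d)"
    by simp
  \<comment> \<open>At \<open>t = 0\<close> division by zero may differ between reals and extended
    reals, so the sequences are only compared for positive \<open>t\<close>.\<close>
  moreover have "\<forall>\<^sub>F t in sequentially. ereal (real (card (torsion V E t)) / real t ^ d) =
      ereal_of_enat (enat (card (torsion V E t))) / ereal (real t ^ d)"
    using eventually_gt_at_top[of 0] by eventually_elim simp
  ultimately have "(\<lambda>t. ereal_of_enat (enat (card (torsion V E t))) / ereal (real t ^ d)) \<longlonglongrightarrow> ereal (l / fact d)"
    by (rule Lim_transform_eventually)
  then have "lim (\<lambda>t. ereal_of_enat (enat (card (torsion V E t))) / ereal (real t ^ d)) = ereal (l / fact d)"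
    by (rule limI)
  then show ?thesis
    unfolding j_multiplicity_def krull_dim_A the_enat.simps Let_def d_def[symmetric]
      module_length_local_cohomology[OF assms(1,2)]
    by simp
qed

end

theorem proposition9p6:
  fixes G :: "'v hypergraph" and x :: 'v and m :: nat
  assumes "hypergraph G"
    and "card (nodes G) \<ge> 2"
    and "uniform m G"
    and "free_node G x"
  shows "j_multiplicity (local_mpoly_ring TYPE('k::field) (nodes G)) (edge_ideal TYPE('k) G)
       = j_multiplicity (local_mpoly_ring TYPE('k) (nodes (delete_node G x)))
           (edge_ideal TYPE('k) (delete_node G x))"
proof -
  obtain e0 where e0: "e0 \<in> edges G" "x \<in> e0" "\<And>e. e \<in> edges G \<Longrightarrow> x \<in> e \<Longrightarrow> e = e0"
    using assms(4) unfolding free_node_def by blast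
  have ne: "nodes G - {x} \<noteq> {}"
  proof
    assume "nodes G - {x} = {}"
    then have "card (nodes G) \<le> card {x}" by (intro card_mono) auto
    then show False using assms(2) by simp
  qed
  interpret free_vertex "nodes G" "edges G" m x e0
  proof unfold_locales
    show "finite (nodes G)" "nodes G \<noteq> {}" "edges G \<subseteq> Pow (nodes G)" "1 \<le> m"
      using assms(1,3) by (auto simp: hypergraph_def uniform_def)
    show "card e = m" if "e \<in> edges G" for e
      using assms(3) that by (simp add: uniform_def)
    show "e = e0" if "e \<in> edges G" "x \<in> e" for e using that by (rule e0(3))
  qed (rule e0(1) e0(2) ne)+
  interpret G: edge_polynomials "TYPE('k)" "nodes G" "edges G" m
    by unfold_locales (rule fin_V)
  interpret G': edge_polynomials "TYPE('k)" "nodes G - {x}" "{e \<in> edges G. x \<notin> e}" m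
    by unfold_locales (rule del.fin_V)
  \<comment> \<open>Both limits already contain their normalizing factorials, so \<open>l\<close> is
    the j-multiplicity on either side.\<close>
  obtain l where
    l: "(\<lambda>t. fact (card (nodes G) - 1) * (real (card (torsion (nodes G) (edges G) t))
        / real t ^ (card (nodes G) - 1))) \<longlonglongrightarrow> l"
      "(\<lambda>t. fact (card (nodes G - {x}) - 1) * (real (card (torsion (nodes G - {x}) {e \<in> edges G. x \<notin> e} t))
        / real t ^ (card (nodes G - {x}) - 1))) \<longlonglongrightarrow> l"
    using torsion_limits by blast
  show ?thesis
    using G.j_multiplicity_edge_ideal[OF refl refl l(1)]
      G'.j_multiplicity_edge_ideal[of "delete_node G x", OF _ _ l(2)]
    by (simp add: delete_node_def)
qed

end
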